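(* Let $X\subset\mathbb{P}^4$ be a cubic threefold over $\mathbb{R}$. Assume that $X$ has no real singular points and that $X_{\mathbb{C}}$ has $2\mathsf{D}_4+2\mathsf{A}_1$-singularities. Then the following are equivalent: - $X$ is not rational over $\mathbb{R}$; - $X$ is not stably rational over $\mathbb{R}$; - $X$ contains only one real plane.
   Context: $X_{\mathbb{C}}$ denotes the base change of $X$ to $\mathbb{C}$. "$X_{\mathbb{C}}$ has $2\mathsf{D}_4+2\mathsf{A}_1$-singularities" means that its singular locus consists of exactly four points, two of type $\mathsf{D}_4$ (locally analytically $x^2+y^2+z^2w+w^3=0$) and two ordinary double points. A real plane is a plane in $X$ defined over $\mathbb{R}$. Stably rational over $\mathbb{R}$ means that $X\times\mathbb{P}^m$ is rational over $\mathbb{R}$ for some $m\ge 0$. *)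

theory Defs
  imports "HOL-Analysis.Analysis" "HOL-Library.Poly_Mapping"
begin

text \<open>
  Real varieties are handled through their complex points and polynomials with real
  coefficients. A real polynomial in variables of type \<open>'v\<close> is a finitely supported
  function from monomials \<open>'v \<Rightarrow>\<^sub>0 nat\<close> to coefficients.
\<close>

type_synonym 'v rpoly = "('v \<Rightarrow>\<^sub>0 nat) \<Rightarrow>\<^sub>0 real"

definition peval :: "'v rpoly \<Rightarrow> ('v \<Rightarrow> complex) \<Rightarrow> complex" where
  "peval p x = (\<Sum>m\<in>Poly_Mapping.keys p. of_real (Poly_Mapping.lookup p m) *
      (\<Prod>i\<in>Poly_Mapping.keys m. x i ^ Poly_Mapping.lookup m i))"

text \<open>
  A product of projective spaces is given by the set \<open>Bs\<close> of its blocks of homogeneous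
  coordinates, which are finite, nonempty and pairwise disjoint sets of variables, one for
  each factor: \<open>{{..n}}\<close> stands for \<open>P^n\<close> and \<open>{Inl ` {..n}, Inr ` {..m}}\<close> for
  \<open>P^n \<times> P^m\<close>. Subsets of such a product (over the complex numbers) are represented by the
  set of all homogeneous coordinate vectors of their points; variables outside the blocks
  get the value 0.
\<close>

definition hcoords :: "'v set set \<Rightarrow> ('v \<Rightarrow> complex) set" where
  "hcoords Bs = {x. (\<forall>B\<in>Bs. \<exists>i\<in>B. x i \<noteq> 0) \<and> (\<forall>i. i \<notin> \<Union>Bs \<longrightarrow> x i = 0)}"

definition same_point :: "'v set set \<Rightarrow> (('v \<Rightarrow> complex) \<times> ('v \<Rightarrow> complex)) set" where
  "same_point Bs = {(x, y). x \<in> hcoords Bs \<and> y \<in> hcoords Bs \<and>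
      (\<forall>B\<in>Bs. \<exists>c. c \<noteq> 0 \<and> (\<forall>i\<in>B. y i = c * x i))}"

definition multihomogeneous :: "'v set set \<Rightarrow> ('v set \<Rightarrow> nat) \<Rightarrow> 'v rpoly \<Rightarrow> bool" where
  "multihomogeneous Bs d p \<longleftrightarrow> (\<forall>m\<in>Poly_Mapping.keys p. Poly_Mapping.keys m \<subseteq> \<Union>Bs \<and>
      (\<forall>B\<in>Bs. (\<Sum>i\<in>B. Poly_Mapping.lookup m i) = d B))"

abbreviation proj_space :: "nat \<Rightarrow> nat set set" where
  "proj_space n \<equiv> {{..n}}"

abbreviation proj_prod :: "nat \<Rightarrow> nat \<Rightarrow> (nat + nat) set set" where
  "proj_prod n m \<equiv> {Inl ` {..n}, Inr ` {..m}}"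

definition zclosed :: "'v set set \<Rightarrow> ('v \<Rightarrow> complex) set \<Rightarrow> bool" where
  "zclosed Bs Z \<longleftrightarrow> (\<exists>S. (\<forall>s\<in>S. \<exists>d. multihomogeneous Bs d s) \<and>
      Z = {x\<in>hcoords Bs. \<forall>s\<in>S. peval s x = 0})"

definition dense_open_in ::
    "'v set set \<Rightarrow> ('v \<Rightarrow> complex) set \<Rightarrow> ('v \<Rightarrow> complex) set \<Rightarrow> bool" where
  "dense_open_in Bs U X \<longleftrightarrow> (\<exists>Z. zclosed Bs Z \<and> U = X - Z) \<and>
      (\<forall>Z. zclosed Bs Z \<longrightarrow> U \<subseteq> Z \<longrightarrow> X \<subseteq> Z)"

text \<open>
  A rational map over the reals into the product with blocks \<open>Cs\<close> is given by one real
  form for each target coordinate, where the forms belonging to one factor have the same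
  multidegree; it is defined where, for each factor, they do not all vanish.
\<close>

definition rational_map_forms :: "'v set set \<Rightarrow> 'w set set \<Rightarrow> ('w \<Rightarrow> 'v rpoly) \<Rightarrow> bool" where
  "rational_map_forms Bs Cs G \<longleftrightarrow> (\<forall>C\<in>Cs. \<exists>d. \<forall>j\<in>C. multihomogeneous Bs d (G j))"

definition apply_forms :: "'w set set \<Rightarrow> ('w \<Rightarrow> 'v rpoly) \<Rightarrow> ('v \<Rightarrow> complex) \<Rightarrow> 'w \<Rightarrow> complex" where
  "apply_forms Cs G x = (\<lambda>j. if j \<in> \<Union>Cs then peval (G j) x else 0)"

text \<open>
  \<open>X\<close> and \<open>Y\<close> are meant to be (the complex points of) closed subvarieties that are reduced
  and irreducible over the reals, so that one tuple of forms suffices for a rational map.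
  Membership of the image in \<open>V\<close> or \<open>U\<close> entails that the map is defined there.
\<close>

definition birational_over_R ::
    "'v set set \<Rightarrow> ('v \<Rightarrow> complex) set \<Rightarrow> 'w set set \<Rightarrow> ('w \<Rightarrow> complex) set \<Rightarrow> bool" where
  "birational_over_R Bs X Cs Y \<longleftrightarrow>
    (\<exists>G H U V. rational_map_forms Bs Cs G \<and> rational_map_forms Cs Bs H \<and>
      dense_open_in Bs U X \<and> dense_open_in Cs V Y \<and>
      (\<forall>x\<in>U. apply_forms Cs G x \<in> V \<and>
         (x, apply_forms Bs H (apply_forms Cs G x)) \<in> same_point Bs) \<and>
      (\<forall>y\<in>V. apply_forms Bs H y \<in> U \<and>
         (y, apply_forms Cs G (apply_forms Bs H y)) \<in> same_point Cs))"

definition cubic_threefold :: "nat rpoly \<Rightarrow> bool" where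
  "cubic_threefold F \<longleftrightarrow> F \<noteq> 0 \<and> multihomogeneous (proj_space 4) (\<lambda>_. 3) F"

definition complex_points :: "nat rpoly \<Rightarrow> (nat \<Rightarrow> complex) set" where
  "complex_points F = {x \<in> hcoords (proj_space 4). peval F x = 0}"

definition rational_threefold :: "nat rpoly \<Rightarrow> bool" where
  "rational_threefold F \<longleftrightarrow> birational_over_R
     (proj_space 4) (complex_points F) (proj_space 3) (hcoords (proj_space 3))"

definition stably_rational_threefold :: "nat rpoly \<Rightarrow> bool" where
  "stably_rational_threefold F \<longleftrightarrow> (\<exists>m. birational_over_R
     (proj_prod 4 m) {case_sum x y | x y. x \<in> complex_points F \<and> y \<in> hcoords (proj_space m)}
     (proj_space (3 + m)) (hcoords (proj_space (3 + m))))"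

text \<open>The complex points of a plane in \<open>P^4\<close> defined over the reals, as the span of three
  real vectors.\<close>

definition real_plane :: "(nat \<Rightarrow> complex) set \<Rightarrow> bool" where
  "real_plane L \<longleftrightarrow> (\<exists>a b c :: nat \<Rightarrow> real.
      (\<forall>i>4. a i = 0 \<and> b i = 0 \<and> c i = 0) \<and>
      (\<forall>s t u. (\<forall>i. s * a i + t * b i + u * c i = 0) \<longrightarrow> s = 0 \<and> t = 0 \<and> u = 0) \<and>
      L = {x \<in> hcoords (proj_space 4). \<exists>s t u :: complex.
            x = (\<lambda>i. s * of_real (a i) + t * of_real (b i) + u * of_real (c i))})"

definition contains_real_plane :: "nat rpoly \<Rightarrow> (nat \<Rightarrow> complex) set \<Rightarrow> bool" where
  "contains_real_plane F L \<longleftrightarrow> real_plane L \<and> L \<subseteq> complex_points F"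

definition singular_coords :: "nat rpoly \<Rightarrow> (nat \<Rightarrow> complex) set" where
  "singular_coords F = {x \<in> complex_points F.
      \<forall>i\<le>4. deriv (\<lambda>t. peval F (x(i := t))) (x i) = 0}"

text \<open>The singular locus as a set of points, that is, of classes of coordinate vectors.\<close>

definition singular_locus :: "nat rpoly \<Rightarrow> (nat \<Rightarrow> complex) set set" where
  "singular_locus F = singular_coords F // same_point (proj_space 4)"

definition real_point :: "(nat \<Rightarrow> complex) set \<Rightarrow> bool" where
  "real_point P \<longleftrightarrow> (\<exists>x\<in>P. \<forall>i. x i \<in> \<real>)"

text \<open>The affine chart of \<open>P^4\<close> on which the coordinate with index \<open>i\<close> is 1; the four
  affine coordinates are indexed by 1, 2, 3, 4.\<close>

definition affine_chart :: "nat \<Rightarrow> complex^4 \<Rightarrow> nat \<Rightarrow> complex" where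
  "affine_chart i q = (\<lambda>j. if j = i then 1 else if j > 4 then 0
      else if j < i then q $ of_nat (j + 1) else q $ of_nat j)"

definition mholomorphic_on :: "(complex^'n \<Rightarrow> complex) \<Rightarrow> (complex^'n) set \<Rightarrow> bool" where
  "mholomorphic_on f S \<longleftrightarrow> (\<forall>z\<in>S. \<exists>D. (f has_derivative D) (at z) \<and>
      (\<forall>c v. D (c *s v) = c * D v))"

definition biholomorphism ::
    "(complex^'n) set \<Rightarrow> (complex^'n) set \<Rightarrow> (complex^'n \<Rightarrow> complex^'n) \<Rightarrow> bool" where
  "biholomorphism W V \<phi> \<longleftrightarrow> open W \<and> open V \<and> (\<exists>\<psi>. homeomorphism W V \<phi> \<psi> \<and>
      (\<forall>k. mholomorphic_on (\<lambda>z. \<phi> z $ k) W) \<and> (\<forall>k. mholomorphic_on (\<lambda>z. \<psi> z $ k) V))"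

text \<open>
  At the point \<open>P\<close>, the hypersurface \<open>F = 0\<close> is given locally analytically by \<open>g = 0\<close>.
  The unit \<open>u\<close> makes this an isomorphism of analytic space germs, not just of their
  underlying sets.
\<close>

definition locally_analytically ::
    "nat rpoly \<Rightarrow> (nat \<Rightarrow> complex) set \<Rightarrow> (complex^4 \<Rightarrow> complex) \<Rightarrow> bool" where
  "locally_analytically F P g \<longleftrightarrow> (\<exists>i\<le>4. \<exists>W V \<phi> u.
      biholomorphism W V \<phi> \<and> 0 \<in> W \<and> affine_chart i (\<phi> 0) \<in> P \<and>
      mholomorphic_on u W \<and> (\<forall>z\<in>W. u z \<noteq> 0) \<and>
      (\<forall>z\<in>W. peval F (affine_chart i (\<phi> z)) = u z * g z))"

definition D4_singularity :: "nat rpoly \<Rightarrow> (nat \<Rightarrow> complex) set \<Rightarrow> bool" where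
  "D4_singularity F P \<longleftrightarrow> locally_analytically F P
     (\<lambda>z. (z $ 1)^2 + (z $ 2)^2 + (z $ 3)^2 * z $ 4 + (z $ 4)^3)"

definition A1_singularity :: "nat rpoly \<Rightarrow> (nat \<Rightarrow> complex) set \<Rightarrow> bool" where
  "A1_singularity F P \<longleftrightarrow> locally_analytically F P
     (\<lambda>z. (z $ 1)^2 + (z $ 2)^2 + (z $ 3)^2 + (z $ 4)^2)"

definition has_2D4_2A1_singularities :: "nat rpoly \<Rightarrow> bool" where
  "has_2D4_2A1_singularities F \<longleftrightarrow> (\<exists>P1 P2 Q1 Q2.
      distinct [P1, P2, Q1, Q2] \<and> singular_locus F = {P1, P2, Q1, Q2} \<and>
      D4_singularity F P1 \<and> D4_singularity F P2 \<and>
      A1_singularity F Q1 \<and> A1_singularity F Q2)"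

end

theory Submission
  imports Defs "HOL-Computational_Algebra.Polynomial_Factorial"
    "HOL-Computational_Algebra.Field_as_Ring" "HOL-Library.Function_Algebras"
begin

text \<open>
  In suitable real coordinates the threefold is
  \<open>Y (X\<^sub>0\<^sup>2 + X\<^sub>1\<^sup>2) + L (Y\<^sup>2 + M\<^sup>2 + a L Y + c L\<^sup>2) = 0\<close> with \<open>c \<noteq> 0\<close> and \<open>a\<^sup>2 \<noteq> 4 c\<close>:
  the two \<open>D\<^sub>4\<close>-points are conjugate and the quadratic parts at them are divisible by a common
  real linear form \<open>Y\<close>, and the two other singular points are conjugate and span the real line
  \<open>X\<^sub>0 = X\<^sub>1 = L = 0\<close>, which lies on the threefold.
  The plane \<open>Y = L = 0\<close> is always real. If \<open>c < 0\<close>, there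
  are two further real planes, and projecting from one of them fibres the threefold into quadric
  surfaces with a section, so that it is rational. If \<open>c > 0\<close>, there is no other real plane, and
  the Brauer class of the quaternion algebra \<open>(-1, L/Y)\<close> is unramified but not constant. If the
  threefold were stably rational, we could join a real point to the generic point by a line in a
  projective space; an unramified class is constant on this line, so \<open>L/Y\<close> would be a real multiple
  of a norm from the complex function field. Descent in this field, which is a rational function
  field in one variable over \<open>\<complex>(l, m)\<close>, shows that this is impossible.
\<close>

section \<open>Sums of two squares up to an involution\<close>

text \<open>Brauer classes occur only through norms: (-1, x) is trivial if and only if x is a norm
  from the extension by i. The class is unramified because c = g^2 is a square: at a prime where Y
  and L have different orders, Y^2 + M^2 + a L Y + c L^2 is a sum of two squares, one of them Y^2 or
  (g L)^2, plus terms of higher order. So it has even order, and the equation gives Y L even order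
  too. That the class is not constant rests on a case of Witt's theorem, which the descent proves
  directly. Put l = L/Y, m = M/Y; the threefold is the conic X0^2 + X1^2 = f over R(l, m) with f = -
  l q, q irreducible. A class of R(l, m) that dies on the conic is 0 or (-1, f). For real r, the
  element r l has odd order along l = 0 and r l f has odd order along q = 0, so neither is a norm. A
  factor P^m is removed by restricting to a real point of it, which leaves the threefold as a
  retract of a projective space. The obstacle is that the maps are known at complex points only,
  whereas the argument lives in a function field; hence real forms are evaluated in many rings and
  identities are carried over by polynomials in l, m, z.\<close>

locale ring_map =
  fixes h :: "'a::comm_ring_1 \<Rightarrow> 'b::comm_ring_1"
  assumes map_add: "h (x + y) = h x + h y"
    and map_mult: "h (x * y) = h x * h y"
    and map_one: "h 1 = 1"
begin

lemma map_zero: "h 0 = 0"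
  using map_add[of 0 0] by simp

lemma map_uminus: "h (- x) = - h x"
  using map_add[of x "- x"] map_zero by (simp add: eq_neg_iff_add_eq_0 add.commute)

lemma map_diff: "h (x - y) = h x - h y"
  using map_add[of x "- y"] map_uminus by simp

lemma map_power: "h (x ^ n) = h x ^ n"
  by (induction n) (simp_all add: map_one map_mult)

lemma map_sum: "h (sum f A) = (\<Sum>a\<in>A. h (f a))"
  by (induction A rule: infinite_finite_induct) (simp_all add: map_zero map_add)

lemma map_prod: "h (prod f A) = (\<Prod>a\<in>A. h (f a))"
  by (induction A rule: infinite_finite_induct) (simp_all add: map_one map_mult)

lemma map_numeral: "h (numeral n) = numeral n"
proof -
  have nat: "h (of_nat k) = of_nat k" for k
    by (induction k) (simp_all add: map_zero map_one map_add)
  show ?thesis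
    using nat[of "numeral n"] by simp
qed

lemma map_dvd: "a dvd b \<Longrightarrow> h a dvd h b"
  by (auto simp: dvd_def map_mult)

lemma ring_map_poly: "ring_map (map_poly h)"
proof
  fix p q :: "'a poly"
  show "map_poly h (p + q) = map_poly h p + map_poly h q"
    by (rule poly_eqI) (simp add: coeff_map_poly map_zero map_add)
  show "map_poly h (p * q) = map_poly h p * map_poly h q"
    by (rule poly_eqI) (simp add: coeff_map_poly map_zero coeff_mult map_sum map_mult)
  show "map_poly h 1 = 1"
    by (simp add: map_one)
qed

lemma map_eval: "h (poly p x) = poly (map_poly h p) (h x)"
  by (induction p) (simp_all add: map_zero map_add map_mult map_poly_pCons)

lemmas map_simps = map_add map_mult map_one map_zero map_uminus map_diff map_power map_sum
  map_prod map_numeral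

end

lemma ring_map_comp: "ring_map f \<Longrightarrow> ring_map g \<Longrightarrow> ring_map (\<lambda>x. g (f x))"
  by (simp add: ring_map_def)

lemma ring_map_to_fract: "ring_map to_fract"
  by (simp add: ring_map_def)

lemma ring_map_const_poly: "ring_map (\<lambda>c. [:c:])"
  by (simp add: ring_map_def)

lemma ring_map_eval: "ring_map (\<lambda>p. poly p x)"
  by (simp add: ring_map_def)

lemma ring_map_of_real: "ring_map (of_real :: real \<Rightarrow> 'a::{real_algebra_1, comm_ring_1})"
  by (simp add: ring_map_def)

lemma ring_map_cnj: "ring_map cnj"
  by (simp add: ring_map_def)

section \<open>Orders of polynomials at a prime, and norms\<close>

locale poly_prime =
  fixes \<pi> :: "'k::field poly"
  assumes prime: "prime_elem \<pi>"
begin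

definition val :: "'k poly \<Rightarrow> nat" where
  "val x = (GREATEST n. \<pi> ^ n dvd x)"

lemma degree_pos: "degree \<pi> > 0"
  using prime by (auto simp: prime_elem_def is_unit_iff_degree)

lemma power_dvd_bound: "x \<noteq> 0 \<Longrightarrow> \<pi> ^ n dvd x \<Longrightarrow> n \<le> degree x"
proof -
  assume "x \<noteq> 0" "\<pi> ^ n dvd x"
  then have "degree (\<pi> ^ n) \<le> degree x"
    by (rule dvd_imp_degree_le[rotated])
  moreover have "degree (\<pi> ^ n) = n * degree \<pi>"
    using degree_pos by (intro degree_power_eq) auto
  moreover have "n \<le> n * degree \<pi>"
    using degree_pos by simp
  ultimately show ?thesis
    by linarith
qed

lemma val_dvd: "x \<noteq> 0 \<Longrightarrow> \<pi> ^ val x dvd x"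
  unfolding val_def by (rule GreatestI_nat[where k = 0 and b = "degree x"]) (auto intro: power_dvd_bound)

lemma power_dvd_iff: "x \<noteq> 0 \<Longrightarrow> \<pi> ^ n dvd x \<longleftrightarrow> n \<le> val x"
proof
  assume "x \<noteq> 0" "\<pi> ^ n dvd x"
  then show "n \<le> val x"
    unfolding val_def by (intro Greatest_le_nat[where b = "degree x"]) (auto intro: power_dvd_bound)
next
  assume "x \<noteq> 0" "n \<le> val x"
  then show "\<pi> ^ n dvd x"
    using val_dvd le_imp_power_dvd dvd_trans by blast
qed

lemma val_decompose:
  assumes "x \<noteq> 0"
  obtains y where "x = \<pi> ^ val x * y" "\<not> \<pi> dvd y"
proof -
  from val_dvd[OF assms] obtain y where y: "x = \<pi> ^ val x * y"
    by (auto simp: dvd_def)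
  have "\<not> \<pi> dvd y"
  proof
    assume "\<pi> dvd y"
    then have "\<pi> ^ Suc (val x) dvd x"
      by (subst y) (simp add: mult.commute mult_dvd_mono)
    then show False
      using power_dvd_iff[OF assms, of "Suc (val x)"] by simp
  qed
  with y that show ?thesis
    by blast
qed

lemma val_eqI: "x = \<pi> ^ n * y \<Longrightarrow> \<not> \<pi> dvd y \<Longrightarrow> val x = n"
proof -
  assume x: "x = \<pi> ^ n * y" and y: "\<not> \<pi> dvd y"
  have nz: "\<pi> \<noteq> 0"
    using degree_pos by auto
  then have x0: "x \<noteq> 0"
    using x y by auto
  have "n \<le> val x"
    using power_dvd_iff[OF x0, of n] x by (metis dvd_triv_left)
  moreover have "\<not> Suc n \<le> val x"
  proof
    assume "Suc n \<le> val x"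
    then have "\<pi> ^ n * \<pi> dvd \<pi> ^ n * y"
      using power_dvd_iff[OF x0, of "Suc n"] x by (simp add: mult.commute)
    then have "\<pi> dvd y"
      using nz by simp
    with y show False ..
  qed
  ultimately show ?thesis
    by simp
qed

lemma val_mult: "x \<noteq> 0 \<Longrightarrow> y \<noteq> 0 \<Longrightarrow> val (x * y) = val x + val y"
proof -
  assume "x \<noteq> 0" "y \<noteq> 0"
  then obtain x' y' where x': "x = \<pi> ^ val x * x'" "\<not> \<pi> dvd x'"
    and y': "y = \<pi> ^ val y * y'" "\<not> \<pi> dvd y'"
    using val_decompose by metis
  have "x * y = \<pi> ^ (val x + val y) * (x' * y')"
    by (subst x'(1), subst y'(1)) (simp add: power_add mult_ac)
  moreover have "\<not> \<pi> dvd x' * y'"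
    using prime x'(2) y'(2) prime_elem_dvd_mult_iff by blast
  ultimately show ?thesis
    by (rule val_eqI)
qed

lemma val_add_high:
  assumes "x \<noteq> 0" "\<pi> ^ Suc (val x) dvd c"
  shows "x + c \<noteq> 0 \<and> val (x + c) = val x"
proof -
  obtain y where y: "x = \<pi> ^ val x * y" "\<not> \<pi> dvd y"
    using val_decompose assms by metis
  obtain d where "c = \<pi> ^ Suc (val x) * d"
    using assms by (auto simp: dvd_def)
  then have c: "x + c = \<pi> ^ val x * (y + \<pi> * d)"
    using y(1) by (metis (no_types, lifting) distrib_left mult.assoc power_Suc2)
  have "\<not> \<pi> dvd y + \<pi> * d"
    using y(2) by (simp add: dvd_add_left_iff)
  with c show ?thesis
    using val_eqI degree_pos by auto
qed

end

text \<open>The field is the extension of the fixed field of \<open>\<sigma>\<close> by a square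
  root of -1, with \<open>\<sigma>\<close> as conjugation, so that \<open>x * \<sigma> x\<close> is
  a sum of two squares of fixed elements.\<close>

locale field_involution = ring_map \<sigma> for \<sigma> :: "'k::field \<Rightarrow> 'k" +
  fixes \<iota> :: 'k
  assumes invol: "\<sigma> (\<sigma> x) = x"
    and unit_sq: "\<iota> * \<iota> = - 1"
    and map_unit: "\<sigma> \<iota> = - \<iota>"
    and two_nz: "(2::'k) \<noteq> 0"
begin

abbreviation bar :: "'k poly \<Rightarrow> 'k poly" where
  "bar \<equiv> map_poly \<sigma>"

sublocale bar: ring_map bar
  by (rule ring_map_poly)

lemma bar_bar: "bar (bar p) = p"
  by (rule poly_eqI) (simp add: coeff_map_poly map_zero invol)

lemma map_eq_0_iff: "\<sigma> x = 0 \<longleftrightarrow> x = 0"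
  by (metis invol map_zero)

lemma bar_eq_0_iff: "bar p = 0 \<longleftrightarrow> p = 0"
  by (metis bar_bar bar.map_zero)

lemma bar_smult: "bar (smult c p) = smult (\<sigma> c) (bar p)"
  by (simp add: map_poly_smult map_zero map_mult)

lemma degree_bar: "degree (bar p) = degree p"
  by (simp add: degree_map_poly map_eq_0_iff)

lemma irreducible_bar: "irreducible p \<Longrightarrow> irreducible (bar p)"
proof (rule irreducibleI)
  assume p: "irreducible p"
  then show "bar p \<noteq> 0"
    by (auto simp: bar_eq_0_iff)
  show "\<not> bar p dvd 1"
    using p bar.map_dvd[of "bar p" 1] by (auto simp: bar_bar bar.map_one irreducible_def)
  fix a b assume "bar p = a * b"
  then have "p = bar a * bar b"
    by (metis bar_bar bar.map_mult)
  then have "bar a dvd 1 \<or> bar b dvd 1"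
    using p by (auto simp: irreducible_def)
  then show "a dvd 1 \<or> b dvd 1"
    using bar.map_dvd by (metis bar_bar bar.map_one)
qed

end

text \<open>At such a prime \<open>x\<close> and \<open>bar x\<close> have the same order, so norms
  have even order. At a prime that is not associated to its conjugate a norm may have odd
  order.\<close>

locale self_conjugate_prime = field_involution \<sigma> \<iota> + poly_prime \<pi>
  for \<sigma> :: "'k::field \<Rightarrow> 'k" and \<iota> and \<pi> :: "'k poly" +
  assumes self: "\<pi> dvd bar \<pi>"
begin

lemma dvd_bar: "\<pi> ^ n dvd x \<Longrightarrow> \<pi> ^ n dvd bar x"
  using bar.map_dvd[of "\<pi> ^ n" x] dvd_power_same[OF self, of n] dvd_trans
  by (metis bar.map_power)

lemma val_bar: "x \<noteq> 0 \<Longrightarrow> val (bar x) = val x"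
  using power_dvd_iff[of x] power_dvd_iff[of "bar x"] dvd_bar[of _ x] dvd_bar[of _ "bar x"]
  by (metis antisym bar_bar bar_eq_0_iff order_refl)

lemma val_norm_even: "x \<noteq> 0 \<Longrightarrow> even (val (x * bar x))"
  by (simp add: val_mult val_bar bar_eq_0_iff)

text \<open>A sum of two squares of fixed elements is a norm, and adding a term of higher order than
  \<open>A\<^sup>2\<close> does not change its order, because that order is at most twice that of \<open>A\<close>.\<close>

lemma sum_squares_val_even:
  assumes A: "bar A = A" "A \<noteq> 0" and B: "bar B = B" and C: "\<pi> ^ Suc (2 * val A) dvd C"
  shows "A\<^sup>2 + B\<^sup>2 + C \<noteq> 0 \<and> even (val (A\<^sup>2 + B\<^sup>2 + C))"
proof -
  define D where "D = A + [:\<iota>:] * B"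
  have i2: "[:\<iota>:] * [:\<iota>:] = (- 1 :: 'k poly)"
    by (simp add: unit_sq one_pCons)
  have barD: "bar D = A - [:\<iota>:] * B"
    using A B by (simp add: D_def bar.map_add bar_smult map_unit)
  have DD: "D * bar D = A\<^sup>2 + B\<^sup>2"
  proof -
    have "D * bar D = A\<^sup>2 - ([:\<iota>:] * [:\<iota>:]) * B\<^sup>2"
      by (subst barD) (simp add: D_def algebra_simps power2_eq_square)
    then show ?thesis
      unfolding i2 by simp
  qed
  have sum: "D + bar D = [:2:] * A"
    by (subst barD) (simp add: D_def numeral_poly algebra_simps)
  have D0: "D \<noteq> 0"
    using sum A two_nz by (auto simp: bar.map_zero)
  have "val D \<le> val A"
  proof -
    have "\<pi> ^ val D dvd D + bar D"
      using val_dvd[OF D0] dvd_bar dvd_add by blast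
    then have "\<pi> ^ val D dvd A"
      unfolding sum using two_nz by (simp add: dvd_smult_iff)
    then show ?thesis
      using power_dvd_iff A by blast
  qed
  then have "val (D * bar D) \<le> 2 * val A"
    by (simp add: val_mult D0 val_bar bar_eq_0_iff)
  then have "\<pi> ^ Suc (val (D * bar D)) dvd C"
    using C dvd_trans le_imp_power_dvd Suc_le_mono by metis
  moreover have "D * bar D \<noteq> 0"
    using D0 by (simp add: bar_eq_0_iff)
  ultimately show ?thesis
    using val_add_high[of "D * bar D" C] val_norm_even[OF D0] unfolding DD by metis
qed

text \<open>Suppose the orders of \<open>Y\<close> and \<open>L\<close> differ. If \<open>Y\<close>
  has the smaller order, then \<open>Y\<^sup>2\<close> dominates \<open>L * Y\<close> and
  \<open>L\<^sup>2\<close>, and the second factor \<open>Q\<close> is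
  \<open>Y\<^sup>2 + M\<^sup>2\<close> up to higher order; otherwise it is
  \<open>([:g:] * L)\<^sup>2 + M\<^sup>2\<close> up to higher order. Either way \<open>Q\<close> has
  even order, and comparing orders in Y * norm = - L * Q gives the claim. The last coefficient has
  to be a square for this.\<close>

lemma val_norm_form_even:
  assumes fixed: "bar X0 = X0" "bar X1 = X1" "bar Y = Y" "bar L = L" "bar M = M" "\<sigma> g = g"
    and g: "g \<noteq> 0" and YL: "Y \<noteq> 0" "L \<noteq> 0"
    and eq: "Y * (X0\<^sup>2 + X1\<^sup>2) + L * (Y\<^sup>2 + M\<^sup>2 + [:a:] * L * Y + [:g:]\<^sup>2 * L\<^sup>2) = 0"
  shows "even (val (Y * L))"
proof (cases "val Y = val L")
  case True
  then show ?thesis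
    using YL by (simp add: val_mult)
next
  case False
  define Q where "Q = Y\<^sup>2 + M\<^sup>2 + [:a:] * L * Y + [:g:]\<^sup>2 * L\<^sup>2"
  have Q: "Q \<noteq> 0 \<and> even (val Q)"
  proof (cases "val Y < val L")
    case True
    have "\<pi> ^ Suc (2 * val Y) dvd L * Y"
      using True YL by (subst power_dvd_iff) (auto simp: val_mult)
    moreover have "\<pi> ^ Suc (2 * val Y) dvd L * L"
      using True YL by (subst power_dvd_iff) (auto simp: val_mult)
    ultimately have "\<pi> ^ Suc (2 * val Y) dvd [:a:] * (L * Y) + [:g:]\<^sup>2 * (L * L)"
      by (rule dvd_add[OF dvd_mult dvd_mult])
    from sum_squares_val_even[OF fixed(3) YL(1) fixed(5) this] show ?thesis
      by (simp only: Q_def power2_eq_square power_mult_distrib mult_ac add_ac simp_thms)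
  next
    case 1: False
    have gL: "bar ([:g:] * L) = [:g:] * L" "[:g:] * L \<noteq> 0"
      using fixed g YL by (simp_all add: map_poly_smult map_zero map_mult)
    have "val [:g:] = 0"
      using g by (intro val_eqI[where y = "[:g:]"])
        (auto dest!: dvd_imp_degree_le simp: degree_pos[THEN gr_implies_not0])
    then have vgL: "val ([:g:] * L) = val L"
      using g YL val_mult[of "[:g:]" L] by simp
    have "\<pi> ^ Suc (2 * val L) dvd L * Y"
      using False 1 YL by (subst power_dvd_iff) (auto simp: val_mult)
    moreover have "\<pi> ^ Suc (2 * val L) dvd Y * Y"
      using False 1 YL by (subst power_dvd_iff) (auto simp: val_mult)
    ultimately have "\<pi> ^ Suc (2 * val ([:g:] * L)) dvd [:a:] * (L * Y) + (Y * Y)"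
      unfolding vgL by (rule dvd_add[OF dvd_mult])
    from sum_squares_val_even[OF gL fixed(5) this] show ?thesis
      by (simp only: Q_def power2_eq_square power_mult_distrib mult_ac add_ac simp_thms)
  qed
  define Z where "Z = X0 + [:\<iota>:] * X1"
  have N: "X0\<^sup>2 + X1\<^sup>2 = Z * bar Z"
    using fixed unit_sq
    by (simp add: Z_def bar.map_add bar_smult map_unit power2_eq_square algebra_simps)
  have "Y * (Z * bar Z) = - (L * Q)"
    using eq unfolding N Q_def[symmetric] by (simp only: eq_neg_iff_add_eq_0)
  moreover have "- (L * Q) \<noteq> 0"
    using Q YL by simp
  ultimately have Z0: "Z \<noteq> 0"
    by auto
  have "val (- (L * Q)) = val (L * Q)"
    unfolding val_def by simp
  then have "val Y + val (Z * bar Z) = val L + val Q"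
    using \<open>Y * (Z * bar Z) = - (L * Q)\<close> val_mult[of Y "Z * bar Z"] val_mult[of L Q] YL Q Z0
      bar_eq_0_iff by (metis mult_eq_0_iff)
  then have "even (val Y + val L)"
    using val_norm_even[OF Z0] Q by (metis even_add)
  then show ?thesis
    using YL by (simp add: val_mult)
qed

end

lemma irreducible_factor_exists:
  fixes p :: "'k::field poly"
  assumes "degree p > 0"
  obtains q where "irreducible q" "q dvd p" "degree q > 0"
proof -
  obtain q where q: "degree q > 0 \<and> q dvd p"
    and min: "\<And>r. degree r > 0 \<and> r dvd p \<Longrightarrow> degree q \<le> degree r"
    using ex_has_least_nat[of "\<lambda>q. degree q > 0 \<and> q dvd p" p degree] assms by (metis dvd_refl)
  have q0: "q \<noteq> 0"
    using q by auto
  have "irreducible q"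
  proof (rule irreducibleI)
    show "q \<noteq> 0" "\<not> q dvd 1"
      using q q0 by (auto simp: is_unit_iff_degree[OF q0])
    fix a b assume ab: "q = a * b"
    then have nz: "a \<noteq> 0" "b \<noteq> 0"
      using q0 by auto
    have "degree q = degree a + degree b"
      using nz by (simp add: ab degree_mult_eq)
    moreover have "degree a = 0 \<or> degree q \<le> degree a" "degree b = 0 \<or> degree q \<le> degree b"
      using min[of a] min[of b] q unfolding ab by (metis dvd_mult_left dvd_mult_right gr0I)+
    ultimately have "degree a = 0 \<or> degree b = 0"
      by linarith
    then show "a dvd 1 \<or> b dvd 1"
      using nz by (simp add: is_unit_iff_degree)
  qed
  with q that show ?thesis
    by blast
qed

context field_involution
begin

lemma self_conjugate_primeI: "prime_elem \<pi> \<Longrightarrow> \<pi> dvd bar \<pi> \<Longrightarrow> self_conjugate_prime \<sigma> \<iota> \<pi>"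
  by (simp add: self_conjugate_prime_def self_conjugate_prime_axioms_def poly_prime_def
      field_involution_axioms)

text \<open>Induction on the degree: for an irreducible factor \<open>\<pi>\<close>, the product
  \<open>\<pi> * bar \<pi>\<close> can be split off. If \<open>\<pi>\<close> is self-conjugate, even
  order yields a second factor \<open>\<pi>\<close>, which is \<open>bar \<pi>\<close> up to a unit;
  otherwise the conjugate is a different prime that divides \<open>p\<close> as well. The factor
  \<open>u\<close> absorbs the constants that arise on the way.\<close>

lemma norm_factorization:
  assumes "p \<noteq> 0" "bar p = smult u p"
    and "\<And>\<pi>. prime_elem \<pi> \<Longrightarrow> \<pi> dvd bar \<pi> \<Longrightarrow> even (poly_prime.val \<pi> p)"
  shows "\<exists>\<kappa> g. p = smult \<kappa> (g * bar g)"
  using assms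
proof (induction "degree p" arbitrary: p u rule: less_induct)
  case less
  show ?case
  proof (cases "degree p = 0")
    case True
    then obtain c where "p = [:c:]"
      using degree_eq_zeroE by blast
    then show ?thesis
      by (intro exI[of _ c] exI[of _ 1]) (simp add: map_one)
  next
    case False
    then obtain \<pi> where \<pi>: "irreducible \<pi>" "\<pi> dvd p" "degree \<pi> > 0"
      using irreducible_factor_exists by blast
    have prime: "prime_elem \<pi>" "prime_elem (bar \<pi>)"
      using \<pi> irreducible_bar field_poly_irreducible_imp_prime by blast+
    have \<pi>0: "\<pi> \<noteq> 0" "bar \<pi> \<noteq> 0"
      using \<pi> by (auto simp: bar_eq_0_iff)
    obtain c p' where c: "c \<noteq> 0" and p': "p = smult c (\<pi> * bar \<pi> * p')"
    proof (cases "\<pi> dvd bar \<pi>")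
      case True
      interpret pr: self_conjugate_prime \<sigma> \<iota> \<pi>
        using self_conjugate_primeI[OF prime(1) True] .
      have "pr.val p \<ge> 1"
        using pr.power_dvd_iff[of p 1] \<pi> less.prems by simp
      then have "pr.val p \<ge> 2"
        using less.prems(3)[OF prime(1) True] by (cases "pr.val p = 1") auto
      then have "\<pi> ^ 2 dvd p"
        using pr.power_dvd_iff less.prems by blast
      then obtain p' where p': "p = \<pi> * \<pi> * p'"
        by (auto simp: dvd_def power2_eq_square)
      obtain k where k: "bar \<pi> = \<pi> * k"
        using True by (auto simp: dvd_def)
      have "degree k = 0"
        using k \<pi>0 degree_bar[of \<pi>] degree_mult_eq[of \<pi> k] by auto
      then obtain d where d: "k = [:d:]"
        using degree_eq_zeroE by blast
      have "d \<noteq> 0"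
        using k d \<pi>0 by auto
      then show ?thesis
        using that[of "1 / d" p'] p' k d by simp
    next
      case False
      have "bar \<pi> dvd smult u p"
        using bar.map_dvd[OF \<pi>(2)] less.prems by simp
      moreover have "u \<noteq> 0"
        using less.prems bar_eq_0_iff[of p] by auto
      ultimately have dvd: "bar \<pi> dvd p"
        by (simp add: dvd_smult_iff)
      obtain q where q: "p = \<pi> * q"
        using \<pi> by (auto simp: dvd_def)
      have "\<not> bar \<pi> dvd \<pi>"
        using False bar.map_dvd[of "bar \<pi>" \<pi>] by (auto simp: bar_bar)
      then have "bar \<pi> dvd q"
        using dvd prime q prime_elem_dvd_mult_iff by blast
      then show ?thesis
        using that[of 1] q by (auto simp: dvd_def mult.assoc)
    qed
    have p'0: "p' \<noteq> 0"
      using p' less.prems by auto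
    have "degree p = degree \<pi> + degree \<pi> + degree p'"
      using p' c \<pi>0 p'0 by (simp add: degree_mult_eq degree_bar)
    then have deg: "degree p' < degree p"
      using \<pi> by simp
    have "smult (\<sigma> c) (\<pi> * bar \<pi> * bar p') = smult (u * c) (\<pi> * bar \<pi> * p')"
      using less.prems(2) unfolding p' by (simp add: bar_smult bar.map_mult bar_bar mult_ac)
    then have "(\<pi> * bar \<pi>) * smult (\<sigma> c) (bar p') = (\<pi> * bar \<pi>) * smult (u * c) p'"
      by simp
    then have "smult (\<sigma> c) (bar p') = smult (u * c) p'"
      using \<pi>0 by (metis mult_cancel_left mult_eq_0_iff)
    then have bar_p': "bar p' = smult (u * c / \<sigma> c) p'"
      using c map_eq_0_iff[of c]
      by (metis (no_types, lifting) divide_inverse_commute left_inverse smult_1_left smult_smult)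
    have "even (poly_prime.val \<rho> p')" if \<rho>: "prime_elem \<rho>" "\<rho> dvd bar \<rho>" for \<rho>
    proof -
      interpret pr: self_conjugate_prime \<sigma> \<iota> \<rho>
        using self_conjugate_primeI[OF \<rho>] .
      have "pr.val [:c:] = 0"
        using c by (intro pr.val_eqI[where y = "[:c:]"])
          (auto dest!: dvd_imp_degree_le simp: pr.degree_pos[THEN gr_implies_not0])
      moreover have "p = [:c:] * ((\<pi> * bar \<pi>) * p')"
        by (simp add: p')
      ultimately have "pr.val p = pr.val (\<pi> * bar \<pi>) + pr.val p'"
        using c \<pi>0 p'0 pr.val_mult[of "[:c:]" "\<pi> * bar \<pi> * p'"] pr.val_mult[of "\<pi> * bar \<pi>" p']
        by (metis add.left_neutral mult_eq_0_iff pCons_eq_0_iff)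
      then show ?thesis
        using less.prems(3)[OF \<rho>] pr.val_norm_even[OF \<pi>0(1)] by (metis even_add)
    qed
    from less.hyps[OF deg p'0 bar_p' this] obtain \<kappa> g where "p' = smult \<kappa> (g * bar g)"
      by blast
    then have "p = smult (c * \<kappa>) ((\<pi> * g) * bar (\<pi> * g))"
      by (simp add: p' bar.map_mult mult_ac)
    then show ?thesis
      by blast
  qed
qed

lemma map_divide: "\<sigma> (x / y) = \<sigma> x / \<sigma> y"
  by (metis (no_types, opaque_lifting) divide_eq_0_iff map_eq_0_iff map_mult
      nonzero_eq_divide_eq times_divide_eq_left nonzero_mult_div_cancel_right)

text \<open>The class of \<open>YL\<close> modulo norms is unramified on the affine line, hence constant.\<close>

lemma norm_form_line:
  assumes fixed: "bar X0 = X0" "bar X1 = X1" "bar Y = Y" "bar L = L" "bar M = M" "\<sigma> g = g"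
    and g: "g \<noteq> 0"
    and eq: "Y * (X0\<^sup>2 + X1\<^sup>2) + L * (Y\<^sup>2 + M\<^sup>2 + [:a:] * L * Y + [:g:]\<^sup>2 * L\<^sup>2) = 0"
    and nz: "poly (Y * L) 0 \<noteq> 0"
  shows "\<exists>w. poly (Y * L) 1 = poly (Y * L) 0 * (w * \<sigma> w)"
proof -
  have YL: "Y \<noteq> 0" "L \<noteq> 0"
    using nz by auto
  have "even (poly_prime.val \<pi> (Y * L))" if \<pi>: "prime_elem \<pi>" "\<pi> dvd bar \<pi>" for \<pi>
  proof -
    interpret pr: self_conjugate_prime \<sigma> \<iota> \<pi>
      using self_conjugate_primeI[OF \<pi>] .
    show ?thesis
      using pr.val_norm_form_even[OF fixed g YL eq] .
  qed
  moreover have "bar (Y * L) = smult 1 (Y * L)"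
    using fixed by (simp add: bar.map_mult)
  ultimately obtain \<kappa> h where h: "Y * L = smult \<kappa> (h * bar h)"
    using norm_factorization[of "Y * L" 1] YL by auto
  have "poly (bar h) 0 = \<sigma> (poly h 0)" "poly (bar h) 1 = \<sigma> (poly h 1)"
    using map_eval[of h 0] map_eval[of h 1] by (simp_all add: map_zero map_one)
  \<comment> \<open>The constant \<open>\<kappa>\<close> is unknown, but the value at 0 determines
    it up to a norm.\<close>
  then have v: "poly (Y * L) 0 = \<kappa> * (poly h 0 * \<sigma> (poly h 0))"
    "poly (Y * L) 1 = \<kappa> * (poly h 1 * \<sigma> (poly h 1))"
    unfolding h by simp_all
  have "poly h 0 \<noteq> 0" "\<sigma> (poly h 0) \<noteq> 0"
    using nz unfolding v(1) by auto
  then have "poly (Y * L) 1 = poly (Y * L) 0 * ((poly h 1 / poly h 0) * \<sigma> (poly h 1 / poly h 0))"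
    unfolding v map_divide by (simp add: field_simps)
  then show ?thesis
    by blast
qed

end

section \<open>Rational functions on a conic bundle\<close>

definition fract_lift :: "('a::idom \<Rightarrow> 'b::field) \<Rightarrow> 'a fract \<Rightarrow> 'b" where
  "fract_lift h x = (THE y. \<exists>a b. b \<noteq> 0 \<and> x = Fract a b \<and> y = h a / h b)"

locale fract_embedding = ring_map h for h :: "'a::idom \<Rightarrow> 'b::field" +
  assumes inj0: "h x = 0 \<Longrightarrow> x = 0"
begin

abbreviation lift :: "'a fract \<Rightarrow> 'b" where
  "lift \<equiv> fract_lift h"

lemma lift_Fract: "b \<noteq> 0 \<Longrightarrow> lift (Fract a b) = h a / h b"
  unfolding fract_lift_def
proof (rule the_equality)
  assume b: "b \<noteq> 0"
  then show "\<exists>c d. d \<noteq> 0 \<and> Fract a b = Fract c d \<and> h a / h b = h c / h d"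
    by blast
  fix y assume "\<exists>c d. d \<noteq> 0 \<and> Fract a b = Fract c d \<and> y = h c / h d"
  then obtain c d where d: "d \<noteq> 0" "Fract a b = Fract c d" and y: "y = h c / h d"
    by blast
  have "a * d = c * b"
    using b d by (simp add: eq_fract)
  then have "h a * h d = h c * h b"
    by (metis map_mult)
  moreover have "h b \<noteq> 0" "h d \<noteq> 0"
    using b d inj0 by blast+
  ultimately show "y = h a / h b"
    by (simp add: y frac_eq_eq)
qed

lemma lift_to_fract: "lift (to_fract a) = h a"
  by (simp add: to_fract_def lift_Fract map_one)

lemma ring_map_lift: "ring_map lift"
proof
  fix x y :: "'a fract"
  obtain a b where x: "x = Fract a b" "b \<noteq> 0"
    by (cases x)
  obtain c d where y: "y = Fract c d" "d \<noteq> 0"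
    by (cases y)
  have nz: "h b \<noteq> 0" "h d \<noteq> 0"
    using x y inj0 by auto
  show "lift (x + y) = lift x + lift y"
    using x y nz by (simp add: lift_Fract map_add map_mult field_simps)
  show "lift (x * y) = lift x * lift y"
    using x y nz by (simp add: lift_Fract map_mult)
  show "lift 1 = 1"
    using lift_to_fract[of 1] by (simp add: map_one)
qed

end

lemma monom_mult_decompose:
  fixes p :: "'a::idom poly"
  assumes "p \<noteq> 0"
  obtains n q where "p = monom 1 n * q" "coeff q 0 \<noteq> 0"
proof -
  obtain q where q: "p = [:- 0, 1:] ^ order 0 p * q" "\<not> [:- 0, 1:] dvd q"
    using order_decomp[OF assms, of 0] by blast
  have "monom 1 n = [:0, 1::'a:] ^ n" for n
    by (simp add: monom_altdef)
  moreover have "coeff q 0 \<noteq> 0"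
    using q(2) poly_eq_0_iff_dvd[of q 0] by (simp add: poly_0_coeff_0)
  ultimately show ?thesis
    using that q(1) by (metis minus_zero)
qed

text \<open>The function field \<open>k(z)\<close> of the conic \<open>z z' = f\<close> over \<open>k\<close>, with the involution that
  extends \<open>\<tau>\<close> and exchanges \<open>z\<close> and \<open>z' = f / z\<close>. For \<open>p\<close> prime to \<open>z\<close> the conjugate of \<open>p\<close> is
  \<open>star p / z ^ degree p\<close>.\<close>

locale conic_involution = ring_map \<tau> for \<tau> :: "'k::field \<Rightarrow> 'k" +
  fixes f :: 'k
  assumes invol: "\<tau> (\<tau> x) = x"
    and map_f: "\<tau> f = f"
    and f_nz: "f \<noteq> 0"
begin

lemma map_eq_0_iff: "\<tau> x = 0 \<longleftrightarrow> x = 0"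
  by (metis invol map_zero)

sublocale poly_map: ring_map "map_poly \<tau>"
  by (rule ring_map_poly)

abbreviation (input) const :: "'k \<Rightarrow> 'k poly fract" where
  "const c \<equiv> to_fract [:c:]"

abbreviation (input) z :: "'k poly fract" where
  "z \<equiv> to_fract [:0, 1:]"

lemma ring_map_const: "ring_map (\<lambda>c. const c)"
  by (rule ring_map_comp[OF ring_map_const_poly ring_map_to_fract])

definition conj :: "'k poly \<Rightarrow> 'k poly fract" where
  "conj p = poly (map_poly (\<lambda>c. const (\<tau> c)) p) (const f / z)"

definition star :: "'k poly \<Rightarrow> 'k poly" where
  "star p = reflect_poly (map_poly \<tau> p \<circ>\<^sub>p [:0, f:])"

lemma ring_map_conj: "ring_map conj"
  unfolding conj_def
  by (rule ring_map_comp[OF ring_map.ring_map_poly ring_map_eval])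
    (rule ring_map_comp[OF ring_map_axioms ring_map_const])

lemma star_mult: "star (p * q) = star p * star q"
  by (simp add: star_def poly_map.map_mult pcompose_mult reflect_poly_mult)

lemma coeff_twist: "coeff (map_poly \<tau> p \<circ>\<^sub>p [:0, f:]) i = f ^ i * \<tau> (coeff p i)"
  by (simp add: coeff_pcompose_linear coeff_map_poly map_zero)

lemma degree_twist: "degree (map_poly \<tau> p \<circ>\<^sub>p [:0, f:]) = degree p"
  using f_nz by (simp add: degree_pcompose degree_map_poly map_eq_0_iff)

lemma coeff_star: "coeff (star p) i = (if i > degree p then 0 else f ^ (degree p - i) * \<tau> (coeff p (degree p - i)))"
  by (simp add: star_def coeff_reflect_poly degree_twist coeff_twist)

lemma star_eq_0_iff: "star p = 0 \<longleftrightarrow> p = 0"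
proof -
  have "map_poly \<tau> p \<circ>\<^sub>p [:0, f:] = 0 \<longleftrightarrow> p = 0"
    by (auto simp: poly_eq_iff coeff_twist f_nz map_eq_0_iff)
  then show ?thesis
    by (simp add: star_def)
qed

lemma degree_star: "coeff p 0 \<noteq> 0 \<Longrightarrow> degree (star p) = degree p"
  unfolding star_def
  by (subst degree_reflect_poly_eq) (auto simp: coeff_twist degree_twist map_eq_0_iff simp del: coeff_pcompose_0)

lemma coeff_star_0: "p \<noteq> 0 \<Longrightarrow> coeff (star p) 0 \<noteq> 0"
  by (simp add: coeff_star f_nz map_eq_0_iff)

text \<open>Reflection loses the factors z of a polynomial, so the constant term must not
  vanish.\<close>

lemma star_star: "coeff p 0 \<noteq> 0 \<Longrightarrow> star (star p) = smult (f ^ degree p) p"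
proof (rule poly_eqI)
  fix i assume p: "coeff p 0 \<noteq> 0"
  show "coeff (star (star p)) i = coeff (smult (f ^ degree p) p) i"
  proof (cases "i > degree p")
    case True
    then show ?thesis
      using degree_star[OF p] by (simp add: coeff_star coeff_eq_0)
  next
    case False
    then have "f ^ degree p = f ^ (degree p - i) * f ^ i"
      by (simp flip: power_add)
    moreover have "\<not> degree p < degree p - i" "degree p - (degree p - i) = i"
      using False by auto
    ultimately show ?thesis
      using False degree_star[OF p] by (simp add: coeff_star map_mult map_power map_f invol)
  qed
qed

lemma conj_star: "p \<noteq> 0 \<Longrightarrow> z ^ degree p * conj p = to_fract (star p)"
proof -
  let ?q = "map_poly \<tau> p \<circ>\<^sub>p [:0, f:]"
  let ?C = "\<lambda>c::'k. const c"
  have const0: "?C c = 0 \<longleftrightarrow> c = 0" for c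
    by simp
  have "poly (map_poly ?C (reflect_poly ?q)) z = poly (reflect_poly (map_poly ?C ?q)) z"
  proof -
    have "map_poly ?C (reflect_poly ?q) = reflect_poly (map_poly ?C ?q)"
      by (rule poly_eqI) (simp add: coeff_map_poly coeff_reflect_poly degree_map_poly)
    then show ?thesis
      by simp
  qed
  also have "\<dots> = z ^ degree p * poly (map_poly ?C ?q) (inverse z)"
    by (subst poly_reflect_poly_nz) (simp_all add: degree_map_poly degree_twist)
  also have "poly (map_poly ?C ?q) (inverse z) = conj p"
  proof -
    have deg: "degree (map_poly ?C ?q) = degree p" "degree (map_poly (\<lambda>c. ?C (\<tau> c)) p) = degree p"
      by (simp_all add: degree_map_poly degree_twist map_eq_0_iff)
    show ?thesis
      unfolding conj_def poly_altdef deg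
      by (rule sum.cong)
        (simp_all add: coeff_map_poly coeff_twist map_zero field_simps power_divide
          ring_map.map_power[OF ring_map_const] ring_map.map_mult[OF ring_map_const] del: mult_pCons_left)
  qed
  also have "poly (map_poly ?C (reflect_poly ?q)) z = to_fract (star p)"
  proof -
    have "to_fract (poly (map_poly (\<lambda>c. [:c:]) r) [:0, 1:]) = poly (map_poly ?C r) z" for r :: "'k poly"
      by (subst ring_map.map_eval[OF ring_map_to_fract]) (simp add: map_poly_map_poly o_def)
    moreover have "poly (map_poly (\<lambda>c. [:c:]) r) [:0, 1:] = r" for r :: "'k poly"
      by (induction r) (simp_all add: map_poly_pCons)
    ultimately show ?thesis
      unfolding star_def by metis
  qed
  finally show ?thesis
    by simp
qed

sublocale conj: fract_embedding conj
proof -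
  interpret ring_map conj
    by (rule ring_map_conj)
  show "fract_embedding conj"
  proof
    fix p assume "conj p = 0"
    then have "p \<noteq> 0 \<Longrightarrow> to_fract (star p) = 0"
      using conj_star[of p] by simp
    then show "p = 0"
      by (auto simp: star_eq_0_iff)
  qed
qed

abbreviation \<sigma> :: "'k poly fract \<Rightarrow> 'k poly fract" where
  "\<sigma> \<equiv> fract_lift conj"

sublocale \<sigma>: ring_map \<sigma>
  by (rule conj.ring_map_lift)

lemma map_const: "\<sigma> (const c) = const (\<tau> c)"
  by (simp add: conj.lift_to_fract conj_def map_poly_pCons map_zero)

lemma map_z: "\<sigma> z = const f / z"
proof -
  have "const (\<tau> 1) = 1"
    by (simp add: map_one flip: one_pCons)
  then show ?thesis
    by (simp add: conj.lift_to_fract conj_def map_poly_pCons map_zero)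
qed

lemma map_divide: "\<sigma> (x / y) = \<sigma> x / \<sigma> y"
proof (cases "y = 0")
  case False
  have "\<sigma> y * \<sigma> (inverse y) = 1"
    using False by (simp flip: \<sigma>.map_mult add: \<sigma>.map_one)
  then have "\<sigma> (inverse y) = inverse (\<sigma> y)"
    using inverse_unique by metis
  then show ?thesis
    by (simp add: divide_inverse \<sigma>.map_mult)
qed (simp add: \<sigma>.map_zero)

lemma \<sigma>_invol: "\<sigma> (\<sigma> x) = x"
proof -
  have poly: "\<sigma> (\<sigma> (to_fract p)) = to_fract p" for p
  proof (induction p)
    case (pCons a p)
    have "to_fract (pCons a p) = const a + z * to_fract p"
      by (simp flip: to_fract_add to_fract_mult)
    then show ?case
      using pCons f_nz
      by (simp add: \<sigma>.map_add \<sigma>.map_mult map_const map_z map_divide map_f invol)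
  qed (simp add: \<sigma>.map_zero)
  obtain a b where "x = Fract a b" "b \<noteq> 0"
    by (cases x)
  then show ?thesis
    using poly by (simp add: Fract_conv_to_fract map_divide)
qed

end

context conic_involution
begin

text \<open>The prime factor \<open>p\<close> of \<open>g\<close> divides \<open>h\<close> or
  \<open>star h\<close>. In the second case \<open>star_star\<close> shows that
  \<open>star p\<close> divides \<open>h\<close>. In both cases \<open>p * star p\<close> cancels,
  in the second one at the price of a power of \<open>f\<close>.\<close>

lemma descent_step:
  assumes p: "irreducible p" "p dvd g" "degree p > 0"
    and g0: "coeff g 0 \<noteq> 0" and h0: "coeff h 0 \<noteq> 0" and deg: "degree g = degree h"
    and \<beta>: "\<beta> \<noteq> 0" and eq: "g * star g = smult \<beta> (h * star h)"
  shows "\<exists>g' h' n. coeff g' 0 \<noteq> 0 \<and> coeff h' 0 \<noteq> 0 \<and> degree g' = degree h' \<and>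
    degree g' < degree g \<and> g' * star g' = smult (\<beta> * f ^ n) (h' * star h')"
proof -
  have prime: "prime_elem p"
    using p by (simp add: field_poly_irreducible_imp_prime)
  obtain g' where g': "g = p * g'"
    using p by (auto simp: dvd_def)
  have c0: "coeff p 0 \<noteq> 0" "coeff g' 0 \<noteq> 0"
    using g0 by (auto simp: g' coeff_mult_0)
  have nz: "p \<noteq> 0" "g' \<noteq> 0" "star p \<noteq> 0" "h \<noteq> 0"
    using c0 h0 by (auto simp: star_eq_0_iff)
  have degg: "degree g = degree p + degree g'"
    using nz by (simp add: g' degree_mult_eq)
  have "p dvd h * star h"
    using eq p(2) \<beta> by (metis dvd_mult2 dvd_smult_iff)
  then consider "p dvd h" | "p dvd star h"
    using prime prime_elem_dvd_mult_iff by blast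
  then show ?thesis
  proof cases
    case 1
    then obtain h' where h': "h = p * h'"
      by (auto simp: dvd_def)
    have "(p * star p) * (g' * star g') = (p * star p) * smult \<beta> (h' * star h')"
      using eq by (simp add: g' h' star_mult mult_ac)
    then have eq': "g' * star g' = smult \<beta> (h' * star h')"
      using nz by (metis mult_cancel_left mult_eq_0_iff)
    have "coeff h' 0 \<noteq> 0" "h' \<noteq> 0"
      using h0 by (auto simp: h' coeff_mult_0)
    then show ?thesis
      using eq' c0 degg deg p(3) nz
      by (intro exI[of _ g'] exI[of _ h'] exI[of _ 0]) (auto simp: h' degree_mult_eq)
  next
    case 2
    then obtain q where q: "star h = p * q"
      by (auto simp: dvd_def)
    have "smult (f ^ degree h) h = star p * star q"
      using star_star[OF h0] by (simp add: q star_mult)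
    then have "star p dvd h"
      using f_nz by (metis dvd_smult_iff dvd_triv_left power_not_zero)
    then obtain h' where h': "h = star p * h'"
      by (auto simp: dvd_def)
    have "(p * star p) * (g' * star g') = (p * star p) * smult (\<beta> * f ^ degree p) (h' * star h')"
      using eq by (simp add: g' h' star_mult star_star[OF c0(1)] mult_ac)
    then have eq': "g' * star g' = smult (\<beta> * f ^ degree p) (h' * star h')"
      using nz by (metis mult_cancel_left mult_eq_0_iff)
    have "coeff h' 0 \<noteq> 0" "h' \<noteq> 0"
      using h0 by (auto simp: h' coeff_mult_0)
    then show ?thesis
      using eq' c0 degg deg p(3) nz degree_star[OF c0(1)]
      by (intro exI[of _ g'] exI[of _ h'] exI[of _ "degree p"]) (auto simp: h' degree_mult_eq)
  qed
qed

text \<open>The descent ends when both polynomials are constant; \<open>n\<close> collects the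
  powers of \<open>f\<close> from the steps.\<close>

lemma descent:
  assumes "coeff g 0 \<noteq> 0" "coeff h 0 \<noteq> 0" "degree g = degree h"
    and "\<beta> \<noteq> 0" "g * star g = smult \<beta> (h * star h)"
  shows "\<exists>c e n. c \<noteq> 0 \<and> e \<noteq> 0 \<and> c * \<tau> c = \<beta> * f ^ n * (e * \<tau> e)"
  using assms
proof (induction "degree g" arbitrary: g h \<beta> rule: less_induct)
  case less
  show ?case
  proof (cases "degree g = 0")
    case True
    then obtain c e where "g = [:c:]" "h = [:e:]"
      using less.prems degree_eq_zeroE by metis
    moreover have "star [:c:] = [:\<tau> c:]" for c
      by (simp add: star_def map_poly_pCons map_zero)
    ultimately have "c * \<tau> c = \<beta> * f ^ 0 * (e * \<tau> e)" "c \<noteq> 0" "e \<noteq> 0"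
      using less.prems by (simp_all add: mult.commute)
    then show ?thesis
      by blast
  next
    case False
    then obtain p where p: "irreducible p" "p dvd g" "degree p > 0"
      using irreducible_factor_exists by blast
    obtain g' h' n where *: "coeff g' 0 \<noteq> 0" "coeff h' 0 \<noteq> 0" "degree g' = degree h'"
      "degree g' < degree g" "g' * star g' = smult (\<beta> * f ^ n) (h' * star h')"
      using descent_step[OF p less.prems] by blast
    have "\<beta> * f ^ n \<noteq> 0"
      using less.prems f_nz by simp
    from less.hyps[OF *(4,1,2,3) this *(5)] show ?thesis
      by (metis mult.assoc power_add)
  qed
qed

text \<open>The irreducible factors of the numerator of \<open>w\<close> cancel against the conjugates of those of the
  denominator, which leaves an identity between constants.\<close>

lemma norm_over_conic:
  assumes \<rho>: "\<rho> \<noteq> 0" and w: "w * \<sigma> w = const \<rho>"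
  shows "\<exists>c e a b. c \<noteq> 0 \<and> e \<noteq> 0 \<and> c * \<tau> c * f ^ a = \<rho> * f ^ b * (e * \<tau> e)"
proof -
  obtain P R where PR: "w = Fract P R" "R \<noteq> 0"
    by (cases w)
  have "P \<noteq> 0"
    using w \<rho> PR by (auto simp: fract_collapse \<sigma>.map_zero)
  obtain a g where g: "P = monom 1 a * g" "coeff g 0 \<noteq> 0"
    using monom_mult_decompose[OF \<open>P \<noteq> 0\<close>] by blast
  obtain b h where h: "R = monom 1 b * h" "coeff h 0 \<noteq> 0"
    using monom_mult_decompose[OF \<open>R \<noteq> 0\<close>] by blast
  have nz: "g \<noteq> 0" "h \<noteq> 0" "star g \<noteq> 0" "star h \<noteq> 0"
    using g h by (auto simp: star_eq_0_iff)
  have monom: "to_fract (monom 1 n) = z ^ n" for n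
    by (simp add: ring_map.map_power[OF ring_map_to_fract, symmetric] monom_altdef)
  have conj: "conj q = to_fract (star q) / z ^ degree q" if "q \<noteq> 0" for q
    using conj_star[OF that] by (simp add: field_simps)
  \<comment> \<open>Since the norm of z is \<open>f\<close>, powers of z contribute only powers of
    \<open>f\<close>.\<close>
  have norm: "to_fract (monom 1 n * q) * \<sigma> (to_fract (monom 1 n * q)) =
      const f ^ n * to_fract (q * star q) / z ^ degree q" if "q \<noteq> 0" for n q
  proof -
    have "\<sigma> (to_fract (monom 1 n * q)) = (const f / z) ^ n * (to_fract (star q) / z ^ degree q)"
      using conj[OF that]
      by (simp add: monom \<sigma>.map_mult \<sigma>.map_power map_z) (simp add: conj.lift_to_fract)
    then show ?thesis
      by (simp add: monom power_divide)
  qed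
  have "to_fract P * \<sigma> (to_fract P) = const \<rho> * (to_fract R * \<sigma> (to_fract R))"
  proof -
    have "to_fract P = w * to_fract R"
      using PR by (simp add: Fract_conv_to_fract)
    then show ?thesis
      using w by (simp add: \<sigma>.map_mult mult_ac)
  qed
  then have "const f ^ a * to_fract (g * star g) * z ^ degree h =
      const \<rho> * (const f ^ b * to_fract (h * star h)) * z ^ degree g"
    using nz unfolding g h norm[OF nz(1)] norm[OF nz(2)] by (simp add: field_simps)
  then have "to_fract ([:f:] ^ a * (g * star g) * [:0, 1:] ^ degree h) =
      to_fract ([:\<rho>:] * ([:f:] ^ b * (h * star h)) * [:0, 1:] ^ degree g)"
    by (simp only: to_fract_mult ring_map.map_power[OF ring_map_to_fract])
  then have eq: "[:f:] ^ a * (g * star g) * [:0, 1:] ^ degree h =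
      [:\<rho>:] * ([:f:] ^ b * (h * star h)) * [:0, 1:] ^ degree g"
    by (simp only: to_fract_eq_iff)
  define u where "u = smult (f ^ a) (g * star g)"
  define v where "v = smult (\<rho> * f ^ b) (h * star h)"
  have uv: "u * [:0, 1:] ^ degree h = v * [:0, 1:] ^ degree g"
    using eq by (simp add: u_def v_def poly_const_pow mult_ac)
  have cu: "coeff u 0 \<noteq> 0" "coeff v 0 \<noteq> 0"
    using g h nz \<rho> f_nz by (simp_all add: u_def v_def coeff_mult_0 coeff_star_0)
  \<comment> \<open>\<open>u\<close> and \<open>v\<close> have nonzero constant terms, so the order
    at z = 0 of the two sides of \<open>uv\<close> can be read off from the powers of z.\<close>
  have deg: "degree g = degree h"
  proof -
    have ord: "order 0 (x * [:0, 1:] ^ n) = n" if "coeff x 0 \<noteq> 0" for x :: "'k poly" and n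
    proof -
      have "order 0 x = 0" "x \<noteq> 0"
        using that order_0I[of x 0] by (auto simp: poly_0_coeff_0)
      moreover have "order 0 ([:0, 1::'k:] ^ n) = n"
        using order_power_n_n[of 0 n] by simp
      ultimately show ?thesis
        by (simp add: order_mult)
    qed
    show ?thesis
      using ord[OF cu(1)] ord[OF cu(2)] uv by metis
  qed
  then have "u = v"
    using uv by simp
  then have "g * star g = smult (\<rho> * f ^ b / f ^ a) (h * star h)"
    using f_nz unfolding u_def v_def
    by (metis (no_types, opaque_lifting) div_by_1 divide_inverse_commute left_inverse
        power_not_zero smult_1_left smult_smult)
  moreover have "\<rho> * f ^ b / f ^ a \<noteq> 0"
    using \<rho> f_nz by simp
  ultimately obtain c e n where c: "c \<noteq> 0" "e \<noteq> 0"
    "c * \<tau> c = \<rho> * f ^ b / f ^ a * f ^ n * (e * \<tau> e)"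
    using descent[OF g(2) h(2) deg] by blast
  then have "c * \<tau> c * f ^ a = \<rho> * f ^ (b + n) * (e * \<tau> e)"
    using f_nz by (simp add: power_add field_simps)
  with c(1,2) show ?thesis
    by blast
qed

end

section \<open>The base field C(l, m) with complex conjugation, and parity of orders in
  C[l, m]\<close>

type_synonym cpoly2 = "complex poly poly"

definition cnj2 :: "cpoly2 \<Rightarrow> cpoly2" where
  "cnj2 = map_poly (map_poly cnj)"

lemma ring_map_cnj2: "ring_map cnj2"
  unfolding cnj2_def by (intro ring_map.ring_map_poly ring_map_cnj)

lemma cnj2_cnj2: "cnj2 (cnj2 p) = p"
  by (simp add: cnj2_def poly_eq_iff coeff_map_poly)

interpretation cnj2: fract_embedding "\<lambda>p. to_fract (cnj2 p)"
proof -
  interpret ring_map "\<lambda>p. to_fract (cnj2 p)"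
    by (rule ring_map_comp[OF ring_map_cnj2 ring_map_to_fract])
  show "fract_embedding (\<lambda>p. to_fract (cnj2 p))"
    by standard (metis cnj2_cnj2 ring_map.map_zero ring_map_cnj2 to_fract_eq_0_iff)
qed

definition cnj_fract :: "cpoly2 fract \<Rightarrow> cpoly2 fract" where
  "cnj_fract = fract_lift (\<lambda>p. to_fract (cnj2 p))"

lemma ring_map_cnj_fract: "ring_map cnj_fract"
  unfolding cnj_fract_def by (rule cnj2.ring_map_lift)

lemma cnj_fract_to_fract: "cnj_fract (to_fract p) = to_fract (cnj2 p)"
  unfolding cnj_fract_def by (rule cnj2.lift_to_fract)

lemma cnj_fract_Fract: "b \<noteq> 0 \<Longrightarrow> cnj_fract (Fract a b) = to_fract (cnj2 a) / to_fract (cnj2 b)"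
  unfolding cnj_fract_def by (rule cnj2.lift_Fract)

lemma cnj_fract_invol: "cnj_fract (cnj_fract x) = x"
proof -
  interpret ring_map cnj_fract
    by (rule ring_map_cnj_fract)
  obtain a b where x: "x = Fract a b" "b \<noteq> 0"
    by (cases x)
  then have *: "x * to_fract b = to_fract a"
    by (simp add: Fract_conv_to_fract)
  then have "cnj_fract (cnj_fract x) * to_fract b = to_fract a"
    by (metis map_mult cnj_fract_to_fract cnj2_cnj2)
  then show ?thesis
    using x(2) * by (metis mult_right_cancel to_fract_eq_0_iff)
qed

lemma multiplicity_cnj2:
  assumes q: "cnj2 q = q" "\<not> is_unit q" and x: "x \<noteq> 0"
  shows "multiplicity q (cnj2 x) = multiplicity q x"
proof -
  interpret ring_map cnj2
    by (rule ring_map_cnj2)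
  have x': "cnj2 x \<noteq> 0"
    using x cnj2_cnj2[of x] by (auto simp: map_zero)
  have "q ^ n dvd cnj2 x \<longleftrightarrow> q ^ n dvd x" for n
    using map_dvd[of "q ^ n" x] map_dvd[of "q ^ n" "cnj2 x"] q by (auto simp: map_power cnj2_cnj2)
  then show ?thesis
    using power_dvd_iff_le_multiplicity[OF x q(2)] power_dvd_iff_le_multiplicity[OF x' q(2)]
    by (metis antisym order_refl)
qed

lemma multiplicity_norm_even:
  assumes "prime_elem q" "cnj2 q = q" "x \<noteq> 0"
  shows "even (multiplicity q (x * cnj2 x))" "x * cnj2 x \<noteq> 0"
proof -
  have x': "cnj2 x \<noteq> 0"
    using assms cnj2_cnj2[of x] by (auto simp: ring_map.map_zero[OF ring_map_cnj2])
  with assms show "x * cnj2 x \<noteq> 0"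
    by simp
  show "even (multiplicity q (x * cnj2 x))"
    using assms x' prime_elem_multiplicity_mult_distrib[OF assms(1,3) x']
      multiplicity_cnj2[OF assms(2) _ assms(3)] by (simp add: prime_elem_def)
qed

definition var_l :: cpoly2 where
  "var_l = [:[:0, 1:]:]"

definition var_m :: cpoly2 where
  "var_m = [:0, 1:]"

text \<open>The outer variable is m, the inner one l. At \<open>y 2 = 1\<close>,
  \<open>y 3 = l\<close>, \<open>y 4 = m\<close> the normal form says that
  \<open>(y 0)\<^sup>2 + (y 1)\<^sup>2\<close> is \<open>- (var_l * conic_poly a c)\<close>.\<close>

definition conic_poly :: "real \<Rightarrow> real \<Rightarrow> cpoly2" where
  "conic_poly a c = [:[:1, of_real a, of_real c:], 0, 1:]"

lemma conic_poly_eq: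
  "conic_poly a c = 1 + var_m\<^sup>2 + [:[:of_real a:]:] * var_l + [:[:of_real c:]:] * var_l\<^sup>2"
  by (simp add: conic_poly_def var_m_def var_l_def power2_eq_square one_pCons)

lemma cnj2_var_l: "cnj2 var_l = var_l"
  by (simp add: cnj2_def var_l_def map_poly_pCons)

lemma cnj2_conic_poly: "cnj2 (conic_poly a c) = conic_poly a c"
  by (simp add: cnj2_def conic_poly_def map_poly_pCons)

lemma prime_var_l: "prime_elem var_l"
  unfolding var_l_def prime_elem_const_poly_iff
  by (rule prime_elem_linear_field_poly) simp

text \<open>The polynomial is monic of degree 2 in m. A proper factorization would consist of two
  factors linear in m and make 1 + a l + c l^2 the negative of a square in C[l]; this forces
  discriminant zero.\<close>

lemma prime_conic_poly:
  assumes c: "c \<noteq> 0" and disc: "a\<^sup>2 \<noteq> 4 * c"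
  shows "prime_elem (conic_poly a c)"
proof -
  let ?e = "[:1, of_real a, of_real c:] :: complex poly"
  have deg: "degree (conic_poly a c) = 2"
    by (simp add: conic_poly_def)
  have "irreducible (conic_poly a c)"
  proof (rule irreducibleI)
    show "conic_poly a c \<noteq> 0"
      using deg by auto
    show "\<not> is_unit (conic_poly a c)"
      using deg by (auto elim!: is_unit_polyE)
    fix p q assume pq: "conic_poly a c = p * q"
    then have nz: "p \<noteq> 0" "q \<noteq> 0"
      using deg by auto
    have degs: "degree p + degree q = 2"
      using deg nz by (simp add: pq degree_mult_eq)
    have lead: "lead_coeff p * lead_coeff q = 1"
      using arg_cong[OF pq, of lead_coeff] deg by (simp add: lead_coeff_mult conic_poly_def)
    have unit: "is_unit r" if r: "degree r = 0" "lead_coeff r dvd 1" for r :: cpoly2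
    proof -
      obtain t where "r = [:t:]"
        using r(1) by (rule degree_eq_zeroE)
      with r show ?thesis
        by (simp add: is_unit_const_poly_iff)
    qed
    show "is_unit p \<or> is_unit q"
    proof (cases "degree p = 0 \<or> degree q = 0")
      case True
      then show ?thesis
        using unit lead by (metis dvd_triv_left dvd_triv_right)
    next
      case False
      then have "degree p = 1" "degree q = 1"
        using degs by auto
      then obtain p0 p1 q0 q1 where p: "p = [:p0, p1:]" and q: "q = [:q0, q1:]"
        by (metis degree1_coeffs)
      have e: "?e = p0 * q0" "p0 * q1 + p1 * q0 = 0" "p1 * q1 = 1"
        using arg_cong[OF pq, of "\<lambda>r. coeff r 0"] arg_cong[OF pq, of "\<lambda>r. coeff r 1"]
          arg_cong[OF pq, of "\<lambda>r. coeff r 2"]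
        unfolding p q conic_poly_def by (simp_all add: coeff_mult coeff_pCons numeral_2_eq_2 ac_simps)
      have "q0 = q1 * (p1 * q0)"
        using e(3) by (metis mult.assoc mult.commute mult_1)
      also have "p1 * q0 = - (p0 * q1)"
        using e(2) by (simp add: eq_neg_iff_add_eq_0 add.commute)
      finally have es: "?e = - ((p0 * q1)\<^sup>2)"
        using e(1) by (simp add: power2_eq_square mult_ac)
      define s where "s = p0 * q1"
      have "degree (s\<^sup>2) = 2"
        using arg_cong[OF es, of degree] c by (simp add: s_def)
      then have "degree s = 1"
        using degree_power_eq[of s 2] by (cases "s = 0") auto
      then obtain s0 s1 where s: "s = [:s0, s1:]"
        by (metis degree1_coeffs)
      have v: "- (s0 * s0) = 1" "complex_of_real a = - (2 * (s0 * s1))" "complex_of_real c = - (s1 * s1)"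
        using es unfolding s_def[symmetric] s by (auto simp: power2_eq_square algebra_simps)
      have "complex_of_real (a\<^sup>2) = - 4 * (- (s0 * s0)) * (s1 * s1)"
        by (simp add: v(2) power2_eq_square)
      also have "\<dots> = of_real (4 * c)"
        unfolding v(1) by (simp add: v(3))
      finally have "complex_of_real (a\<^sup>2) = of_real (4 * c)" .
      then show ?thesis
        using disc of_real_eq_iff by blast
    qed
  qed
  then show ?thesis
    by (simp add: prime_elem_iff_irreducible)
qed

text \<open>Norms have even order at a prime fixed by conjugation, and
  \<open>var_l * conic_poly a c\<close> has order 1 at both of its prime factors. Along l = 0 the
  equation says that i and j + 1 have the same parity, along the conic that i and j do.\<close>

lemma parity_obstruction:
  assumes c: "c \<noteq> 0" and disc: "a\<^sup>2 \<noteq> 4 * c" and r: "r \<noteq> (0::complex)"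
    and x: "x \<noteq> 0" and y: "y \<noteq> 0"
    and eq: "(x * cnj2 x) * (- (var_l * conic_poly a c)) ^ i =
      [:[:r:]:] * var_l * (- (var_l * conic_poly a c)) ^ j * (y * cnj2 y)"
  shows False
proof -
  let ?Q = "conic_poly a c"
  define R where "R = ([:[:r:]:] :: cpoly2)"
  have pQ: "prime_elem ?Q"
    by (rule prime_conic_poly[OF c disc])
  have nz: "var_l \<noteq> 0" "?Q \<noteq> 0" "R \<noteq> 0"
    using prime_var_l pQ r by (auto simp: R_def)
  have R: "is_unit R"
    using r by (simp add: R_def is_unit_const_poly_iff dvd_field_iff)
  have "\<not> ?Q dvd var_l"
    using dvd_imp_degree_le[of ?Q var_l] nz by (auto simp: conic_poly_def var_l_def)
  moreover have "\<not> var_l dvd ?Q"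
    by (auto simp: conic_poly_def var_l_def const_poly_dvd_iff coeff_pCons split: nat.splits
        dest!: spec[of _ 2] simp: is_unit_iff_degree)
  ultimately have mult: "multiplicity ?Q var_l = 0" "multiplicity var_l ?Q = 0"
    by (simp_all add: not_dvd_imp_multiplicity_0)
  define F where "F = - (var_l * ?Q)"
  have F0: "F \<noteq> 0"
    using nz by (simp add: F_def)
  have parity: "even (multiplicity q F * i) \<longleftrightarrow> even (multiplicity q var_l + multiplicity q F * j)"
    if q: "prime_elem q" "cnj2 q = q" for q
  proof -
    note nx = multiplicity_norm_even[OF q x] and ny = multiplicity_norm_even[OF q y]
    define X Y where "X = x * cnj2 x" and "Y = y * cnj2 y"
    have XY: "X \<noteq> 0" "Y \<noteq> 0"
      using nx(2) ny(2) by (simp_all add: X_def Y_def)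
    have "multiplicity q (X * F ^ i) = multiplicity q (R * var_l * F ^ j * Y)"
      using eq by (simp add: X_def Y_def F_def R_def)
    then have "multiplicity q X + i * multiplicity q F =
        multiplicity q R + multiplicity q var_l + j * multiplicity q F + multiplicity q Y"
      using F0 nz q(1) XY
      by (simp add: prime_elem_multiplicity_mult_distrib prime_elem_multiplicity_power_distrib)
    moreover have "multiplicity q R = 0"
      using R by (simp add: multiplicity_unit_right)
    ultimately show ?thesis
      using nx(1) ny(1) unfolding X_def Y_def by (metis add.left_neutral even_add mult.commute)
  qed
  have "multiplicity q (- (var_l * ?Q)) = multiplicity q (var_l * ?Q)" for q
    using multiplicity_times_unit_right[of "- 1" q "var_l * ?Q"] by simp
  then have "multiplicity var_l F = 1" "multiplicity ?Q F = 1"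
    unfolding F_def using mult nz pQ prime_var_l by (simp_all add: prime_elem_multiplicity_mult_distrib)
  then show False
    using parity[OF prime_var_l cnj2_var_l] parity[OF pQ cnj2_conic_poly] mult prime_var_l by simp
qed

section \<open>Real forms as functions\<close>

definition mono_eval :: "('v \<Rightarrow>\<^sub>0 nat) \<Rightarrow> ('v \<Rightarrow> 'r::comm_ring_1) \<Rightarrow> 'r" where
  "mono_eval m x = (\<Prod>i\<in>Poly_Mapping.keys m. x i ^ Poly_Mapping.lookup m i)"

text \<open>The map \<open>\<rho>\<close> on coefficients allows the same real form to be evaluated
  in the complex numbers, in polynomial rings and in function fields, compatibly with homomorphisms
  between them.\<close>

definition eval_in :: "(real \<Rightarrow> 'r::comm_ring_1) \<Rightarrow> 'v rpoly \<Rightarrow> ('v \<Rightarrow> 'r) \<Rightarrow> 'r" where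
  "eval_in \<rho> p x = (\<Sum>m\<in>Poly_Mapping.keys p. \<rho> (Poly_Mapping.lookup p m) * mono_eval m x)"

lemma peval_eq_eval_in: "peval p x = eval_in of_real p x"
  by (simp add: peval_def eval_in_def mono_eval_def)

lemma (in ring_map) map_eval_in: "h (eval_in \<rho> p x) = eval_in (\<lambda>r. h (\<rho> r)) p (\<lambda>i. h (x i))"
  by (simp add: eval_in_def mono_eval_def map_sum map_mult map_prod map_power)

lemma mono_eval_superset:
  assumes "finite S" "Poly_Mapping.keys m \<subseteq> S"
  shows "mono_eval m x = (\<Prod>i\<in>S. x i ^ Poly_Mapping.lookup m i)"
  unfolding mono_eval_def
  by (rule prod.mono_neutral_left) (use assms in \<open>auto simp: in_keys_iff\<close>)

lemma mono_eval_add: "mono_eval (m + n) x = mono_eval m x * mono_eval n x"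
proof -
  let ?S = "Poly_Mapping.keys m \<union> Poly_Mapping.keys n"
  have "mono_eval (m + n) x = (\<Prod>i\<in>?S. x i ^ Poly_Mapping.lookup (m + n) i)"
    by (rule mono_eval_superset) (use keys_add[of m n] in auto)
  also have "\<dots> = mono_eval m x * mono_eval n x"
    by (simp add: mono_eval_superset[of ?S m] mono_eval_superset[of ?S n] lookup_add power_add prod.distrib)
  finally show ?thesis .
qed

lemma mono_eval_scale:
  fixes x :: "nat \<Rightarrow> 'r::comm_ring_1"
  assumes "Poly_Mapping.keys m \<subseteq> {..n}"
  shows "mono_eval m (\<lambda>i. c * x i) = c ^ (\<Sum>i\<le>n. Poly_Mapping.lookup m i) * mono_eval m x"
proof -
  have "mono_eval m y = (\<Prod>i\<le>n. y i ^ Poly_Mapping.lookup m i)" for y :: "nat \<Rightarrow> 'r"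
    by (rule mono_eval_superset[OF finite_atMost assms])
  then show ?thesis
    by (simp add: power_mult_distrib prod.distrib power_sum)
qed

lemma eval_in_scale:
  assumes "multihomogeneous (proj_space n) (\<lambda>_. d) p"
  shows "eval_in \<rho> p (\<lambda>i. c * x i) = c ^ d * eval_in \<rho> p x"
  unfolding eval_in_def sum_distrib_left
proof (rule sum.cong)
  fix m assume m: "m \<in> Poly_Mapping.keys p"
  then have "Poly_Mapping.keys m \<subseteq> {..n}" "(\<Sum>i\<le>n. Poly_Mapping.lookup m i) = d"
    using assms by (auto simp: multihomogeneous_def)
  then show "\<rho> (Poly_Mapping.lookup p m) * mono_eval m (\<lambda>i. c * x i) =
      c ^ d * (\<rho> (Poly_Mapping.lookup p m) * mono_eval m x)"
    by (simp add: mono_eval_scale mult_ac)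
qed simp

lemma peval_scale:
  "multihomogeneous (proj_space n) (\<lambda>_. d) p \<Longrightarrow> peval p (\<lambda>i. c * x i) = c ^ d * peval p x"
  by (simp add: peval_eq_eval_in eval_in_scale)

lemma peval_superset:
  assumes "finite S" "Poly_Mapping.keys p \<subseteq> S"
  shows "peval p x = (\<Sum>m\<in>S. of_real (Poly_Mapping.lookup p m) * mono_eval m x)"
  unfolding peval_eq_eval_in eval_in_def
  by (rule sum.mono_neutral_left) (use assms in \<open>auto simp: in_keys_iff\<close>)

lemma peval_0: "peval 0 x = 0"
  by (simp add: peval_def)

lemma peval_add: "peval (p + q) x = peval p x + peval q x"
proof -
  let ?S = "Poly_Mapping.keys p \<union> Poly_Mapping.keys q"
  have "peval (p + q) x = (\<Sum>m\<in>?S. of_real (Poly_Mapping.lookup (p + q) m) * mono_eval m x)"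
    by (rule peval_superset) (use keys_add[of p q] in auto)
  also have "\<dots> = peval p x + peval q x"
    by (simp add: peval_superset[of ?S p] peval_superset[of ?S q] lookup_add sum.distrib distrib_right)
  finally show ?thesis .
qed

lemma peval_sum: "peval (sum f A) x = (\<Sum>a\<in>A. peval (f a) x)"
  by (induction A rule: infinite_finite_induct) (simp_all add: peval_0 peval_add)

lemma peval_single: "peval (Poly_Mapping.single m c) x = of_real c * mono_eval m x"
  by (simp add: peval_eq_eval_in eval_in_def)

lemma sum_singles: "p = (\<Sum>m\<in>Poly_Mapping.keys p. Poly_Mapping.single m (Poly_Mapping.lookup p m))"
proof (rule poly_mapping_eqI)
  fix k
  have "(\<Sum>m\<in>Poly_Mapping.keys p. Poly_Mapping.lookup (Poly_Mapping.single m (Poly_Mapping.lookup p m)) k) =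
      (\<Sum>m\<in>Poly_Mapping.keys p. if m = k then Poly_Mapping.lookup p k else 0)"
    by (rule sum.cong) (auto simp: lookup_single when_def)
  then show "Poly_Mapping.lookup p k =
      Poly_Mapping.lookup (\<Sum>m\<in>Poly_Mapping.keys p. Poly_Mapping.single m (Poly_Mapping.lookup p m)) k"
    by (simp add: lookup_sum in_keys_iff)
qed

lemma peval_mult: "peval (p * q) x = peval p x * peval q x"
proof -
  have "p * q = (\<Sum>m\<in>Poly_Mapping.keys p. \<Sum>n\<in>Poly_Mapping.keys q.
      Poly_Mapping.single (m + n) (Poly_Mapping.lookup p m * Poly_Mapping.lookup q n))"
    by (subst (1) sum_singles[of p], subst (1) sum_singles[of q]) (simp add: sum_product mult_single)
  then have "peval (p * q) x = (\<Sum>m\<in>Poly_Mapping.keys p. \<Sum>n\<in>Poly_Mapping.keys q.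
      (of_real (Poly_Mapping.lookup p m) * mono_eval m x) * (of_real (Poly_Mapping.lookup q n) * mono_eval n x))"
    by (simp add: peval_sum peval_single mono_eval_add mult_ac)
  then show ?thesis
    unfolding peval_eq_eval_in eval_in_def by (simp add: sum_product)
qed

lemma tendsto_peval:
  assumes "\<And>i. ((\<lambda>t. \<gamma> t i) \<longlongrightarrow> x i) T"
  shows "((\<lambda>t. peval p (\<gamma> t)) \<longlongrightarrow> peval p x) T"
  unfolding peval_def by (intro tendsto_intros assms)

lemma poly_along_curve:
  obtains q where "\<And>t. peval p (\<lambda>i. poly (c i) t) = poly q t"
proof
  fix t
  show "peval p (\<lambda>i. poly (c i) t) = poly (eval_in (\<lambda>r. [:of_real r:]) p c) t"
    by (simp add: ring_map.map_eval_in[OF ring_map_eval] peval_eq_eval_in)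
qed

lemma poly_eq_0_of_reals:
  fixes q :: "complex poly"
  assumes "\<And>r::real. poly q (of_real r) = 0"
  shows "q = 0"
proof (rule ccontr)
  assume "q \<noteq> 0"
  then have "finite (of_real ` (UNIV :: real set) :: complex set)"
    using poly_roots_finite[of q] assms finite_subset by (metis (mono_tags, lifting) image_subsetI mem_Collect_eq)
  then show False
    by (simp add: finite_image_iff inj_on_def infinite_UNIV_char_0)
qed

lemma peval_cong: "(\<And>i m. m \<in> Poly_Mapping.keys p \<Longrightarrow> i \<in> Poly_Mapping.keys m \<Longrightarrow> x i = y i) \<Longrightarrow> peval p x = peval p y"
  unfolding peval_def by (intro sum.cong prod.cong arg_cong2[where f = "(*)"]) auto

text \<open>The coordinates are made real one at a time: as a function of a single coordinate,
  \<open>p\<close> is a nonzero polynomial and cannot vanish at all real numbers.\<close>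

lemma real_coordinates_dense:
  assumes "finite S" "peval p x \<noteq> 0"
  obtains y where "\<And>i. i \<in> S \<Longrightarrow> y i \<in> \<real>" "\<And>i. i \<notin> S \<Longrightarrow> y i = x i" "peval p y \<noteq> 0"
proof -
  have "\<exists>y. (\<forall>i\<in>S. y i \<in> \<real>) \<and> (\<forall>i. i \<notin> S \<longrightarrow> y i = x i) \<and> peval p y \<noteq> 0"
    using assms(1)
  proof (induction S rule: finite_induct)
    case (insert a S)
    then obtain y where y: "\<forall>i\<in>S. y i \<in> \<real>" "\<forall>i. i \<notin> S \<longrightarrow> y i = x i" "peval p y \<noteq> 0"
      by blast
    obtain q where q: "\<And>t. peval p (\<lambda>i. poly (if i = a then [:0, 1:] else [:y i:]) t) = poly q t"
      using poly_along_curve[of p "\<lambda>i. if i = a then [:0, 1:] else [:y i:]"] by blast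
    have curve: "(\<lambda>i. poly (if i = a then [:0, 1:] else [:y i:]) t) = y(a := t)" for t
      by auto
    have "poly q (y a) \<noteq> 0"
      using q[of "y a"] y unfolding curve by simp
    then obtain r :: real where "poly q (of_real r) \<noteq> 0"
      using poly_eq_0_of_reals[of q] by force
    then have "peval p (y(a := of_real r)) \<noteq> 0"
      using q[of "of_real r"] unfolding curve by simp
    moreover have "\<forall>i\<in>insert a S. (y(a := of_real r)) i \<in> \<real>"
      "\<forall>i. i \<notin> insert a S \<longrightarrow> (y(a := of_real r)) i = x i"
      using y by auto
    ultimately show ?case
      by blast
  qed (use assms in auto)
  with that show ?thesis
    by blast
qed

lemma real_points_dense:
  assumes "peval p x \<noteq> 0"
  obtains t :: "'v \<Rightarrow> real" where "peval p (\<lambda>i. of_real (t i)) \<noteq> 0"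
proof -
  let ?V = "\<Union>m\<in>Poly_Mapping.keys p. Poly_Mapping.keys m"
  have "finite ?V"
    by simp
  then obtain y where y: "\<And>i. i \<in> ?V \<Longrightarrow> y i \<in> \<real>" "peval p y \<noteq> 0"
    using assms by (rule real_coordinates_dense) blast
  have "peval p (\<lambda>i. of_real (Re (y i))) = peval p y"
  proof (rule peval_cong)
    fix i m assume "m \<in> Poly_Mapping.keys p" "i \<in> Poly_Mapping.keys m"
    then have "y i \<in> \<real>"
      using y(1) by blast
    then show "complex_of_real (Re (y i)) = y i"
      by (simp add: complex_is_Real_iff complex_eq_iff)
  qed
  with y(2) that show ?thesis
    by metis
qed

text \<open>Treating forms as functions lets multidegrees be derived from rules for sums, products
  and substitution, without computing with coefficients.\<close>

definition rform :: "'v set set \<Rightarrow> ('v set \<Rightarrow> nat) \<Rightarrow> (('v \<Rightarrow> complex) \<Rightarrow> complex) \<Rightarrow> bool" where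
  "rform Bs d f \<longleftrightarrow> (\<exists>p. multihomogeneous Bs d p \<and> (\<forall>x. peval p x = f x))"

lemma rformE:
  assumes "rform Bs d f"
  obtains p where "multihomogeneous Bs d p" "\<And>x. peval p x = f x"
  using assms by (auto simp: rform_def)

lemma rform_peval: "multihomogeneous Bs d p \<Longrightarrow> rform Bs d (peval p)"
  by (auto simp: rform_def)

lemma rform_degree_cong: "rform Bs d f \<Longrightarrow> (\<And>B. B \<in> Bs \<Longrightarrow> d B = d' B) \<Longrightarrow> rform Bs d' f"
  by (auto simp: rform_def multihomogeneous_def)

lemma rform_0: "rform Bs d (\<lambda>_. 0)"
  unfolding rform_def by (rule exI[of _ 0]) (simp add: multihomogeneous_def peval_0)

lemma rform_const: "rform Bs (\<lambda>_. 0) (\<lambda>_. of_real c)"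
  unfolding rform_def
  by (rule exI[of _ "Poly_Mapping.single 0 c"]) (auto simp: multihomogeneous_def peval_single mono_eval_def)

lemma rform_add: "rform Bs d f \<Longrightarrow> rform Bs d g \<Longrightarrow> rform Bs d (\<lambda>x. f x + g x)"
proof -
  assume "rform Bs d f" "rform Bs d g"
  then obtain p q where p: "multihomogeneous Bs d p" "\<And>x. peval p x = f x"
    and q: "multihomogeneous Bs d q" "\<And>x. peval q x = g x"
    by (auto simp: rform_def)
  have "multihomogeneous Bs d (p + q)"
    using p(1) q(1) keys_add[of p q] by (auto simp: multihomogeneous_def)
  then show ?thesis
    unfolding rform_def using p(2) q(2) by (intro exI[of _ "p + q"]) (simp add: peval_add)
qed

lemma rform_mult:
  assumes "rform Bs d f" "rform Bs e g"
  shows "rform Bs (\<lambda>B. d B + e B) (\<lambda>x. f x * g x)"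
proof -
  from assms obtain p q where p: "multihomogeneous Bs d p" "\<And>x. peval p x = f x"
    and q: "multihomogeneous Bs e q" "\<And>x. peval q x = g x"
    by (auto simp: rform_def)
  have "multihomogeneous Bs (\<lambda>B. d B + e B) (p * q)"
    unfolding multihomogeneous_def
  proof
    fix m assume "m \<in> Poly_Mapping.keys (p * q)"
    then obtain a b where m: "m = a + b" "a \<in> Poly_Mapping.keys p" "b \<in> Poly_Mapping.keys q"
      using keys_mult[of p q] by blast
    then show "Poly_Mapping.keys m \<subseteq> \<Union> Bs \<and> (\<forall>B\<in>Bs. sum (Poly_Mapping.lookup m) B = d B + e B)"
      using p(1) q(1) keys_add[of a b]
      by (auto simp: multihomogeneous_def lookup_add sum.distrib dest!: bspec)
  qed
  then show ?thesis
    unfolding rform_def using p q by (intro exI[of _ "p * q"]) (simp add: peval_mult)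
qed

lemma rform_scale: "rform Bs d f \<Longrightarrow> rform Bs d (\<lambda>x. of_real c * f x)"
  using rform_mult[OF rform_const, of Bs d f c] by simp

lemma rform_uminus: "rform Bs d f \<Longrightarrow> rform Bs d (\<lambda>x. - f x)"
  using rform_scale[of Bs d f "- 1"] by simp

lemma rform_diff: "rform Bs d f \<Longrightarrow> rform Bs d g \<Longrightarrow> rform Bs d (\<lambda>x. f x - g x)"
  using rform_add[OF _ rform_uminus, of Bs d f g] by simp

lemma rform_sum:
  "(\<And>a. a \<in> A \<Longrightarrow> rform Bs d (f a)) \<Longrightarrow> rform Bs d (\<lambda>x. \<Sum>a\<in>A. f a x)"
  by (induction A rule: infinite_finite_induct) (simp_all add: rform_0 rform_add)

lemma rform_power: "rform Bs d f \<Longrightarrow> rform Bs (\<lambda>B. n * d B) (\<lambda>x. f x ^ n)"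
proof (induction n)
  case 0
  show ?case
    using rform_const[of Bs 1] by simp
next
  case (Suc n)
  then show ?case
    using rform_mult[of Bs d f "\<lambda>B. n * d B" "\<lambda>x. f x ^ n"] by simp
qed

lemma rform_prod:
  "(\<And>a. a \<in> A \<Longrightarrow> rform Bs (d a) (f a)) \<Longrightarrow> rform Bs (\<lambda>B. \<Sum>a\<in>A. d a B) (\<lambda>x. \<Prod>a\<in>A. f a x)"
proof (induction A rule: infinite_finite_induct)
  case (insert a A)
  then show ?case
    using rform_mult[of Bs "d a" "f a"] by simp
qed (use rform_const[of Bs 1] in simp_all)

lemma rform_var:
  assumes "i \<in> B0" "B0 \<in> Bs" "\<And>B. B \<in> Bs \<Longrightarrow> finite B"
  shows "rform Bs (\<lambda>B. if i \<in> B then 1 else 0) (\<lambda>x. x i)"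
  unfolding rform_def
proof (rule exI[of _ "Poly_Mapping.single (Poly_Mapping.single i 1) 1"], intro conjI allI)
  show "multihomogeneous Bs (\<lambda>B. if i \<in> B then 1 else 0)
      (Poly_Mapping.single (Poly_Mapping.single i 1) 1)"
    using assms by (auto simp: multihomogeneous_def lookup_single when_def sum.delta')
  show "peval (Poly_Mapping.single (Poly_Mapping.single i 1) 1) x = x i" for x
    by (simp add: peval_single mono_eval_def)
qed

lemma rform_subst:
  assumes p: "multihomogeneous Bs d p" and fin: "finite Bs" "\<And>B. B \<in> Bs \<Longrightarrow> finite B"
    and disj: "\<And>B B'. B \<in> Bs \<Longrightarrow> B' \<in> Bs \<Longrightarrow> B \<inter> B' \<noteq> {} \<Longrightarrow> B = B'"
    and f: "\<And>B i. B \<in> Bs \<Longrightarrow> i \<in> B \<Longrightarrow> rform Cs (e B) (f i)"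
  shows "rform Cs (\<lambda>C. \<Sum>B\<in>Bs. d B * e B C) (\<lambda>x. peval p (\<lambda>i. f i x))"
  unfolding peval_def
proof (intro rform_sum rform_scale)
  fix m assume "m \<in> Poly_Mapping.keys p"
  then have m: "Poly_Mapping.keys m \<subseteq> \<Union>Bs" "\<And>B. B \<in> Bs \<Longrightarrow> (\<Sum>i\<in>B. Poly_Mapping.lookup m i) = d B"
    using p by (auto simp: multihomogeneous_def)
  define b where "b i = (THE B. B \<in> Bs \<and> i \<in> B)" for i
  have b: "b i = B" if "i \<in> B" "B \<in> Bs" for i B
    unfolding b_def using that disj by (intro the_equality) blast+
  have "rform Cs (\<lambda>C. \<Sum>i\<in>Poly_Mapping.keys m. Poly_Mapping.lookup m i * e (b i) C)
      (\<lambda>x. \<Prod>i\<in>Poly_Mapping.keys m. f i x ^ Poly_Mapping.lookup m i)"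
    using m(1) f b by (intro rform_prod rform_power) (metis UnionE subsetD)
  moreover have "(\<Sum>i\<in>Poly_Mapping.keys m. Poly_Mapping.lookup m i * e (b i) C) = (\<Sum>B\<in>Bs. d B * e B C)" for C
  proof -
    have "(\<Sum>i\<in>Poly_Mapping.keys m. Poly_Mapping.lookup m i * e (b i) C) =
        (\<Sum>i\<in>\<Union>Bs. Poly_Mapping.lookup m i * e (b i) C)"
      using m(1) fin by (intro sum.mono_neutral_left) (auto simp: in_keys_iff)
    also have "\<dots> = (\<Sum>B\<in>Bs. \<Sum>i\<in>B. Poly_Mapping.lookup m i * e (b i) C)"
      using fin disj sum.Union_disjoint[of Bs "\<lambda>i. Poly_Mapping.lookup m i * e (b i) C"]
      by (simp add: o_def) blast
    also have "\<dots> = (\<Sum>B\<in>Bs. d B * e B C)"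
    proof (rule sum.cong)
      fix B assume B: "B \<in> Bs"
      then have "(\<Sum>i\<in>B. Poly_Mapping.lookup m i * e (b i) C) = (\<Sum>i\<in>B. Poly_Mapping.lookup m i * e B C)"
        by (intro sum.cong) (simp_all add: b)
      then show "(\<Sum>i\<in>B. Poly_Mapping.lookup m i * e (b i) C) = d B * e B C"
        using m(2)[OF B] by (simp flip: sum_distrib_right)
    qed simp
    finally show ?thesis .
  qed
  ultimately show "rform Cs (\<lambda>C. \<Sum>B\<in>Bs. d B * e B C)
      (\<lambda>x. \<Prod>i\<in>Poly_Mapping.keys m. f i x ^ Poly_Mapping.lookup m i)"
    by simp
qed

section \<open>The obstruction to stable rationality\<close>

definition normal_form :: "'r \<Rightarrow> 'r \<Rightarrow> (nat \<Rightarrow> 'r) \<Rightarrow> 'r::comm_ring_1" where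
  "normal_form a c y = y 2 * ((y 0)\<^sup>2 + (y 1)\<^sup>2) +
    y 3 * ((y 2)\<^sup>2 + (y 4)\<^sup>2 + a * y 3 * y 2 + c * (y 3)\<^sup>2)"

lemma (in ring_map) map_normal_form:
  "h (normal_form a c y) = normal_form (h a) (h c) (\<lambda>i. h (y i))"
  by (simp add: normal_form_def map_simps)

lemma normal_form_scale: "normal_form a c (\<lambda>i. u * y i) = u ^ 3 * normal_form a c y"
  by (simp add: normal_form_def power2_eq_square power3_eq_cube algebra_simps)

definition eval3 :: "complex \<Rightarrow> complex \<Rightarrow> complex \<Rightarrow> cpoly2 poly \<Rightarrow> complex" where
  "eval3 l m z P = poly (poly (poly P [:[:z:]:]) [:m:]) l"

lemma ring_map_eval3: "ring_map (eval3 l m z)"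
  unfolding eval3_def
  by (rule ring_map_comp[OF ring_map_comp[OF ring_map_eval ring_map_eval] ring_map_eval])

lemma poly_eq_0_of_values:
  fixes p :: "'a::idom poly"
  assumes "infinite S" "\<And>x. x \<in> S \<Longrightarrow> poly p x = 0"
  shows "p = 0"
  using assms poly_roots_finite[of p] finite_subset[of S "{x. poly p x = 0}"] by blast

lemma poly_eq_0_of_consts:
  fixes p :: "'a::{idom, ring_char_0} poly poly"
  assumes "\<And>c. poly p [:c:] = 0"
  shows "p = 0"
proof (rule poly_eq_0_of_values)
  show "infinite (range (\<lambda>c::'a. [:c:]))"
    by (simp add: finite_image_iff inj_on_def infinite_UNIV_char_0)
qed (use assms in auto)

text \<open>This carries identities known at complex points over to the polynomial ring, and from
  there to the function field.\<close>

lemma eval3_eq_0: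
  assumes "\<And>l m z. eval3 l m z P = 0"
  shows "P = 0"
proof -
  have "poly (poly (poly P [:[:z:]:]) [:m:]) = poly 0" for m z
    using assms by (auto simp: eval3_def fun_eq_iff)
  then have "poly (poly P [:[:z:]:]) [:m:] = 0" for m z
    by (simp only: poly_eq_poly_eq_iff)
  then have P: "poly P [:[:z:]:] = 0" for z
    by (rule poly_eq_0_of_consts)
  show ?thesis
  proof (rule poly_eq_0_of_values)
    show "infinite (range (\<lambda>z. [:[:z:]:]) :: cpoly2 set)"
      by (simp add: finite_image_iff inj_on_def infinite_UNIV_char_0)
  qed (use P in auto)
qed

text \<open>On the generic point, scaled to \<open>y 2 = 1\<close>, the coordinates \<open>y 3 = l\<close>, \<open>y 4 = m\<close> and
  \<open>y 0 + \<i> * y 1 = z\<close> are independent and \<open>y 0 - \<i> * y 1 = f / z\<close> with \<open>f = - var_l * conic_poly a c\<close>.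
  Here it is multiplied by \<open>z\<close> to have polynomial coordinates.\<close>

definition generic_point :: "real \<Rightarrow> real \<Rightarrow> nat \<Rightarrow> cpoly2 poly" where
  "generic_point a c i =
    (if i = 0 then [:[:[:1/2:]:]:] * ([:0, 1:]\<^sup>2 - [:var_l * conic_poly a c:])
     else if i = 1 then [:[:[:-\<i>/2:]:]:] * ([:0, 1:]\<^sup>2 + [:var_l * conic_poly a c:])
     else if i = 2 then [:0, 1:] else if i = 3 then [:var_l:] * [:0, 1:]
     else if i = 4 then [:var_m:] * [:0, 1:] else 0)"

lemma eval3_generic_point:
  fixes l m z :: complex and a c :: real
  defines "Q \<equiv> 1 + m\<^sup>2 + of_real a * l + of_real c * l\<^sup>2"
  shows "eval3 l m z (generic_point a c i) =
    (if i = 0 then (z\<^sup>2 - l * Q) / 2 else if i = 1 then - \<i> * (z\<^sup>2 + l * Q) / 2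
     else if i = 2 then z else if i = 3 then l * z else if i = 4 then m * z else 0)"
  by (simp add: generic_point_def eval3_def Q_def conic_poly_eq var_l_def var_m_def
      power2_eq_square algebra_simps)

text \<open>The forms \<open>g\<close> and \<open>h\<close> stand for rational maps from the
  threefold to a projective space and back whose composition is the identity at the generic point.
  On the line from a real point to the image of the generic point, \<open>norm_form_line\<close>
  compares \<open>h 2 * h 3\<close> at the two ends: a real constant at one end, l times a square at
  the other. So l would be a real multiple of a norm.\<close>

lemma not_dominated_by_projective_space:
  fixes a s :: real and n d e :: nat and g h :: "nat \<Rightarrow> nat rpoly" and P :: "cpoly2 poly"
  assumes s: "s \<noteq> 0" and disc: "a\<^sup>2 \<noteq> 4 * s\<^sup>2"
    and g: "\<And>j. multihomogeneous (proj_space 4) (\<lambda>_. d) (g j)"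
    and h: "\<And>j. multihomogeneous (proj_space n) (\<lambda>_. e) (h j)"
    and image: "\<And>t. normal_form (of_real a) (of_real (s\<^sup>2)) (\<lambda>j. peval (h j) t) = 0"
    and P: "P \<noteq> 0"
    and sect: "\<And>l m z y. eval3 l m z P \<noteq> 0 \<Longrightarrow>
      y = (\<lambda>i. eval3 l m z (generic_point a (s\<^sup>2) i)) \<Longrightarrow>
      peval (h 2) (\<lambda>k. peval (g k) y) \<noteq> 0 \<and>
      (\<forall>i\<le>4. \<forall>j\<le>4. y i * peval (h j) (\<lambda>k. peval (g k) y) = y j * peval (h i) (\<lambda>k. peval (g k) y))"
  shows False
proof -
  define c where "c = s\<^sup>2"
  define f where "f = to_fract (- (var_l * conic_poly a c))"
  have c: "c \<noteq> 0" "a\<^sup>2 \<noteq> 4 * c"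
    using s disc by (simp_all add: c_def)
  have lQ: "var_l \<noteq> 0" "conic_poly a c \<noteq> 0"
    using prime_var_l prime_conic_poly[OF c] by auto
  interpret T: ring_map cnj_fract
    by (rule ring_map_cnj_fract)
  interpret c2: ring_map cnj2
    by (rule ring_map_cnj2)
  interpret C: conic_involution cnj_fract f
  proof
    show "cnj_fract (cnj_fract x) = x" for x
      by (rule cnj_fract_invol)
    show "cnj_fract f = f"
      by (simp only: f_def cnj_fract_to_fract c2.map_uminus c2.map_mult cnj2_var_l cnj2_conic_poly)
    show "f \<noteq> 0"
      using lQ by (simp add: f_def)
  qed
  \<comment> \<open>The target is the function field C(l, m)(z) of the threefold;
    \<open>cst\<close>, \<open>CC\<close> and \<open>RR\<close> embed C[l, m], the complex and the
    real numbers.\<close>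
  define cst :: "cpoly2 \<Rightarrow> cpoly2 fract poly fract" where "cst p = to_fract [:to_fract p:]" for p
  interpret cst: ring_map cst
    unfolding cst_def by (rule ring_map_comp[OF ring_map_to_fract C.ring_map_const])
  have \<sigma>_cst: "C.\<sigma> (cst p) = cst (cnj2 p)" for p
    by (simp add: cst_def C.map_const cnj_fract_to_fract)
  define CC where "CC r = cst [:[:r:]:]" for r
  interpret CC: ring_map CC
    unfolding CC_def
    by (rule ring_map_comp[OF ring_map_comp[OF ring_map_const_poly ring_map_const_poly] cst.ring_map_axioms])
  have \<sigma>_CC: "C.\<sigma> (CC r) = CC (cnj r)" for r
    by (simp add: CC_def \<sigma>_cst cnj2_def map_poly_pCons)
  have CC0: "CC r = 0 \<longleftrightarrow> r = 0" for r
    by (simp add: CC_def cst_def)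
  define RR :: "real \<Rightarrow> _" where "RR r = CC (of_real r)" for r
  interpret RR: ring_map RR
    unfolding RR_def by (rule ring_map_comp[OF ring_map_of_real CC.ring_map_axioms])
  have \<sigma>_RR: "C.\<sigma> (RR r) = RR r" for r
    by (simp add: RR_def \<sigma>_CC)
  interpret F: field_involution C.\<sigma> "CC \<i>"
  proof
    show "C.\<sigma> (C.\<sigma> x) = x" for x
      by (rule C.\<sigma>_invol)
    show "CC \<i> * CC \<i> = - 1"
      by (simp flip: CC.map_mult add: CC.map_uminus CC.map_one)
    show "C.\<sigma> (CC \<i>) = - CC \<i>"
      by (simp add: \<sigma>_CC CC.map_uminus)
    show "(2 :: cpoly2 fract poly fract) \<noteq> 0"
      using CC0[of 2] by (simp add: CC.map_numeral)
  qed
  define z where "z = (to_fract [:0, 1:] :: cpoly2 fract poly fract)"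
  have z0: "z \<noteq> 0"
    by (simp add: z_def)
  define f' where "f' = cst (- (var_l * conic_poly a c))"
  have \<sigma>_z: "C.\<sigma> z = f' / z"
    unfolding z_def f'_def cst_def f_def[symmetric] by (rule C.map_z)
  have f'0: "f' \<noteq> 0"
    using lQ by (simp add: f'_def cst_def)
  have \<sigma>_f': "C.\<sigma> f' = f'"
    by (simp add: f'_def \<sigma>_cst c2.map_uminus c2.map_mult cnj2_var_l cnj2_conic_poly)
  \<comment> \<open>Each object below has a version over C[l, m][z] (names in P), which can be
    evaluated at complex points, and one in the function field (names in K); \<open>emb\<close>
    matches them up to powers of z.\<close>
  define emb where "emb p = (to_fract (map_poly to_fract p) :: cpoly2 fract poly fract)" for p
  interpret emb: ring_map emb
    unfolding emb_def by (rule ring_map_comp[OF ring_map.ring_map_poly[OF ring_map_to_fract] ring_map_to_fract])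
  have emb0: "emb p = 0 \<longleftrightarrow> p = 0" for p
    by (simp add: emb_def)
  have emb_const: "emb [:q:] = cst q" for q
    by (simp add: emb_def cst_def map_poly_pCons)
  have emb_z: "emb [:0, 1:] = z"
    by (simp add: emb_def z_def map_poly_pCons)
  \<comment> \<open>The generic point scaled to \<open>y 2 = 1\<close>. As \<open>\<sigma>\<close>
    exchanges \<open>z\<close> and \<open>f' / z\<close>, all its coordinates are fixed.\<close>
  define y where "y i = (if i = 0 then CC (1/2) * (z + f' / z) else if i = 1 then CC (-\<i>/2) * (z - f' / z)
     else if i = 2 then 1 else if i = 3 then cst var_l else if i = 4 then cst var_m else 0)" for i :: nat
  have cnj2_var_m: "cnj2 var_m = var_m"
    by (simp add: cnj2_def var_m_def map_poly_pCons)
  have \<sigma>_fz: "C.\<sigma> (f' / z) = z"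
    using f'0 z0 by (simp add: C.map_divide \<sigma>_f' \<sigma>_z)
  have \<sigma>_y: "C.\<sigma> (y i) = y i" for i
  proof -
    have "CC (\<i>/2) * (f' / z - z) = CC (-\<i>/2) * (z - f' / z)"
      using CC.map_uminus[of "\<i>/2"] by (simp add: algebra_simps)
    then show ?thesis
      by (simp add: y_def C.\<sigma>.map_mult C.\<sigma>.map_add C.\<sigma>.map_diff \<sigma>_CC \<sigma>_z \<sigma>_fz \<sigma>_cst cnj2_var_l cnj2_var_m
          C.\<sigma>.map_zero C.\<sigma>.map_one add.commute)
  qed
  have emb_generic: "emb (generic_point a c i) = z * y i" for i
    using z0
    by (simp add: generic_point_def y_def emb.map_mult emb.map_diff emb.map_add emb.map_power emb_z
        emb_const CC_def emb.map_zero f'_def cst.map_uminus cst.map_mult power2_eq_square field_simps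
        del: mult_pCons_left mult_pCons_right)
  define RP where "RP r = ([:[:[:of_real r:]:]:] :: cpoly2 poly)" for r :: real
  interpret RP: ring_map RP
    unfolding RP_def
    by (rule ring_map_comp[OF ring_map_comp[OF ring_map_comp[OF ring_map_of_real ring_map_const_poly]
        ring_map_const_poly] ring_map_const_poly])
  have emb_RP: "emb (RP r) = RR r" for r
    by (simp add: RP_def RR_def CC_def emb_const)
  define gP where "gP j = eval_in RP (g j) (generic_point a c)" for j
  define gK where "gK j = eval_in RR (g j) y" for j
  have emb_gP: "emb (gP j) = z ^ d * gK j" for j
    by (simp add: gP_def gK_def emb.map_eval_in emb_RP emb_generic eval_in_scale[OF g])
  define hK where "hK j = eval_in RR (h j) gK" for j
  define hP where "hP j = eval_in RP (h j) gP" for j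
  have emb_hP: "emb (hP j) = (z ^ d) ^ e * hK j" for j
    by (simp add: hP_def hK_def emb.map_eval_in emb_RP emb_gP eval_in_scale[OF h])
  define u where "u = z ^ d"
  have u0: "u \<noteq> 0"
    using z0 by (simp add: u_def)
  have \<sigma>_gK: "C.\<sigma> (gK j) = gK j" for j
    by (simp add: gK_def C.\<sigma>.map_eval_in \<sigma>_RR \<sigma>_y)
  have \<sigma>_hK: "C.\<sigma> (hK j) = hK j" for j
    by (simp add: hK_def C.\<sigma>.map_eval_in \<sigma>_RR \<sigma>_gK)
  have ev_RP: "eval3 l m w (RP r) = of_real r" for l m w r
    by (simp add: eval3_def RP_def)
  have ev_gP: "eval3 l m w (gP j) = peval (g j) (\<lambda>i. eval3 l m w (generic_point a c i))" for l m w j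
    by (simp add: gP_def ring_map.map_eval_in[OF ring_map_eval3] ev_RP peval_eq_eval_in)
  have ev_hP: "eval3 l m w (hP j) =
      peval (h j) (\<lambda>k. peval (g k) (\<lambda>i. eval3 l m w (generic_point a c i)))" for l m w j
    by (simp add: hP_def ring_map.map_eval_in[OF ring_map_eval3] ev_RP ev_gP peval_eq_eval_in)
  note sect' = sect[OF _ refl, folded c_def, folded ev_hP]
  \<comment> \<open>The composition is proportional to the identity wherever \<open>P\<close> does
    not vanish; multiplying by \<open>P\<close> makes this a polynomial identity at all
    points.\<close>
  have cross: "y i * hK j = y j * hK i" if "i \<le> 4" "j \<le> 4" for i j
  proof -
    have "P * (generic_point a c i * hP j - generic_point a c j * hP i) = 0"
    proof (rule eval3_eq_0)
      fix l m w
      show "eval3 l m w (P * (generic_point a c i * hP j - generic_point a c j * hP i)) = 0"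
        using sect'[of l m w] that
        by (auto simp: ring_map.map_mult[OF ring_map_eval3] ring_map.map_diff[OF ring_map_eval3])
    qed
    then have "generic_point a c i * hP j = generic_point a c j * hP i"
      using P by simp
    then have "emb (generic_point a c i * hP j) = emb (generic_point a c j * hP i)"
      by simp
    then have "(z * u ^ e) * (y i * hK j) = (z * u ^ e) * (y j * hK i)"
      by (simp add: emb.map_mult emb_generic emb_hP u_def mult_ac)
    then show ?thesis
      using z0 u0 by simp
  qed
  have "\<exists>l m w. eval3 l m w (P * [:0, 1:] * [:var_l:]) \<noteq> 0"
  proof (rule ccontr)
    assume "\<not> ?thesis"
    then have "P * [:0, 1:] * [:var_l:] = 0"
      by (intro eval3_eq_0) auto
    then show False
      using P lQ by (simp only: mult_eq_0_iff) simp
  qed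
  then obtain l0 m0 w0 where "eval3 l0 m0 w0 (P * [:0, 1:] * [:var_l:]) \<noteq> 0"
    by blast
  then have pt: "eval3 l0 m0 w0 P \<noteq> 0" "w0 \<noteq> 0" "l0 \<noteq> 0"
    by (auto simp: eval3_def var_l_def)
  have h2: "eval3 l0 m0 w0 (hP 2) \<noteq> 0"
    using sect'[OF pt(1)] by simp
  have h3: "eval3 l0 m0 w0 (hP 3) \<noteq> 0"
  proof -
    have "eval3 l0 m0 w0 (generic_point a c 2) * eval3 l0 m0 w0 (hP 3) =
        eval3 l0 m0 w0 (generic_point a c 3) * eval3 l0 m0 w0 (hP 2)"
      using sect'[OF pt(1)] by simp
    then show ?thesis
      using h2 pt by (auto simp: eval3_generic_point)
  qed
  have hK2: "hK 2 \<noteq> 0"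
    using h2 emb0[of "hP 2"] by (auto simp: emb_hP ring_map.map_zero[OF ring_map_eval3])
  \<comment> \<open>The product does not vanish identically, hence not at all real points. A real
    \<open>t\<close> with nonzero value is the starting point of the line.\<close>
  have "peval (h 2 * h 3) (\<lambda>k. peval (g k) (\<lambda>i. eval3 l0 m0 w0 (generic_point a c i))) \<noteq> 0"
    using h2 h3 by (simp add: peval_mult ev_hP)
  then obtain t :: "nat \<Rightarrow> real" where t: "peval (h 2 * h 3) (\<lambda>i. of_real (t i)) \<noteq> 0"
    by (rule real_points_dense)
  define r where "r = eval_in (\<lambda>x. x) (h 2) t * eval_in (\<lambda>x. x) (h 3) t"
  have "complex_of_real r = peval (h 2 * h 3) (\<lambda>i. of_real (t i))"
    by (simp add: r_def peval_mult ring_map.map_eval_in[OF ring_map_of_real] flip: peval_eq_eval_in)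
  then have r: "r \<noteq> 0"
    using t by auto
  define RL where "RL x = [:RR x:]" for x
  interpret RL: ring_map RL
    unfolding RL_def by (rule ring_map_comp[OF RR.ring_map_axioms ring_map_const_poly])
  \<comment> \<open>the line from the real point \<open>t\<close> to the image of the generic point\<close>
  define \<xi> where "\<xi> k = [:RR (t k), gK k - RR (t k):]" for k
  define H where "H j = eval_in RL (h j) \<xi>" for j
  have "F.bar (RL x) = RL x" "F.bar (\<xi> k) = \<xi> k" for x k
    by (simp_all add: RL_def \<xi>_def map_poly_pCons C.\<sigma>.map_zero C.\<sigma>.map_diff \<sigma>_RR \<sigma>_gK)
  then have bar_H: "F.bar (H j) = H j" for j
    by (simp add: H_def F.bar.map_eval_in)
  have RL: "poly (RL x) v = RR x" for x v
    by (simp add: RL_def)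
  have \<xi>: "poly (\<xi> k) 0 = RR (t k)" "poly (\<xi> k) 1 = gK k" for k
    by (simp_all add: \<xi>_def)
  have H0: "poly (H j) 0 = RR (eval_in (\<lambda>x. x) (h j) t)" for j
    by (simp add: H_def ring_map.map_eval_in[OF ring_map_eval] RL \<xi> RR.map_eval_in)
  have H1: "poly (H j) 1 = hK j" for j
    by (simp add: H_def hK_def ring_map.map_eval_in[OF ring_map_eval] RL \<xi>)
  define RS where "RS x = [:RP x:]" for x
  interpret RS: ring_map RS
    unfolding RS_def by (rule ring_map_comp[OF RP.ring_map_axioms ring_map_const_poly])
  \<comment> \<open>The line with the denominators \<open>z ^ d\<close> cleared. The normal form
    vanishes on it after every substitution of complex values for the four variables, hence
    identically, and \<open>emb\<close> carries this over to \<open>H\<close>.\<close>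
  define \<Xi> where "\<Xi> k = [:[:0, 1:] ^ d * RP (t k), gP k - [:0, 1:] ^ d * RP (t k):]" for k
  define HP where "HP j = eval_in RS (h j) \<Xi>" for j
  have "normal_form (RS a) (RS c) HP = 0"
  proof (rule poly_eq_0_of_values)
    show "infinite (range (\<lambda>w. [:[:[:w:]:]:]) :: cpoly2 poly set)"
      by (simp add: finite_image_iff inj_on_def infinite_UNIV_char_0)
    fix x :: "cpoly2 poly" assume "x \<in> range (\<lambda>w. [:[:[:w:]:]:])"
    show "poly (normal_form (RS a) (RS c) HP) x = 0"
    proof (rule eval3_eq_0)
      fix l m w
      interpret E: ring_map "\<lambda>q. eval3 l m w (poly q x)"
        by (rule ring_map_comp[OF ring_map_eval ring_map_eval3])
      have "eval3 l m w (poly (RS r) x) = of_real r" for r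
        by (simp add: RS_def ev_RP)
      then show "eval3 l m w (poly (normal_form (RS a) (RS c) HP) x) = 0"
        using image by (simp add: E.map_normal_form HP_def E.map_eval_in flip: peval_eq_eval_in c_def)
    qed
  qed
  then have "map_poly emb (normal_form (RS a) (RS c) HP) = 0"
    by simp
  moreover have "map_poly emb (RS x) = RL x" for x
    by (simp add: RS_def RL_def map_poly_pCons emb.map_zero emb_RP)
  moreover have "map_poly emb (\<Xi> k) = [:u:] * \<xi> k" for k
    by (simp add: \<Xi>_def \<xi>_def map_poly_pCons emb.map_zero emb.map_diff emb.map_mult emb.map_power
        emb_z emb_RP emb_gP u_def algebra_simps)
  ultimately have "([:u:] ^ e) ^ 3 * normal_form (RL a) (RL c) H = 0"
    using ring_map.map_normal_form[OF emb.ring_map_poly, of "RS a" "RS c" HP]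
    by (simp add: HP_def H_def ring_map.map_eval_in[OF emb.ring_map_poly] eval_in_scale[OF h]
        del: mult_pCons_left flip: normal_form_scale)
  then have nf: "normal_form (RL a) (RL c) H = 0"
    using u0 by simp
  have "RL c = [:RR s:]\<^sup>2"
    by (simp add: RL_def c_def RR.map_mult power2_eq_square)
  then have eq: "H 2 * ((H 0)\<^sup>2 + (H 1)\<^sup>2) +
      H 3 * ((H 2)\<^sup>2 + (H 4)\<^sup>2 + [:RR a:] * H 3 * H 2 + [:RR s:]\<^sup>2 * (H 3)\<^sup>2) = 0"
    using nf by (simp add: normal_form_def RL_def)
  have RRr: "poly (H 2 * H 3) 0 = RR r" "RR r \<noteq> 0"
    using r by (simp_all add: H0 r_def RR.map_mult) (simp_all add: RR_def CC0 r_def)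
  have "RR s \<noteq> 0"
    using s by (simp add: RR_def CC0)
  then obtain w where w: "poly (H 2 * H 3) 1 = RR r * (w * C.\<sigma> w)"
    using F.norm_form_line[OF bar_H bar_H bar_H bar_H bar_H \<sigma>_RR _ eq] RRr by metis
  have "hK 3 = cst var_l * hK 2"
    using cross[of 2 3] by (simp add: y_def)
  \<comment> \<open>\<open>hK 2\<close> is fixed by \<open>\<sigma>\<close>, so its square is a norm
    and can be divided out.\<close>
  then have "cst var_l * (hK 2 * hK 2) = RR r * (w * C.\<sigma> w)"
    using w by (simp add: H1 mult_ac)
  then have "(w / hK 2) * C.\<sigma> (w / hK 2) = cst var_l / RR r"
    using hK2 RRr by (simp add: C.map_divide \<sigma>_hK field_simps)
  also have "\<dots> = cst ([:[:of_real (1 / r):]:] * var_l)"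
  proof -
    have "RR r * RR (1 / r) = 1"
      using r by (simp flip: RR.map_mult add: RR.map_one)
    then show ?thesis
      using RRr by (simp only: cst.map_mult flip: CC_def RR_def) (simp add: field_simps)
  qed
  finally have norm: "(w / hK 2) * C.\<sigma> (w / hK 2) = to_fract [:to_fract ([:[:of_real (1 / r):]:] * var_l):]"
    by (simp only: cst_def)
  have "to_fract ([:[:of_real (1 / r):]:] * var_l) \<noteq> 0"
    using r lQ by (simp only: to_fract_eq_0_iff mult_eq_0_iff) simp
  from C.norm_over_conic[OF this norm] obtain p q i j where pq: "p \<noteq> 0" "q \<noteq> 0"
    "p * cnj_fract p * f ^ i = to_fract ([:[:of_real (1 / r):]:] * var_l) * f ^ j * (q * cnj_fract q)"
    by blast
  obtain p1 p2 where p: "p = Fract p1 p2" "p2 \<noteq> 0"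
    by (cases p)
  obtain q1 q2 where q: "q = Fract q1 q2" "q2 \<noteq> 0"
    by (cases q)
  have p1: "p1 \<noteq> 0" and q1: "q1 \<noteq> 0"
    using pq p q by (auto simp: fract_collapse)
  have cnj0: "cnj2 x = 0 \<longleftrightarrow> x = 0" for x
    by (metis cnj2_cnj2 c2.map_zero)
  \<comment> \<open>The denominators are cleared together with their conjugates, so that both sides
    keep their norm factors.\<close>
  have "to_fract ((p1 * q2) * cnj2 (p1 * q2) * (- (var_l * conic_poly a c)) ^ i) =
      to_fract ([:[:of_real (1 / r):]:] * var_l * (- (var_l * conic_poly a c)) ^ j * ((q1 * p2) * cnj2 (q1 * p2)))"
  proof -
    have pe: "p = to_fract p1 / to_fract p2" "cnj_fract p = to_fract (cnj2 p1) / to_fract (cnj2 p2)"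
      using p by (simp_all add: Fract_conv_to_fract cnj_fract_Fract[OF p(2), unfolded Fract_conv_to_fract])
    have qe: "q = to_fract q1 / to_fract q2" "cnj_fract q = to_fract (cnj2 q1) / to_fract (cnj2 q2)"
      using q by (simp_all add: Fract_conv_to_fract cnj_fract_Fract[OF q(2), unfolded Fract_conv_to_fract])
    define R where "R = to_fract ([:[:of_real (1 / r):]:] * var_l)"
    have "to_fract p1 * to_fract q2 * (to_fract (cnj2 p1) * to_fract (cnj2 q2)) * f ^ i =
        R * f ^ j * (to_fract q1 * to_fract p2 * (to_fract (cnj2 q1) * to_fract (cnj2 p2)))"
      using pq(3) p(2) q(2) cnj0[of p2] cnj0[of q2] unfolding pe(2) qe(2) R_def[symmetric] unfolding pe(1) qe(1)
      by (simp add: field_simps)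
    then show ?thesis
      by (simp only: R_def f_def to_fract_mult c2.map_mult ring_map.map_power[OF ring_map_to_fract])
  qed
  then have "(p1 * q2) * cnj2 (p1 * q2) * (- (var_l * conic_poly a c)) ^ i =
      [:[:of_real (1 / r):]:] * var_l * (- (var_l * conic_poly a c)) ^ j * ((q1 * p2) * cnj2 (q1 * p2))"
    by (simp only: to_fract_eq_iff)
  from parity_obstruction[OF c _ _ _ this] show False
    using r p1 q1 p(2) q(2) by simp
qed

section \<open>Symmetric tensors of cubic forms\<close>

definition scale :: "complex \<Rightarrow> (nat \<Rightarrow> complex) \<Rightarrow> nat \<Rightarrow> complex" (infixr "\<odot>" 75) where
  "c \<odot> x = (\<lambda>i. c * x i)"

lemma scale_apply [simp]: "(c \<odot> x) i = c * x i"
  by (simp add: scale_def)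

definition tri :: "(nat \<Rightarrow> nat \<Rightarrow> nat \<Rightarrow> real) \<Rightarrow> (nat \<Rightarrow> complex) \<Rightarrow> (nat \<Rightarrow> complex) \<Rightarrow> (nat \<Rightarrow> complex) \<Rightarrow> complex" where
  "tri C x y z = (\<Sum>i\<le>4. \<Sum>j\<le>4. \<Sum>k\<le>4. of_real (C i j k) * x i * y j * z k)"

lemma tri_swap12: "tri C x y z = tri (\<lambda>i j k. C j i k) y x z"
  unfolding tri_def by (subst sum.swap) (simp add: mult_ac)

lemma tri_swap23: "tri C x y z = tri (\<lambda>i j k. C i k j) x z y"
  unfolding tri_def by (rule sum.cong[OF refl], subst sum.swap) (simp add: mult_ac)

lemma tri_tensor_add: "tri (\<lambda>i j k. C i j k + D i j k) x y z = tri C x y z + tri D x y z"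
  by (simp add: tri_def distrib_right sum.distrib)

lemma tri_tensor_scale: "tri (\<lambda>i j k. r * C i j k) x y z = of_real r * tri C x y z"
  by (simp add: tri_def sum_distrib_left mult_ac)

lemma tri_sum_tensor: "tri (\<lambda>i j k. \<Sum>a\<in>A. C a i j k) x y z = (\<Sum>a\<in>A. tri (C a) x y z)"
  by (induction A rule: infinite_finite_induct) (simp_all add: tri_tensor_add, simp_all add: tri_def)

lemma mono_eval_Suc:
  assumes "Poly_Mapping.keys m \<subseteq> {..n}" "(\<Sum>i\<le>n. Poly_Mapping.lookup m i) = Suc d"
  obtains a m' where "a \<le> n" "Poly_Mapping.keys m' \<subseteq> {..n}" "(\<Sum>i\<le>n. Poly_Mapping.lookup m' i) = d"
    "\<And>x :: nat \<Rightarrow> complex. mono_eval m x = x a * mono_eval m' x"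
proof -
  obtain a where a: "a \<le> n" "Poly_Mapping.lookup m a \<noteq> 0"
  proof -
    have "\<exists>a\<in>{..n}. Poly_Mapping.lookup m a \<noteq> 0"
      using assms(2) by (metis nat.simps(3) sum.neutral)
    with that show ?thesis
      by auto
  qed
  define m' where "m' = m - Poly_Mapping.single a 1"
  have m: "m = Poly_Mapping.single a 1 + m'"
    using a by (intro poly_mapping_eqI) (auto simp: m'_def lookup_add lookup_minus lookup_single when_def)
  have "Poly_Mapping.keys m' \<subseteq> {..n}"
    using assms(1) by (auto simp: m'_def in_keys_iff lookup_minus subset_iff)
  moreover have "Suc (\<Sum>i\<le>n. Poly_Mapping.lookup m' i) = Suc d"
  proof -
    have "(\<Sum>i\<le>n. Poly_Mapping.lookup m i) = (\<Sum>i\<le>n. (if a = i then 1 else 0) + Poly_Mapping.lookup m' i)"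
      by (rule sum.cong) (auto simp: arg_cong[OF m, of "\<lambda>m. Poly_Mapping.lookup m _"] lookup_add lookup_single when_def)
    then show ?thesis
      using assms(2) a by (simp add: sum.distrib)
  qed
  moreover have "mono_eval m x = x a * mono_eval m' x" for x :: "nat \<Rightarrow> complex"
    by (subst m) (simp only: mono_eval_add, simp add: mono_eval_def)
  ultimately show ?thesis
    using that a by blast
qed

lemma mono_eval_cubic:
  assumes "Poly_Mapping.keys m \<subseteq> {..n}" "(\<Sum>i\<le>n. Poly_Mapping.lookup m i) = 3"
  obtains a b c where "a \<le> n" "b \<le> n" "c \<le> n" "\<And>x :: nat \<Rightarrow> complex. mono_eval m x = x a * x b * x c"
proof -
  obtain a m1 where 1: "a \<le> n" "Poly_Mapping.keys m1 \<subseteq> {..n}" "(\<Sum>i\<le>n. Poly_Mapping.lookup m1 i) = 2"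
    "\<And>x :: nat \<Rightarrow> complex. mono_eval m x = x a * mono_eval m1 x"
    using mono_eval_Suc[of m n 2] assms by auto
  obtain b m2 where 2: "b \<le> n" "Poly_Mapping.keys m2 \<subseteq> {..n}" "(\<Sum>i\<le>n. Poly_Mapping.lookup m2 i) = 1"
    "\<And>x :: nat \<Rightarrow> complex. mono_eval m1 x = x b * mono_eval m2 x"
    using mono_eval_Suc[of m1 n 1] 1 by auto
  obtain c m3 where 3: "c \<le> n" "Poly_Mapping.keys m3 \<subseteq> {..n}" "(\<Sum>i\<le>n. Poly_Mapping.lookup m3 i) = 0"
    "\<And>x :: nat \<Rightarrow> complex. mono_eval m2 x = x c * mono_eval m3 x"
    using mono_eval_Suc[of m2 n 0] 2 by auto
  have "Poly_Mapping.lookup m3 t = 0" for t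
    using 3(2,3) by (cases "t \<le> n") (auto simp: in_keys_iff subset_iff)
  then have "m3 = 0"
    by (intro poly_mapping_eqI) simp
  then have "mono_eval m3 x = 1" for x :: "nat \<Rightarrow> complex"
    by (simp add: mono_eval_def)
  then show ?thesis
    using that[of a b c] 1 2 3 by simp
qed

text \<open>A product of three coordinates is the cubic of a tensor with a single entry. The sum
  \<open>D\<close> of these over all monomials is then averaged over the six permutations of its
  indices, which does not change its values on the diagonal.\<close>

lemma cubic_tensor_exists:
  assumes "multihomogeneous (proj_space 4) (\<lambda>_. 3) F"
  obtains C where "\<And>i j k. C i j k = C j i k" "\<And>i j k. C i j k = C i k j" "\<And>x. peval F x = tri C x x x"
proof -
  have "\<exists>E. \<forall>x. mono_eval m x = tri E x x x" if "m \<in> Poly_Mapping.keys F" for m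
  proof -
    have "Poly_Mapping.keys m \<subseteq> {..4}" "(\<Sum>i\<le>4. Poly_Mapping.lookup m i) = 3"
      using assms that by (auto simp: multihomogeneous_def)
    then obtain a b c where abc: "a \<le> 4" "b \<le> 4" "c \<le> 4"
      "\<And>x :: nat \<Rightarrow> complex. mono_eval m x = x a * x b * x c"
      by (rule mono_eval_cubic) blast
    define \<delta> where "\<delta> a i = (if i = a then 1 else 0 :: real)" for a i :: nat
    have \<delta>: "(\<Sum>i\<le>4. of_real (\<delta> a i) * x i) = x a" if "a \<le> 4" for a and x :: "nat \<Rightarrow> complex"
      using that by (simp add: \<delta>_def if_distrib[where f = "\<lambda>t. t * _"] if_distrib[where f = of_real] cong: if_cong)
    have "tri (\<lambda>i j k. \<delta> a i * \<delta> b j * \<delta> c k) x x x =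
        (\<Sum>i\<le>4. of_real (\<delta> a i) * x i * (\<Sum>j\<le>4. of_real (\<delta> b j) * x j * (\<Sum>k\<le>4. of_real (\<delta> c k) * x k)))" for x
      by (simp add: tri_def sum_distrib_left mult_ac)
    then have "tri (\<lambda>i j k. \<delta> a i * \<delta> b j * \<delta> c k) x x x = x a * x b * x c" for x
      using abc(1-3) by (simp add: \<delta> flip: sum_distrib_right)
    with abc(4) show ?thesis
      by metis
  qed
  then obtain E where E: "\<And>m x. m \<in> Poly_Mapping.keys F \<Longrightarrow> mono_eval m x = tri (E m) x x x"
    by metis
  define D where "D i j k = (\<Sum>m\<in>Poly_Mapping.keys F. Poly_Mapping.lookup F m * E m i j k)" for i j k
  have D: "peval F x = tri D x x x" for x
    unfolding D_def tri_sum_tensor tri_tensor_scale peval_eq_eval_in eval_in_def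
    by (rule sum.cong) (simp_all add: E)
  define C where "C i j k = (1/6) * (D i j k + (D i k j + (D j i k + (D j k i + (D k i j + D k j i)))))" for i j k
  have perm: "tri (\<lambda>i j k. D i k j) x x x = tri D x x x" "tri (\<lambda>i j k. D j i k) x x x = tri D x x x"
    "tri (\<lambda>i j k. D j k i) x x x = tri D x x x" "tri (\<lambda>i j k. D k i j) x x x = tri D x x x"
    "tri (\<lambda>i j k. D k j i) x x x = tri D x x x" for x
    using tri_swap12[of D x x x] tri_swap23[of D x x x] tri_swap12[of "\<lambda>i j k. D i k j" x x x]
      tri_swap23[of "\<lambda>i j k. D j i k" x x x] tri_swap23[of "\<lambda>i j k. D j k i" x x x] by simp_all
  show ?thesis
  proof
    show "C i j k = C j i k" "C i j k = C i k j" for i j k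
      by (simp_all add: C_def)
    show "peval F x = tri C x x x" for x
      unfolding C_def tri_tensor_scale tri_tensor_add D by (simp add: perm)
  qed
qed

definition vec5 :: "(nat \<Rightarrow> complex) \<Rightarrow> bool" where
  "vec5 x \<longleftrightarrow> (\<forall>i>4. x i = 0)"

definition unit_vec :: "nat \<Rightarrow> nat \<Rightarrow> complex" where
  "unit_vec i = (\<lambda>j. if j = i then 1 else 0)"

definition cnjv :: "(nat \<Rightarrow> complex) \<Rightarrow> nat \<Rightarrow> complex" where
  "cnjv x = (\<lambda>i. cnj (x i))"

lemma cnjv_apply [simp]: "cnjv x i = cnj (x i)"
  by (simp add: cnjv_def)

lemma cnjv_cnjv [simp]: "cnjv (cnjv x) = x"
  by (simp add: cnjv_def)

lemma vec5_add [intro]: "vec5 x \<Longrightarrow> vec5 y \<Longrightarrow> vec5 (x + y)"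
  and vec5_diff [intro]: "vec5 x \<Longrightarrow> vec5 y \<Longrightarrow> vec5 (x - y)"
  and vec5_scale [intro]: "vec5 x \<Longrightarrow> vec5 (c \<odot> x)"
  and vec5_cnjv [intro]: "vec5 x \<Longrightarrow> vec5 (cnjv x)"
  by (simp_all add: vec5_def)

lemma hcoords_proj_space4: "x \<in> hcoords (proj_space 4) \<longleftrightarrow> vec5 x \<and> x \<noteq> 0"
  by (auto simp: hcoords_def vec5_def fun_eq_iff) (metis atMost_iff not_le)

locale cubic_tensor =
  fixes C :: "nat \<Rightarrow> nat \<Rightarrow> nat \<Rightarrow> real"
  assumes sym12: "C i j k = C j i k" and sym23: "C i j k = C i k j"
begin

abbreviation T :: "(nat \<Rightarrow> complex) \<Rightarrow> (nat \<Rightarrow> complex) \<Rightarrow> (nat \<Rightarrow> complex) \<Rightarrow> complex" where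
  "T \<equiv> tri C"

lemma T_swap12: "T x y z = T y x z"
proof -
  have "(\<lambda>i j k. C j i k) = C"
    by (intro ext) (rule sym12)
  then show ?thesis
    using tri_swap12[of C x y z] by simp
qed

lemma T_swap23: "T x y z = T x z y"
proof -
  have "(\<lambda>i j k. C i k j) = C"
    by (intro ext) (rule sym23)
  then show ?thesis
    using tri_swap23[of C x y z] by simp
qed

lemma T_swap13: "T x y z = T z y x"
  using T_swap12 T_swap23 by metis

lemma T_add1: "T (x + y) u v = T x u v + T y u v"
  by (simp add: tri_def algebra_simps sum.distrib)

lemma T_scale1: "T (c \<odot> x) u v = c * T x u v"
  by (simp add: tri_def sum_distrib_left mult_ac)

lemma T_add2: "T u (x + y) v = T u x v + T u y v"
  by (simp add: T_swap12[of u] T_add1)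

lemma T_scale2: "T u (c \<odot> x) v = c * T u x v"
  by (simp add: T_swap12[of u] T_scale1)

lemma T_add3: "T u v (x + y) = T u v x + T u v y"
  by (simp add: T_swap13[of u] T_add1)

lemma T_scale3: "T u v (c \<odot> x) = c * T u v x"
  by (simp add: T_swap13[of u] T_scale1)

lemmas T_linear = T_add1 T_add2 T_add3 T_scale1 T_scale2 T_scale3

lemma T_cnj: "T (cnjv x) (cnjv y) (cnjv z) = cnj (T x y z)"
  by (simp add: tri_def)

lemma T_cong3: "(\<And>i. i \<le> 4 \<Longrightarrow> z i = z' i) \<Longrightarrow> T x y z = T x y z'"
  by (simp add: tri_def)

lemma tendsto_T:
  assumes "\<And>i. ((\<lambda>t. x t i) \<longlongrightarrow> a i) F" "\<And>i. ((\<lambda>t. y t i) \<longlongrightarrow> b i) F" "\<And>i. ((\<lambda>t. z t i) \<longlongrightarrow> c i) F"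
  shows "((\<lambda>t. T (x t) (y t) (z t)) \<longlongrightarrow> T a b c) F"
  unfolding tri_def by (intro tendsto_intros assms)

lemma T_unit_vec: "T x y z = (\<Sum>i\<le>4. z i * T x y (unit_vec i))"
proof -
  have "T x y (unit_vec k) = (\<Sum>i\<le>4. \<Sum>j\<le>4. of_real (C i j k) * x i * y j)" if "k \<le> 4" for k
    using that by (simp add: tri_def unit_vec_def if_distrib[where f = "\<lambda>t. _ * t"] cong: if_cong)
  then have "(\<Sum>k\<le>4. z k * T x y (unit_vec k)) = (\<Sum>k\<le>4. \<Sum>i\<le>4. \<Sum>j\<le>4. of_real (C i j k) * x i * y j * z k)"
    by (intro sum.cong refl) (simp add: sum_distrib_left mult_ac)
  also have "\<dots> = (\<Sum>i\<le>4. \<Sum>k\<le>4. \<Sum>j\<le>4. of_real (C i j k) * x i * y j * z k)"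
    by (rule sum.swap)
  also have "\<dots> = T x y z"
    unfolding tri_def by (rule sum.cong[OF refl], rule sum.swap)
  finally show ?thesis ..
qed

text \<open>The derivative of the cubic at \<open>x\<close> in direction \<open>v\<close> is
  \<open>3 * T x x v\<close>; the direction \<open>x\<close> itself gives the equation of the
  hypersurface.\<close>

definition singular :: "(nat \<Rightarrow> complex) \<Rightarrow> bool" where
  "singular x \<longleftrightarrow> vec5 x \<and> x \<noteq> 0 \<and> (\<forall>v. T x x v = 0)"

lemma cubic_expand:
  "T (x + s \<odot> v) (x + s \<odot> v) (x + s \<odot> v) =
    T x x x + 3 * s * T x x v + 3 * s ^ 2 * T x v v + s ^ 3 * T v v v"
proof -
  have "T x v x = T x x v" "T v x x = T x x v" "T v x v = T x v v" "T v v x = T x v v"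
    by (metis T_swap12 T_swap23)+
  then show ?thesis
    by (simp add: T_linear algebra_simps power2_eq_square power3_eq_cube)
qed

lemma deriv_cubic: "deriv (\<lambda>t. T (x(i := t)) (x(i := t)) (x(i := t))) (x i) = 3 * T x x (unit_vec i)"
proof (rule DERIV_imp_deriv)
  have "x(i := t) = x + (t - x i) \<odot> unit_vec i" for t
    by (auto simp: fun_eq_iff unit_vec_def)
  then have eq: "T (x(i := t)) (x(i := t)) (x(i := t)) =
      T x x x + 3 * (t - x i) * T x x (unit_vec i) + 3 * (t - x i) ^ 2 * T x (unit_vec i) (unit_vec i) +
      (t - x i) ^ 3 * T (unit_vec i) (unit_vec i) (unit_vec i)" for t
    using cubic_expand by simp
  show "((\<lambda>t. T (x(i := t)) (x(i := t)) (x(i := t))) has_field_derivative 3 * T x x (unit_vec i)) (at (x i))"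
    unfolding eq by (auto intro!: derivative_eq_intros)
qed

lemma singular_iff:
  assumes F: "\<And>x. peval F x = T x x x"
  shows "x \<in> singular_coords F \<longleftrightarrow> singular x"
proof -
  have "(\<forall>i\<le>4. T x x (unit_vec i) = 0) \<longleftrightarrow> (\<forall>v. T x x v = 0)"
  proof (intro iffI allI)
    fix v assume "\<forall>i\<le>4. T x x (unit_vec i) = 0"
    then show "T x x v = 0"
      by (subst T_unit_vec) simp
  qed blast
  then show ?thesis
    unfolding singular_coords_def complex_points_def F singular_def
    by (auto simp: hcoords_proj_space4 deriv_cubic)
qed

lemma singular_scale: "singular x \<Longrightarrow> c \<noteq> 0 \<Longrightarrow> singular (c \<odot> x)"
  by (auto simp: singular_def T_linear fun_eq_iff vec5_def)

lemma singular_cnjv: "singular x \<Longrightarrow> singular (cnjv x)"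
proof -
  assume x: "singular x"
  have "T (cnjv x) (cnjv x) v = 0" for v
    using x T_cnj[of x x "cnjv v"] by (simp add: singular_def)
  then show ?thesis
    using x by (auto simp: singular_def fun_eq_iff vec5_def)
qed

end

section \<open>Quadratic parts at singular points\<close>

definition chart_dir :: "nat \<Rightarrow> complex^4 \<Rightarrow> nat \<Rightarrow> complex" where
  "chart_dir i q = (\<lambda>j. if j = i \<or> j > 4 then 0 else if j < i then q $ of_nat (j + 1) else q $ of_nat j)"

text \<open>In the type \<open>4\<close> the numeral 4 equals 0, so the last branch is the fourth
  component.\<close>

definition index4 :: "4 \<Rightarrow> nat" where
  "index4 k = (if k = 1 then 1 else if k = 2 then 2 else if k = 3 then 3 else 4)"

lemma index4_of_nat: "1 \<le> n \<Longrightarrow> n \<le> 4 \<Longrightarrow> index4 (of_nat n) = n"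
proof -
  assume "1 \<le> n" "n \<le> 4"
  then consider "n = 1" | "n = 2" | "n = 3" | "n = 4"
    by linarith
  then show ?thesis
    by cases (simp_all add: index4_def)
qed

definition chart_coord :: "nat \<Rightarrow> (nat \<Rightarrow> complex) \<Rightarrow> complex^4" where
  "chart_coord i w = (\<chi> k. let j = (if index4 k \<le> i then index4 k - 1 else index4 k) in
     w j)"

lemma affine_chart_add: "affine_chart i (q + r) = affine_chart i q + chart_dir i r"
  by (auto simp: affine_chart_def chart_dir_def fun_eq_iff)

lemma chart_dir_linear:
  "chart_dir i (c *s q) = c \<odot> chart_dir i q"
  "chart_dir i (q + r) = chart_dir i q + chart_dir i r"
  by (auto simp: chart_dir_def fun_eq_iff)

lemma chart_dir_coord:
  assumes "i \<le> 4" "vec5 w" "w i = 0"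
  shows "chart_dir i (chart_coord i w) = w"
proof
  fix j
  show "chart_dir i (chart_coord i w) j = w j"
    using assms index4_of_nat[of "j + 1"] index4_of_nat[of j]
    by (auto simp: chart_dir_def chart_coord_def vec5_def Let_def)
qed

lemma mholomorphic_vec:
  fixes \<phi> :: "complex^'n \<Rightarrow> complex^'m"
  assumes "\<And>k. mholomorphic_on (\<lambda>z. \<phi> z $ k) W" "x \<in> W"
  obtains A where "(\<phi> has_derivative A) (at x)" "\<And>c v. A (c *s v) = c *s A v"
proof -
  have "\<forall>k. \<exists>D. ((\<lambda>z. \<phi> z $ k) has_derivative D) (at x) \<and> (\<forall>c v. D (c *s v) = c * D v)"
    using assms unfolding mholomorphic_on_def by blast
  from choice[OF this] obtain D where D: "\<And>k. ((\<lambda>z. \<phi> z $ k) has_derivative D k) (at x)"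
    "\<And>k c v. D k (c *s v) = c * D k v"
    by blast
  have "(\<phi> has_derivative (\<lambda>v. \<chi> k. D k v)) (at x)"
  proof (subst has_derivative_componentwise_within, intro ballI)
    fix b :: "complex^'m" assume "b \<in> Basis"
    then obtain u k where b: "b = axis k u"
      by (auto simp: Basis_vec_def)
    show "((\<lambda>z. \<phi> z \<bullet> b) has_derivative (\<lambda>v. (\<chi> k. D k v) \<bullet> b)) (at x)"
      unfolding b inner_axis by (auto intro!: derivative_eq_intros D(1))
  qed
  with that[of "\<lambda>v. \<chi> k. D k v"] D(2) show ?thesis
    by (simp add: vec_eq_iff)
qed

text \<open>\<open>A\<close> and \<open>B\<close> are the derivatives of the map and of its inverse;
  the chain rule for their composition, which is the identity near the image point, gives
  \<open>A (B v) = v\<close>.\<close>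

lemma biholomorphism_derivatives:
  fixes \<phi> :: "complex^'n \<Rightarrow> complex^'n"
  assumes "biholomorphism W V \<phi>" "x \<in> W"
  obtains A B where "(\<phi> has_derivative A) (at x)" "\<And>c v. A (c *s v) = c *s A v" "\<And>c v. B (c *s v) = c *s B v"
    "\<And>v w. B (v + w) = B v + B w" "\<And>v. A (B v) = v"
proof -
  obtain \<psi> where open': "open W" "open V" and hom: "homeomorphism W V \<phi> \<psi>"
    and hol: "\<And>k. mholomorphic_on (\<lambda>z. \<phi> z $ k) W" "\<And>k. mholomorphic_on (\<lambda>z. \<psi> z $ k) V"
    using assms unfolding biholomorphism_def by auto
  have V: "\<phi> x \<in> V" and inv: "\<psi> (\<phi> x) = x"
    using hom assms(2) by (auto simp: homeomorphism_def)
  obtain A where A: "(\<phi> has_derivative A) (at x)" "\<And>c v. A (c *s v) = c *s A v"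
    using mholomorphic_vec[of \<phi> W, OF hol(1) assms(2)] by blast
  obtain B where B: "(\<psi> has_derivative B) (at (\<phi> x))" "\<And>c v. B (c *s v) = c *s B v"
    using mholomorphic_vec[of \<psi> V, OF hol(2) V] by blast
  have "((\<lambda>z. \<phi> (\<psi> z)) has_derivative (\<lambda>v. A (B v))) (at (\<phi> x))"
    using has_derivative_compose[OF B(1), of \<phi> A] A(1) by (simp add: inv)
  moreover have "((\<lambda>z. \<phi> (\<psi> z)) has_derivative (\<lambda>v. v)) (at (\<phi> x))"
    by (rule has_derivative_transform_within_open[OF has_derivative_ident open'(2) V])
      (use hom in \<open>auto simp: homeomorphism_def\<close>)
  ultimately have "(\<lambda>v. A (B v)) = (\<lambda>v. v)"
    by (rule has_derivative_unique)
  then have "A (B v) = v" for v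
    by meson
  moreover have "B (v + w) = B v + B w" for v w
    using has_derivative_bounded_linear[OF B(1)] by (simp add: bounded_linear.linear linear_add)
  ultimately show ?thesis
    using that A B(2) by blast
qed

text \<open>At a singular point the cubic starts with the quadratic form \<open>3 * T p w w\<close>,
  and up to a linear change of coordinates and the factor \<open>u 0\<close> this is the quadratic
  part \<open>q\<close> of the local equation. \<open>E\<close> transports \<open>q\<close> to the
  cubic, which is used to show that a quadratic part does not split, and \<open>R\<close> transports
  in the other direction, which is used to show that it splits.\<close>

lemma (in cubic_tensor) local_quadratic_part:
  assumes F: "\<And>x. peval F x = T x x x"
    and loc: "locally_analytically F P g"
    and P: "\<And>x. x \<in> P \<Longrightarrow> singular x"
    and g: "\<And>v. ((\<lambda>t. g (t *\<^sub>R v) / of_real (t\<^sup>2)) \<longlongrightarrow> q v) (at (0::real))"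
  shows "\<exists>p\<in>P. \<exists>u (E :: complex^4 \<Rightarrow> nat \<Rightarrow> complex) R. u \<noteq> 0 \<and>
    (\<forall>v. vec5 (E v)) \<and> (\<forall>c v. E (c *s v) = c \<odot> E v) \<and> (\<forall>v w. E (v + w) = E v + E w) \<and>
    (\<forall>c v. R (c \<odot> v) = c *s R v) \<and> (\<forall>v w. R (v + w) = R v + R w) \<and>
    (\<forall>v. T p (E v) (E v) = u * q v) \<and> (\<forall>w. vec5 w \<longrightarrow> T p w w = u * q (R w))"
proof -
  obtain i W V \<phi> u where i: "i \<le> 4" and bi: "biholomorphism W V \<phi>" and W: "0 \<in> W"
    and p: "affine_chart i (\<phi> 0) \<in> P" and u: "mholomorphic_on u W" "\<And>z. z \<in> W \<Longrightarrow> u z \<noteq> 0"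
    and eq: "\<And>z. z \<in> W \<Longrightarrow> peval F (affine_chart i (\<phi> z)) = u z * g z"
    using loc unfolding locally_analytically_def by metis
  obtain A B where A: "(\<phi> has_derivative A) (at 0)" "\<And>c v. A (c *s v) = c *s A v"
    and B: "\<And>c v. B (c *s v) = c *s B v" "\<And>v w. B (v + w) = B v + B w" and AB: "\<And>v. A (B v) = v"
    using biholomorphism_derivatives[OF bi W] by blast
  have A_add: "A (v + w) = A v + A w" for v w
    using has_derivative_bounded_linear[OF A(1)] by (simp add: bounded_linear.linear linear_add)
  define p0 where "p0 = affine_chart i (\<phi> 0)"
  have sing: "T p0 p0 v = 0" for v
    using P[OF p] by (simp add: singular_def p0_def)
  have "open W"
    using bi by (simp add: biholomorphism_def)
  define E where "E v = chart_dir i (A v)" for v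
  have TE: "3 * T p0 (E v) (E v) = u 0 * q v" for v
  proof -
    \<comment> \<open>With the difference quotient, the map at t v is exactly its value at 0 plus t
      times \<open>\<delta> t\<close>, so the cubic can be expanded at \<open>p0\<close> without an
      error term before passing to the limit.\<close>
    define \<delta> where "\<delta> t = (1 / t) *\<^sub>R (\<phi> (t *\<^sub>R v) - \<phi> 0)" for t :: real
    have "((\<lambda>t. \<phi> (t *\<^sub>R v)) has_vector_derivative A v) (at 0)"
    proof -
      have "((\<lambda>t::real. t *\<^sub>R v) has_vector_derivative v) (at 0)"
        by (auto intro!: derivative_eq_intros simp: has_vector_derivative_def)
      from vector_derivative_diff_chain_within[OF this, of \<phi> A] show ?thesis
        using A(1) by (simp add: o_def has_derivative_at_withinI)
    qed
    then have lim: "((\<lambda>t. norm (\<phi> (t *\<^sub>R v) - \<phi> 0 - t *\<^sub>R A v) / norm t) \<longlongrightarrow> 0) (at 0)"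
      by (simp add: has_vector_derivative_def has_derivative_at)
    have "norm (\<phi> (t *\<^sub>R v) - \<phi> 0 - t *\<^sub>R A v) / norm t = norm (\<delta> t - A v)" if "t \<noteq> 0" for t
    proof -
      have "\<delta> t - A v = (1 / t) *\<^sub>R (\<phi> (t *\<^sub>R v) - \<phi> 0 - t *\<^sub>R A v)"
        using that by (simp add: \<delta>_def scaleR_diff_right)
      then show ?thesis
        by simp
    qed
    then have "((\<lambda>t. norm (\<delta> t - A v)) \<longlongrightarrow> 0) (at 0)"
      by (intro Lim_transform_within[OF lim, of 1]) auto
    then have \<delta>: "(\<delta> \<longlongrightarrow> A v) (at 0)"
      by (rule LIM_zero_cancel[OF tendsto_norm_zero_cancel])
    define w where "w t = chart_dir i (\<delta> t)" for t
    have w: "((\<lambda>t. w t j) \<longlongrightarrow> E v j) (at 0)" for j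
      unfolding w_def E_def chart_dir_def by (auto intro!: tendsto_intros \<delta>)
    have lim1: "((\<lambda>t. 3 * T p0 (w t) (w t) + of_real t * T (w t) (w t) (w t)) \<longlongrightarrow>
        3 * T p0 (E v) (E v) + of_real 0 * T (E v) (E v) (E v)) (at 0)"
      by (intro tendsto_intros tendsto_T w)
    have lim2: "((\<lambda>t. u (t *\<^sub>R v) * (g (t *\<^sub>R v) / of_real (t\<^sup>2))) \<longlongrightarrow> u 0 * q v) (at 0)"
    proof (intro tendsto_mult g)
      have "isCont u 0"
        using u(1) W has_derivative_continuous unfolding mholomorphic_on_def by blast
      moreover have "((\<lambda>t. t *\<^sub>R v) \<longlongrightarrow> 0) (at (0::real))"
        by (auto intro!: tendsto_eq_intros)
      ultimately show "((\<lambda>t. u (t *\<^sub>R v)) \<longlongrightarrow> u 0) (at 0)"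
        by (rule isCont_tendsto_compose)
    qed
    have "eventually (\<lambda>t. 3 * T p0 (w t) (w t) + of_real t * T (w t) (w t) (w t) =
        u (t *\<^sub>R v) * (g (t *\<^sub>R v) / of_real (t\<^sup>2))) (at 0)"
    proof -
      have "((\<lambda>t. t *\<^sub>R v) \<longlongrightarrow> 0) (at (0::real))"
        by (auto intro!: tendsto_eq_intros)
      then have "eventually (\<lambda>t. t *\<^sub>R v \<in> W) (at (0::real))"
        using \<open>open W\<close> W by (rule topological_tendstoD)
      then show ?thesis
        using eventually_neq_at_within[of 0]
      proof eventually_elim
        fix t :: real assume t: "t *\<^sub>R v \<in> W" "t \<noteq> 0"
        have "\<phi> (t *\<^sub>R v) = \<phi> 0 + of_real t *s \<delta> t"
          using t(2) by (simp add: \<delta>_def vec_eq_iff del: scaleR_conv_of_real) (simp add: complex_eq_iff)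
        then have chart: "affine_chart i (\<phi> (t *\<^sub>R v)) = p0 + of_real t \<odot> w t"
          by (simp add: affine_chart_add chart_dir_linear p0_def w_def)
        have "u (t *\<^sub>R v) * g (t *\<^sub>R v) =
            of_real (t\<^sup>2) * (3 * T p0 (w t) (w t) + of_real t * T (w t) (w t) (w t))"
          using eq[OF t(1)] unfolding F chart cubic_expand
          by (simp add: sing algebra_simps power2_eq_square power3_eq_cube)
        then show "3 * T p0 (w t) (w t) + of_real t * T (w t) (w t) (w t) =
            u (t *\<^sub>R v) * (g (t *\<^sub>R v) / of_real (t\<^sup>2))"
          using t(2) by simp
      qed
    qed
    then have "((\<lambda>t. 3 * T p0 (w t) (w t) + of_real t * T (w t) (w t) (w t)) \<longlongrightarrow> u 0 * q v) (at 0)"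
      using lim2 by (subst tendsto_cong)
    from LIM_unique[OF lim1 this]
    have "3 * T p0 (E v) (E v) + of_real 0 * T (E v) (E v) (E v) = u 0 * q v" .
    then show ?thesis
      by simp
  qed
  \<comment> \<open>Subtracting a multiple of \<open>p0\<close> makes coordinate \<open>i\<close>
    vanish, as needed for a direction in the chart. As \<open>p0\<close> is singular, this does not
    change \<open>T p0 w w\<close>.\<close>
  define R where "R w = B (chart_coord i (w + (- w i) \<odot> p0))" for w
  have coord: "chart_coord i (c \<odot> v) = c *s chart_coord i v"
    "chart_coord i (v + w) = chart_coord i v + chart_coord i w" for c v w
    by (simp_all add: chart_coord_def vec_eq_iff Let_def)
  have "T p0 w w = u 0 / 3 * q (R w)" if "vec5 w" for w
  proof -
    have p0: "p0 i = 1" "vec5 p0"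
      using i by (simp_all add: p0_def affine_chart_def vec5_def)
    then have "E (R w) = w + (- w i) \<odot> p0"
      unfolding E_def R_def AB using i that by (intro chart_dir_coord) (auto simp: vec5_def)
    then have "T p0 (E (R w)) (E (R w)) = T p0 w w"
      using sing T_swap23[of p0 w p0] by (simp add: T_linear)
    then show ?thesis
      using TE[of "R w"] by (simp add: field_simps)
  qed
  moreover have "R (c \<odot> v) = c *s R v" "R (v + w) = R v + R w" for c v w
  proof -
    have "c \<odot> v + (- (c \<odot> v) i) \<odot> p0 = c \<odot> (v + (- v i) \<odot> p0)"
      "(v + w) + (- (v + w) i) \<odot> p0 = (v + (- v i) \<odot> p0) + (w + (- w i) \<odot> p0)"
      by (auto simp: fun_eq_iff algebra_simps)
    then show "R (c \<odot> v) = c *s R v" "R (v + w) = R v + R w"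
      by (simp_all only: R_def coord B)
  qed
  moreover have "E (c *s v) = c \<odot> E v" "E (v + w) = E v + E w" for c v w
    by (simp_all add: E_def A A_add chart_dir_linear)
  moreover have "vec5 (E v)" for v
    using i by (simp add: E_def vec5_def chart_dir_def)
  moreover have "T p0 (E v) (E v) = u 0 / 3 * q v" for v
    using TE[of v] by (simp add: field_simps)
  moreover have "u 0 / 3 \<noteq> 0"
    using u(2)[OF W] by simp
  ultimately show ?thesis
    using p unfolding p0_def[symmetric] by blast
qed

section \<open>Linear algebra over the reals\<close>

lemma nontrivial_kernel:
  fixes A :: "nat \<Rightarrow> 'a \<Rightarrow> real"
  assumes "finite K" "m < card K"
  shows "\<exists>y. (\<forall>k. k \<notin> K \<longrightarrow> y k = 0) \<and> (\<exists>k\<in>K. y k \<noteq> 0) \<and> (\<forall>r<m. (\<Sum>k\<in>K. A r k * y k) = 0)"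
  using assms
proof (induction m arbitrary: A K)
  case 0
  then obtain k where "k \<in> K"
    by fastforce
  then show ?case
    by (intro exI[of _ "\<lambda>j. if j = k then 1 else 0"]) auto
next
  case (Suc m)
  show ?case
  proof (cases "\<forall>k\<in>K. A m k = 0")
    case True
    obtain y where "\<forall>k. k \<notin> K \<longrightarrow> y k = 0" "\<exists>k\<in>K. y k \<noteq> 0" "\<forall>r<m. (\<Sum>k\<in>K. A r k * y k) = 0"
      using Suc.IH[OF Suc.prems(1), of A] Suc.prems(2) by auto
    with True show ?thesis
      by (intro exI[of _ y]) (auto simp: less_Suc_eq)
  next
    case False
    then obtain k0 where k0: "k0 \<in> K" "A m k0 \<noteq> 0"
      by blast
    let ?K = "K - {k0}"
    define B where "B r k = A r k - A r k0 * A m k / A m k0" for r k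
    have "m < card ?K"
      using Suc.prems k0 by simp
    then obtain y where y: "\<forall>k. k \<notin> ?K \<longrightarrow> y k = 0" "\<exists>k\<in>?K. y k \<noteq> 0" "\<forall>r<m. (\<Sum>k\<in>?K. B r k * y k) = 0"
      using Suc.IH[of ?K B] Suc.prems(1) by auto
    define S where "S r = (\<Sum>k\<in>?K. A r k * y k)" for r
    define y' where "y' = y(k0 := - S m / A m k0)"
    have sum: "(\<Sum>k\<in>K. A r k * y' k) = S r - A r k0 * S m / A m k0" for r
    proof -
      have "(\<Sum>k\<in>K. A r k * y' k) = A r k0 * y' k0 + (\<Sum>k\<in>?K. A r k * y' k)"
        using k0(1) Suc.prems(1) by (rule sum.remove[rotated])
      moreover have "(\<Sum>k\<in>?K. A r k * y' k) = S r"
        unfolding S_def by (rule sum.cong) (auto simp: y'_def)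
      ultimately show ?thesis
        by (simp add: y'_def)
    qed
    have "(\<Sum>k\<in>K. A r k * y' k) = 0" if "r < Suc m" for r
    proof (cases "r = m")
      case True
      then show ?thesis
        using k0 by (simp add: sum)
    next
      case False
      then have "0 = (\<Sum>k\<in>?K. B r k * y k)"
        using y(3) that by simp
      also have "\<dots> = S r - A r k0 * S m / A m k0"
        by (simp add: B_def S_def algebra_simps sum_subtractf sum_distrib_left sum_divide_distrib)
      finally show ?thesis
        by (simp add: sum)
    qed
    then show ?thesis
      using y k0 by (intro exI[of _ y']) (auto simp: y'_def)
  qed
qed

text \<open>Away from coordinate \<open>i0\<close> there are n equations for n + 1 unknowns; the
  remaining coordinate of the combination vanishes because it is orthogonal to \<open>d\<close> and
  \<open>d i0\<close> is nonzero.\<close>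

lemma dependent_in_hyperplane:
  fixes e :: "nat \<Rightarrow> nat \<Rightarrow> real"
  assumes d: "i0 \<le> n" "d i0 \<noteq> 0" and orth: "\<And>k. k \<le> n \<Longrightarrow> (\<Sum>i\<le>n. d i * e k i) = 0"
  obtains y where "\<exists>k\<le>n. y k \<noteq> 0" "\<And>i. i \<le> n \<Longrightarrow> (\<Sum>k\<le>n. y k * e k i) = 0"
proof -
  define r where "r i = (if i < i0 then i else i + 1)" for i
  obtain y where y: "\<exists>k\<in>{..n}. y k \<noteq> 0" "\<And>i. i < n \<Longrightarrow> (\<Sum>k\<le>n. e k (r i) * y k) = 0"
    using nontrivial_kernel[of "{..n}" n "\<lambda>i k. e k (r i)"] by auto
  have other: "(\<Sum>k\<le>n. y k * e k i) = 0" if "i \<le> n" "i \<noteq> i0" for i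
  proof -
    have "r (if i < i0 then i else i - 1) = i" "(if i < i0 then i else i - 1) < n"
      using that d(1) by (auto simp: r_def)
    then show ?thesis
      using y(2) by (metis (no_types, lifting) mult.commute sum.cong)
  qed
  have "(\<Sum>i\<le>n. d i * (\<Sum>k\<le>n. y k * e k i)) = (\<Sum>k\<le>n. y k * (\<Sum>i\<le>n. d i * e k i))"
    by (simp add: sum_distrib_left, subst sum.swap) (simp add: mult_ac)
  also have "\<dots> = 0"
    by (simp add: orth)
  also have "(\<Sum>i\<le>n. d i * (\<Sum>k\<le>n. y k * e k i)) = d i0 * (\<Sum>k\<le>n. y k * e k i0)"
    using d(1) other by (subst sum.remove[of _ i0]) (auto intro!: sum.neutral)
  finally have "(\<Sum>k\<le>n. y k * e k i0) = 0"
    using d(2) by simp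
  then show ?thesis
    using that[of y] y(1) other by (metis atMost_iff)
qed

text \<open>Row j of \<open>D\<close> is a nonzero vector orthogonal to all other
  \<open>e k\<close>. It is not orthogonal to \<open>e j\<close>, for otherwise all
  \<open>e k\<close> would lie in a hyperplane and be dependent, so it can be scaled. If some
  \<open>x\<close> were not recovered from its coordinates, the error would be orthogonal to all
  rows of \<open>D\<close>; these would then be dependent, against duality.\<close>

lemma dual_basis:
  fixes e :: "nat \<Rightarrow> nat \<Rightarrow> real"
  assumes indep: "\<And>y. (\<And>i. i \<le> n \<Longrightarrow> (\<Sum>k\<le>n. y k * e k i) = 0) \<Longrightarrow> (\<And>k. k \<le> n \<Longrightarrow> y k = 0)"
  obtains D :: "nat \<Rightarrow> nat \<Rightarrow> real" where
    "\<And>j k. j \<le> n \<Longrightarrow> k \<le> n \<Longrightarrow> (\<Sum>i\<le>n. D j i * e k i) = (if j = k then 1 else 0)"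
    "\<And>(x :: nat \<Rightarrow> real) i. i \<le> n \<Longrightarrow> (\<Sum>k\<le>n. (\<Sum>j\<le>n. D k j * x j) * e k i) = x i"
proof -
  have "\<exists>d. \<forall>k\<le>n. (\<Sum>i\<le>n. d i * e k i) = (if j = k then 1 else 0)" if j: "j \<le> n" for j
  proof -
    define r where "r i = (if i < j then i else i + 1)" for i
    obtain d where d: "\<exists>i\<in>{..n}. d i \<noteq> 0" "\<And>k. k < n \<Longrightarrow> (\<Sum>i\<le>n. e (r k) i * d i) = 0"
      using nontrivial_kernel[of "{..n}" n "\<lambda>k i. e (r k) i"] by auto
    have other: "(\<Sum>i\<le>n. d i * e k i) = 0" if "k \<le> n" "k \<noteq> j" for k
    proof -
      have "r (if k < j then k else k - 1) = k" "(if k < j then k else k - 1) < n"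
        using that j by (auto simp: r_def)
      then show ?thesis
        using d(2) by (metis (no_types, lifting) mult.commute sum.cong)
    qed
    define c where "c = (\<Sum>i\<le>n. d i * e j i)"
    have "c \<noteq> 0"
    proof
      assume "c = 0"
      then have orth: "(\<Sum>i\<le>n. d i * e k i) = 0" if "k \<le> n" for k
        using other that by (cases "k = j") (auto simp: c_def)
      obtain i0 where "i0 \<le> n" "d i0 \<noteq> 0"
        using d(1) by auto
      from dependent_in_hyperplane[where e = e, OF this orth] obtain y where
        "\<exists>k\<le>n. y k \<noteq> 0" "\<And>i. i \<le> n \<Longrightarrow> (\<Sum>k\<le>n. y k * e k i) = 0"
        by blast
      then show False
        using indep by blast
    qed
    have "(\<Sum>i\<le>n. d i / c * e k i) = (if j = k then 1 else 0)" if "k \<le> n" for k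
    proof -
      have "(\<Sum>i\<le>n. d i / c * e k i) = (\<Sum>i\<le>n. d i * e k i) / c"
        by (simp add: sum_divide_distrib)
      then show ?thesis
        using other[OF that] \<open>c \<noteq> 0\<close> by (auto simp: c_def)
    qed
    then show ?thesis
      by (intro exI[of _ "\<lambda>i. d i / c"]) simp
  qed
  then have "\<forall>j. \<exists>d. j \<le> n \<longrightarrow> (\<forall>k\<le>n. (\<Sum>i\<le>n. d i * e k i) = (if j = k then 1 else 0))"
    by blast
  from choice[OF this] obtain D where D: "\<And>j k. j \<le> n \<Longrightarrow> k \<le> n \<Longrightarrow> (\<Sum>i\<le>n. D j i * e k i) = (if j = k then 1 else 0)"
    by blast
  have "(\<Sum>k\<le>n. (\<Sum>j\<le>n. D k j * x j) * e k i) = x i" if i: "i \<le> n" for x :: "nat \<Rightarrow> real" and i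
  proof (rule ccontr)
    define d where "d i = x i - (\<Sum>k\<le>n. (\<Sum>j\<le>n. D k j * x j) * e k i)" for i
    assume "(\<Sum>k\<le>n. (\<Sum>j\<le>n. D k j * x j) * e k i) \<noteq> x i"
    then have "d i \<noteq> 0"
      by (simp add: d_def)
    have "(\<Sum>i\<le>n. d i * D m i) = 0" if m: "m \<le> n" for m
    proof -
      have "(\<Sum>i\<le>n. D m i * (\<Sum>k\<le>n. (\<Sum>j\<le>n. D k j * x j) * e k i)) =
          (\<Sum>k\<le>n. (\<Sum>j\<le>n. D k j * x j) * (\<Sum>i\<le>n. D m i * e k i))"
        by (simp add: sum_distrib_left, subst sum.swap) (simp add: mult_ac)
      also have "\<dots> = (\<Sum>j\<le>n. D m j * x j)"
        using m by (simp add: D if_distrib[where f = "\<lambda>t. _ * t"] cong: if_cong)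
      finally show ?thesis
        by (simp add: d_def left_diff_distrib right_diff_distrib sum_subtractf mult.commute)
    qed
    from dependent_in_hyperplane[where e = D, OF i \<open>d i \<noteq> 0\<close> this] obtain y where
      y: "\<exists>k\<le>n. y k \<noteq> 0" "\<And>i. i \<le> n \<Longrightarrow> (\<Sum>k\<le>n. y k * D k i) = 0"
      by blast
    have "y k = 0" if k: "k \<le> n" for k
    proof -
      have "0 = (\<Sum>i\<le>n. (\<Sum>m\<le>n. y m * D m i) * e k i)"
        using y(2) by simp
      also have "\<dots> = (\<Sum>m\<le>n. y m * (\<Sum>i\<le>n. D m i * e k i))"
        by (simp add: sum_distrib_left sum_distrib_right, subst sum.swap) (simp add: mult_ac)
      also have "\<dots> = y k"
        using k by (simp add: D if_distrib[where f = "\<lambda>t. _ * t"] cong: if_cong)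
      finally show ?thesis ..
    qed
    with y(1) show False
      by blast
  qed
  with D that show ?thesis
    by blast
qed

section \<open>Telling the two kinds of singular points apart by the rank of the quadratic
  part\<close>

context cubic_tensor
begin

definition clinear_form :: "((nat \<Rightarrow> complex) \<Rightarrow> complex) \<Rightarrow> bool" where
  "clinear_form \<alpha> \<longleftrightarrow> (\<forall>c v. \<alpha> (c \<odot> v) = c * \<alpha> v) \<and> (\<forall>v w. \<alpha> (v + w) = \<alpha> v + \<alpha> w)"

text \<open>This says that the quadratic part has rank at most 2. It is stable under scaling and
  conjugation and holds at the D4-points but not at the A1-points.\<close>

definition split_at :: "(nat \<Rightarrow> complex) \<Rightarrow> bool" where
  "split_at p \<longleftrightarrow> (\<exists>\<alpha> \<beta>. clinear_form \<alpha> \<and> clinear_form \<beta> \<and> (\<forall>w. vec5 w \<longrightarrow> T p w w = \<alpha> w * \<beta> w))"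

lemma split_at_scale: "split_at p \<Longrightarrow> split_at (c \<odot> p)"
proof -
  assume "split_at p"
  then obtain \<alpha> \<beta> where *: "clinear_form \<alpha>" "clinear_form \<beta>" "\<And>w. vec5 w \<Longrightarrow> T p w w = \<alpha> w * \<beta> w"
    by (auto simp: split_at_def)
  have "clinear_form (\<lambda>w. c * \<alpha> w)"
    using *(1) by (simp add: clinear_form_def algebra_simps)
  then show ?thesis
    unfolding split_at_def using *
    by (intro exI[of _ "\<lambda>w. c * \<alpha> w"] exI[of _ \<beta>]) (simp add: T_linear)
qed

lemma split_at_cnjv: "split_at p \<Longrightarrow> split_at (cnjv p)"
proof -
  assume "split_at p"
  then obtain \<alpha> \<beta> where *: "clinear_form \<alpha>" "clinear_form \<beta>" "\<And>w. vec5 w \<Longrightarrow> T p w w = \<alpha> w * \<beta> w"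
    by (auto simp: split_at_def)
  have lin: "clinear_form (\<lambda>w. cnj (\<gamma> (cnjv w)))" if "clinear_form \<gamma>" for \<gamma>
  proof -
    have "cnjv (c \<odot> v) = cnj c \<odot> cnjv v" "cnjv (v + w) = cnjv v + cnjv w" for c v w
      by (auto simp: fun_eq_iff)
    then show ?thesis
      using that by (simp add: clinear_form_def)
  qed
  have "T (cnjv p) w w = cnj (\<alpha> (cnjv w)) * cnj (\<beta> (cnjv w))" if "vec5 w" for w
    using T_cnj[of p "cnjv w" "cnjv w"] *(3)[OF vec5_cnjv[OF that]] by simp
  then show ?thesis
    unfolding split_at_def using lin * by blast
qed

text \<open>The remaining terms of the D4-equation have order 3, so its quadratic part is x^2 + y^2
  = (x + i y)(x - i y).\<close>

lemma D4_split:
  assumes F: "\<And>x. peval F x = T x x x" and D4: "D4_singularity F P" and P: "\<And>x. x \<in> P \<Longrightarrow> singular x"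
  shows "\<exists>p\<in>P. split_at p"
proof -
  define q where "q v = (v $ 1)\<^sup>2 + (v $ 2)\<^sup>2" for v :: "complex^4"
  have "((\<lambda>t. (((t *\<^sub>R v) $ 1)^2 + ((t *\<^sub>R v) $ 2)^2 + ((t *\<^sub>R v) $ 3)^2 * (t *\<^sub>R v) $ 4 + ((t *\<^sub>R v) $ 4)^3) /
      of_real (t\<^sup>2)) \<longlongrightarrow> q v) (at (0::real))" for v
  proof -
    have "((\<lambda>t. q v + of_real t * ((v $ 3)\<^sup>2 * v $ 4 + (v $ 4) ^ 3)) \<longlongrightarrow> q v + of_real 0 * ((v $ 3)\<^sup>2 * v $ 4 + (v $ 4) ^ 3))
        (at (0::real))"
      by (intro tendsto_intros)
    then have lim: "((\<lambda>t. q v + of_real t * ((v $ 3)\<^sup>2 * v $ 4 + (v $ 4) ^ 3)) \<longlongrightarrow> q v) (at (0::real))"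
      by simp
    show ?thesis
      by (rule Lim_transform_within[OF lim zero_less_one])
        (simp add: q_def scaleR_conv_of_real[where 'a = complex] field_simps power2_eq_square power3_eq_cube)
  qed
  from local_quadratic_part[OF F D4[unfolded D4_singularity_def] P this]
  obtain p u R where p: "p \<in> P" and R: "\<And>c v. R (c \<odot> v) = c *s R v" "\<And>v w. R (v + w) = R v + R w"
    and Tp: "\<And>w. vec5 w \<Longrightarrow> T p w w = u * q (R w)"
    by blast
  have "clinear_form (\<lambda>w. u * (R w $ 1 + \<i> * R w $ 2))" "clinear_form (\<lambda>w. R w $ 1 - \<i> * R w $ 2)"
    by (simp_all add: clinear_form_def R algebra_simps)
  moreover have "T p w w = u * (R w $ 1 + \<i> * R w $ 2) * (R w $ 1 - \<i> * R w $ 2)" if "vec5 w" for w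
    using Tp[OF that] by (simp add: q_def algebra_simps power2_eq_square)
  ultimately show ?thesis
    unfolding split_at_def using p by blast
qed

text \<open>A sum of three squares already has no factorization: with values \<open>a k\<close>,
  \<open>b k\<close> of the two linear forms on the axes, \<open>a k * b k = u\<close> and
  \<open>a j * b k + a k * b j = 0\<close> give \<open>(a j)\<^sup>2 = - (a k)\<^sup>2\<close> for
  all pairs among three indices, so \<open>a 1\<close> vanishes, and with it
  \<open>u\<close>.\<close>

lemma A1_not_split:
  assumes F: "\<And>x. peval F x = T x x x" and A1: "A1_singularity F P" and P: "\<And>x. x \<in> P \<Longrightarrow> singular x"
  shows "\<exists>p\<in>P. \<not> split_at p"
proof -
  define q where "q v = (v $ 1)\<^sup>2 + (v $ 2)\<^sup>2 + (v $ 3)\<^sup>2 + (v $ 4)\<^sup>2" for v :: "complex^4"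
  have "((\<lambda>t. (((t *\<^sub>R v) $ 1)^2 + ((t *\<^sub>R v) $ 2)^2 + ((t *\<^sub>R v) $ 3)^2 + ((t *\<^sub>R v) $ 4)^2) /
      of_real (t\<^sup>2)) \<longlongrightarrow> q v) (at (0::real))" for v
    by (rule Lim_transform_within[OF tendsto_const zero_less_one])
      (simp add: q_def scaleR_conv_of_real[where 'a = complex] field_simps power2_eq_square)
  from local_quadratic_part[OF F A1[unfolded A1_singularity_def] P this]
  obtain p u and E :: "complex^4 \<Rightarrow> nat \<Rightarrow> complex" where p: "p \<in> P" and u: "u \<noteq> 0"
    and E: "\<And>v. vec5 (E v)" "\<And>c v. E (c *s v) = c \<odot> E v" "\<And>v w. E (v + w) = E v + E w"
    and Tp: "\<And>v. T p (E v) (E v) = u * q v"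
    by blast
  have "\<not> split_at p"
  proof
    assume "split_at p"
    then obtain \<alpha> \<beta> where lin: "clinear_form \<alpha>" "clinear_form \<beta>" and
      prod: "\<And>w. vec5 w \<Longrightarrow> T p w w = \<alpha> w * \<beta> w"
      by (auto simp: split_at_def)
    define a b where "a k = \<alpha> (E (axis k 1))" and "b k = \<beta> (E (axis k 1))" for k
    have comb: "(s * a j + t * a k) * (s * b j + t * b k) = u * q (s *s axis j 1 + t *s axis k 1)" for s t j k
      using prod[OF E(1), of "s *s axis j 1 + t *s axis k 1"] lin
      unfolding Tp by (simp add: E(2,3) clinear_form_def a_def b_def)
    have diag: "a k * b k = u" if "k \<in> {1, 2, 3}" for k
      using comb[of 1 k 0 k] that by (auto simp: q_def axis_def)
    have off: "a j * b k + a k * b j = 0" if "j \<in> {1, 2, 3}" "k \<in> {1, 2, 3}" "j \<noteq> k" for j k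
    proof -
      have "(a j + a k) * (b j + b k) = 2 * u"
        using comb[of 1 j 1 k] that by (auto simp: q_def axis_def)
      then show ?thesis
        using diag[OF that(1)] diag[OF that(2)] by (simp add: algebra_simps)
    qed
    have sq: "(a j)\<^sup>2 = - (a k)\<^sup>2" if "j \<in> {1, 2, 3}" "k \<in> {1, 2, 3}" "j \<noteq> k" for j k
    proof -
      have "u * ((a j)\<^sup>2 + (a k)\<^sup>2) = (a j * (a k * b k)) * a j + (a k * (a j * b j)) * a k"
        using diag[OF that(1)] diag[OF that(2)] by (simp add: power2_eq_square algebra_simps)
      also have "\<dots> = a j * a k * (a j * b k + a k * b j)"
        by (simp add: algebra_simps)
      finally show ?thesis
        using off[OF that] u by (simp add: eq_neg_iff_add_eq_0)
    qed
    have "(a 1)\<^sup>2 = - (a 1)\<^sup>2"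
      using sq[of 1 2] sq[of 2 3] sq[of 3 1] by simp
    then have "a 1 = 0"
      by simp
    then show False
      using diag[of 1] u by simp
  qed
  with p show ?thesis
    by blast
qed

end

section \<open>The normal form\<close>

context cubic_tensor
begin

text \<open>A point equal to its conjugate has a real coordinate vector: if \<open>cnjv x\<close> is
  \<open>c \<odot> x\<close>, then \<open>(1 + c) \<odot> x\<close> is real, and for
  \<open>c = - 1\<close> the vector \<open>\<i> \<odot> x\<close> is.\<close>

lemma not_self_conjugate:
  assumes noreal: "\<And>x. singular x \<Longrightarrow> cnjv x \<noteq> x" and x: "singular x"
  shows "cnjv x \<noteq> c \<odot> x"
proof
  assume eq: "cnjv x = c \<odot> x"
  show False
  proof (cases "c = - 1")
    case True
    then have "cnjv (\<i> \<odot> x) = \<i> \<odot> x"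
      using fun_cong[OF eq] by (auto simp: fun_eq_iff)
    then show False
      using noreal[OF singular_scale[OF x, of \<i>]] by simp
  next
    case False
    have "cnjv ((1 + c) \<odot> x) = (1 + c) \<odot> x"
    proof
      fix i
      have "cnj (x i) = c * x i" "x i = cnj c * cnj (x i)"
        using fun_cong[OF eq, of i] by simp (metis cnjv_apply complex_cnj_cnj complex_cnj_mult eq scale_apply)
      then show "cnjv ((1 + c) \<odot> x) i = ((1 + c) \<odot> x) i"
        by (simp add: algebra_simps)
    qed
    moreover have "1 + c \<noteq> 0"
      using False by (simp add: add_eq_0_iff)
    ultimately show False
      using noreal[OF singular_scale[OF x, of "1 + c"]] by simp
  qed
qed

end

lemma same_point_space4:
  "(x, y) \<in> same_point (proj_space 4) \<longleftrightarrow> vec5 x \<and> x \<noteq> 0 \<and> vec5 y \<and> y \<noteq> 0 \<and> (\<exists>c. c \<noteq> 0 \<and> y = c \<odot> x)"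
proof -
  have "(\<exists>c. c \<noteq> 0 \<and> (\<forall>i\<in>{..4}. y i = c * x i)) \<longleftrightarrow> (\<exists>c. c \<noteq> 0 \<and> y = c \<odot> x)" if "vec5 x" "vec5 y"
  proof -
    have "y = c \<odot> x \<longleftrightarrow> (\<forall>i\<in>{..4}. y i = c * x i)" for c
    proof
      assume *: "\<forall>i\<in>{..4}. y i = c * x i"
      show "y = c \<odot> x"
      proof
        fix i
        show "y i = (c \<odot> x) i"
          using * that by (cases "i \<le> 4") (auto simp: vec5_def)
      qed
    qed auto
    then show ?thesis
      by simp
  qed
  then show ?thesis
    by (auto simp: same_point_def hcoords_proj_space4)
qed

text \<open>Conjugation permutes the four singular points, preserves \<open>split_at\<close> and
  fixes none of them. Hence it exchanges the two D4-points and exchanges the two A1-points;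
  \<open>p\<close> and \<open>q\<close> represent one of each pair.\<close>

lemma singular_configuration:
  assumes cubic: "cubic_threefold F"
    and noreal: "\<forall>P\<in>singular_locus F. \<not> real_point P"
    and sing: "has_2D4_2A1_singularities F"
  obtains C p q where "cubic_tensor C" "\<And>x. peval F x = tri C x x x"
    "cubic_tensor.singular C p" "cubic_tensor.singular C q" "cubic_tensor.split_at C p"
    "\<And>x. cubic_tensor.singular C x \<Longrightarrow> \<exists>c. x = c \<odot> p \<or> x = c \<odot> cnjv p \<or> x = c \<odot> q \<or> x = c \<odot> cnjv q"
    "\<And>x. cubic_tensor.singular C x \<Longrightarrow> cnjv x \<noteq> x"
    "\<And>c. q \<noteq> c \<odot> p" "\<And>c. q \<noteq> c \<odot> cnjv p"
proof -
  obtain C where sym: "\<And>i j k. C i j k = C j i k" "\<And>i j k. C i j k = C i k j" and F: "\<And>x. peval F x = tri C x x x"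
    using cubic cubic_tensor_exists unfolding cubic_threefold_def by metis
  interpret cubic_tensor C
    by standard (fact sym)+
  let ?S = "same_point (proj_space 4)"
  have sc: "singular_coords F = {x. singular x}"
    using singular_iff[OF F] by auto
  have cls: "?S `` {x} = {y. \<exists>c. c \<noteq> 0 \<and> y = c \<odot> x}" if "singular x" for x
    using that by (auto simp: same_point_space4 singular_def fun_eq_iff vec5_def)
  have locus: "P \<in> singular_locus F \<longleftrightarrow> (\<exists>x. singular x \<and> P = {y. \<exists>c. c \<noteq> 0 \<and> y = c \<odot> x})" for P
    unfolding singular_locus_def quotient_def sc using cls by auto
  have refl: "x \<in> {y. \<exists>c. c \<noteq> 0 \<and> y = c \<odot> x}" for x
    by (auto intro!: exI[of _ 1] simp: fun_eq_iff)
  have Psing: "singular x" if "P \<in> singular_locus F" "x \<in> P" for P x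
    using that singular_scale by (auto simp: locus)
  have Pscale: "\<exists>c. c \<noteq> 0 \<and> y = c \<odot> x" if P: "P \<in> singular_locus F" "x \<in> P" "y \<in> P" for P x y
  proof -
    obtain z where "P = {y. \<exists>c. c \<noteq> 0 \<and> y = c \<odot> z}"
      using iffD1[OF locus P(1)] by blast
    then have "\<exists>c. c \<noteq> 0 \<and> x = c \<odot> z" "\<exists>c. c \<noteq> 0 \<and> y = c \<odot> z"
      using P(2,3) by simp_all
    then obtain c d where "c \<noteq> 0" "d \<noteq> 0" "x = c \<odot> z" "y = d \<odot> z"
      by blast
    then show ?thesis
      by (intro exI[of _ "d / c"]) (auto simp: fun_eq_iff)
  qed
  have Pall: "\<exists>P\<in>singular_locus F. x \<in> P" if x: "singular x" for x
  proof (rule bexI)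
    show "x \<in> {y. \<exists>c. c \<noteq> 0 \<and> y = c \<odot> x}"
      by (rule refl)
    show "{y. \<exists>c. c \<noteq> 0 \<and> y = c \<odot> x} \<in> singular_locus F"
      using x by (intro iffD2[OF locus] exI[of _ x]) simp
  qed
  have Peq: "P = Q" if P: "P \<in> singular_locus F" "Q \<in> singular_locus F" "x \<in> P" "x \<in> Q" for P Q x
  proof -
    have "A \<subseteq> B" if AB: "A \<in> singular_locus F" "B \<in> singular_locus F" "x \<in> A" "x \<in> B" for A B
    proof
      fix y assume "y \<in> A"
      then obtain c where c: "c \<noteq> 0" "y = c \<odot> x"
        using Pscale[OF AB(1,3)] by blast
      obtain z where z: "B = {y. \<exists>c. c \<noteq> 0 \<and> y = c \<odot> z}"
        using iffD1[OF locus AB(2)] by blast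
      then obtain d where "d \<noteq> 0" "x = d \<odot> z"
        using AB(4) by auto
      then show "y \<in> B"
        unfolding z using c by (auto intro!: exI[of _ "c * d"] simp: fun_eq_iff)
    qed
    with P show ?thesis
      by blast
  qed
  have nr: "cnjv x \<noteq> x" if x: "singular x" for x
  proof
    assume eq: "cnjv x = x"
    obtain P where P: "P \<in> singular_locus F" "x \<in> P"
      using Pall[OF x] by blast
    have "x i \<in> \<real>" for i
      using fun_cong[OF eq, of i] by (simp add: Reals_cnj_iff)
    then have "real_point P"
      using P by (auto simp: real_point_def)
    then show False
      using noreal P by blast
  qed
  obtain P1 P2 Q1 Q2 where dist: "distinct [P1, P2, Q1, Q2]" and all: "singular_locus F = {P1, P2, Q1, Q2}"
    and D4: "D4_singularity F P1" "D4_singularity F P2" and A1: "A1_singularity F Q1" "A1_singularity F Q2"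
    using sing unfolding has_2D4_2A1_singularities_def by (elim exE conjE) (rule that)
  have in_locus: "P1 \<in> singular_locus F" "P2 \<in> singular_locus F" "Q1 \<in> singular_locus F" "Q2 \<in> singular_locus F"
    using all by auto
  obtain p1 where p1: "p1 \<in> P1" "split_at p1"
    using D4_split[OF F D4(1) Psing[OF in_locus(1)]] by blast
  obtain p2 where p2: "p2 \<in> P2" "split_at p2"
    using D4_split[OF F D4(2) Psing[OF in_locus(2)]] by blast
  obtain q1 where q1: "q1 \<in> Q1" "\<not> split_at q1"
    using A1_not_split[OF F A1(1) Psing[OF in_locus(3)]] by blast
  obtain q2 where q2: "q2 \<in> Q2" "\<not> split_at q2"
    using A1_not_split[OF F A1(2) Psing[OF in_locus(4)]] by blast
  have sings: "singular p1" "singular p2" "singular q1" "singular q2"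
    by (fact Psing[OF in_locus(1) p1(1)] Psing[OF in_locus(2) p2(1)]
        Psing[OF in_locus(3) q1(1)] Psing[OF in_locus(4) q2(1)])+
  have four: "\<exists>c. c \<noteq> 0 \<and> (x = c \<odot> p1 \<or> x = c \<odot> p2 \<or> x = c \<odot> q1 \<or> x = c \<odot> q2)" if "singular x" for x
  proof -
    obtain P where P: "P \<in> singular_locus F" "x \<in> P"
      using Pall[OF \<open>singular x\<close>] by blast
    then consider "P = P1" | "P = P2" | "P = Q1" | "P = Q2"
      using all by auto
    then show ?thesis
      using Pscale[OF P(1) _ P(2), of p1] Pscale[OF P(1) _ P(2), of p2]
        Pscale[OF P(1) _ P(2), of q1] Pscale[OF P(1) _ P(2), of q2] p1(1) p2(1) q1(1) q2(1)
      by cases blast+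
  qed
  have cancel: "split_at y" if "split_at x" "x = c \<odot> y" "c \<noteq> 0" for x y c
  proof -
    have "y = (1 / c) \<odot> x"
      using that by (auto simp: fun_eq_iff)
    then show ?thesis
      using split_at_scale that by metis
  qed
  have cnj_cancel: "split_at x" if "split_at (cnjv x)" for x
    using split_at_cnjv[OF that] by simp
  obtain c where c: "c \<noteq> 0" "cnjv p1 = c \<odot> p2"
    using four[OF singular_cnjv[OF sings(1)]] not_self_conjugate[OF nr sings(1)] split_at_cnjv[OF p1(2)]
      cancel q1 q2 by metis
  obtain d where d: "d \<noteq> 0" "cnjv q1 = d \<odot> q2"
    using four[OF singular_cnjv[OF sings(3)]] not_self_conjugate[OF nr sings(3)] cnj_cancel[of q1]
      split_at_scale p1 p2 q1 by metis
  show ?thesis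
  proof (rule that[OF cubic_tensor_axioms F sings(1) sings(3) p1(2)])
    fix x assume "singular x"
    then obtain b where "x = b \<odot> p1 \<or> x = b \<odot> p2 \<or> x = b \<odot> q1 \<or> x = b \<odot> q2"
      using four by blast
    moreover have "b \<odot> p2 = (b / c) \<odot> cnjv p1" "b \<odot> q2 = (b / d) \<odot> cnjv q1"
      using c d by (auto simp: fun_eq_iff)
    ultimately show "\<exists>c. x = c \<odot> p1 \<or> x = c \<odot> cnjv p1 \<or> x = c \<odot> q1 \<or> x = c \<odot> cnjv q1"
      by metis
  next
    fix x assume "singular x"
    then show "cnjv x \<noteq> x"
      by (rule nr)
  next
    fix b
    show "q1 \<noteq> b \<odot> p1"
      using split_at_scale[OF p1(2)] q1(2) by metis
    show "q1 \<noteq> b \<odot> cnjv p1"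
      using split_at_scale[OF split_at_cnjv[OF p1(2)]] q1(2) by metis
  qed
qed

section \<open>Linear forms attached to the singular points\<close>

locale cubic_configuration = cubic_tensor +
  fixes p q :: "nat \<Rightarrow> complex"
  assumes sing_p: "singular p" and sing_q: "singular q" and split_p: "split_at p"
    and four: "singular x \<Longrightarrow> \<exists>c. x = c \<odot> p \<or> x = c \<odot> cnjv p \<or> x = c \<odot> q \<or> x = c \<odot> cnjv q"
    and no_real: "singular x \<Longrightarrow> cnjv x \<noteq> x"
    and q_ne: "q \<noteq> c \<odot> p" "q \<noteq> c \<odot> cnjv p"
begin

abbreviation pb :: "nat \<Rightarrow> complex" where
  "pb \<equiv> cnjv p"

text \<open>This real linear form becomes the coordinate \<open>y 2\<close> of the normal
  form.\<close>

definition l :: "(nat \<Rightarrow> complex) \<Rightarrow> complex" where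
  "l v = T p pb v"

lemma vec5_p [simp]: "vec5 p" "vec5 pb" "vec5 q"
  using sing_p sing_q by (auto simp: singular_def)

lemma Tpp [simp]: "T p p v = 0" "T pb pb v = 0" "T q q v = 0"
  using sing_p sing_q singular_cnjv[OF sing_p] by (auto simp: singular_def)

lemma l_linear: "l (c \<odot> v) = c * l v" "l (v + w) = l v + l w"
  by (simp_all add: l_def T_linear)

lemma l_cnjv: "l (cnjv v) = cnj (l v)"
  using T_cnj[of pb p v] T_swap12[of pb p v] by (simp add: l_def)

lemma l_p [simp]: "l p = 0" "l pb = 0"
  using T_swap23[of p pb p] T_swap13[of p pb pb] by (simp_all add: l_def)

text \<open>Each of the four singular points can belong to at most one parameter, while there are
  infinitely many nonzero parameters.\<close>

lemma finite_singular:
  assumes "\<And>t. t \<noteq> 0 \<Longrightarrow> singular (f t)"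
    and "\<And>(s :: complex) t c. s \<noteq> 0 \<Longrightarrow> t \<noteq> 0 \<Longrightarrow> f s = c \<odot> f t \<Longrightarrow> s = t"
  shows False
proof -
  define A where "A r = {t. t \<noteq> 0 \<and> (\<exists>c. f t = c \<odot> r)}" for r
  have fin: "finite (A r)" for r
  proof (cases "A r = {}")
    case False
    then obtain t where t: "t \<in> A r"
      by blast
    have "s = t" if s: "s \<in> A r" for s
    proof -
      obtain c d where cd: "f s = c \<odot> r" "f t = d \<odot> r"
        using s t by (auto simp: A_def)
      have "f t \<noteq> 0"
        using assms(1) t by (auto simp: A_def singular_def)
      then have "d \<noteq> 0"
        using cd by (auto simp: fun_eq_iff)
      then have "f s = (c / d) \<odot> f t"
        using cd by (auto simp: fun_eq_iff)
      then show ?thesis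
        using assms(2) s t by (auto simp: A_def)
    qed
    then have "A r \<subseteq> {t}"
      by blast
    then show ?thesis
      using finite_subset by blast
  qed simp
  have "UNIV - {0} \<subseteq> A p \<union> A pb \<union> A q \<union> A (cnjv q)"
  proof
    fix t :: complex assume "t \<in> UNIV - {0}"
    then have t: "t \<noteq> 0"
      by simp
    from four[OF assms(1)[OF t]] t show "t \<in> A p \<union> A pb \<union> A q \<union> A (cnjv q)"
      unfolding A_def by blast
  qed
  then have "finite (UNIV - {0} :: complex set)"
    using fin by (metis finite_UnI finite_subset)
  then show False
    by (simp add: infinite_UNIV_char_0)
qed

lemma indep_p: "a \<odot> p + b \<odot> pb = 0 \<Longrightarrow> a = 0 \<and> b = 0"
proof -
  assume eq: "a \<odot> p + b \<odot> pb = 0"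
  have "b = 0"
  proof (rule ccontr)
    assume b: "b \<noteq> 0"
    have "pb i = (- a / b) * p i" for i
      using fun_cong[OF eq, of i] b by (simp add: field_simps eq_neg_iff_add_eq_0)
    then have "pb = (- a / b) \<odot> p"
      by (auto simp: fun_eq_iff)
    then show False
      using not_self_conjugate[OF no_real sing_p] by blast
  qed
  moreover have "p \<noteq> 0"
    using sing_p by (simp add: singular_def)
  ultimately show ?thesis
    using eq by (auto simp: fun_eq_iff)
qed

text \<open>If \<open>l\<close> vanished, all points of the line through \<open>p\<close> and
  \<open>pb\<close> would be singular.\<close>

lemma l_nonzero: "\<exists>v. vec5 v \<and> l v \<noteq> 0"
proof (rule ccontr)
  assume zero: "\<not> ?thesis"
  have l0: "l v = 0" for v
  proof -
    have "l v = l (\<lambda>i. if i \<le> 4 then v i else 0)"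
      unfolding l_def by (rule T_cong3) simp
    also have "\<dots> = 0"
    proof -
      have "vec5 (\<lambda>i. if i \<le> 4 then v i else 0)"
        by (simp add: vec5_def)
      with zero show ?thesis
        by blast
    qed
    finally show ?thesis .
  qed
  show False
  proof (rule finite_singular)
    fix t :: complex assume "t \<noteq> 0"
    show "singular (p + t \<odot> pb)"
      unfolding singular_def
    proof (intro conjI allI)
      show "vec5 (p + t \<odot> pb)"
        by (intro vec5_add vec5_scale) simp_all
      have "1 \<odot> p + t \<odot> pb = p + t \<odot> pb"
        by (auto simp: fun_eq_iff)
      then show "p + t \<odot> pb \<noteq> 0"
        using indep_p[of 1 t] by auto
      show "T (p + t \<odot> pb) (p + t \<odot> pb) v = 0" for v
        using l0[of v] T_swap12[of pb p v] by (simp add: T_linear l_def)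
    qed
  next
    fix s t c :: complex assume "p + s \<odot> pb = c \<odot> (p + t \<odot> pb)"
    then have "(1 - c) \<odot> p + (s - c * t) \<odot> pb = 0"
      by (auto simp: fun_eq_iff algebra_simps)
    from indep_p[OF this] show "s = t"
      by auto
  qed
qed

text \<open>The quadratic part at \<open>p\<close> is a product of two linear forms, and it vanishes
  at \<open>pb\<close> because \<open>pb\<close> is singular; so one factor vanishes at
  \<open>pb\<close>. Polarizing against \<open>pb\<close> shows that this factor is proportional to
  \<open>l\<close>, and \<open>\<mu>\<close> is the other factor, scaled.\<close>

lemma mu_exists:
  obtains \<mu> where "clinear_form \<mu>" "\<mu> p = 0" "\<mu> pb = 2"
    "\<And>u v. vec5 u \<Longrightarrow> vec5 v \<Longrightarrow> 2 * T p u v = l u * \<mu> v + l v * \<mu> u"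
proof -
  obtain \<alpha> \<beta> where lin: "clinear_form \<alpha>" "clinear_form \<beta>"
    and prod: "\<And>w. vec5 w \<Longrightarrow> T p w w = \<alpha> w * \<beta> w" and \<beta>: "\<beta> pb = 0"
  proof -
    obtain \<alpha> \<beta> where *: "clinear_form \<alpha>" "clinear_form \<beta>" "\<And>w. vec5 w \<Longrightarrow> T p w w = \<alpha> w * \<beta> w"
      using split_p by (auto simp: split_at_def)
    have "\<alpha> pb * \<beta> pb = 0"
      using *(3)[of pb] T_swap13[of p pb pb] by simp
    then have "\<beta> pb = 0 \<or> \<alpha> pb = 0"
      by auto
    then show ?thesis
      using that[of \<alpha> \<beta>] that[of \<beta> \<alpha>] * by (auto simp: mult.commute)
  qed
  have polar: "2 * T p u v = \<alpha> u * \<beta> v + \<alpha> v * \<beta> u" if "vec5 u" "vec5 v" for u v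
    using prod[of "u + v"] prod[of u] prod[of v] that lin T_swap23[of p v u]
    by (auto simp: clinear_form_def T_linear algebra_simps)
  have lb: "2 * l v = \<alpha> pb * \<beta> v" if "vec5 v" for v
    using polar[of pb v] that \<beta> by (simp add: l_def)
  have a0: "\<alpha> pb \<noteq> 0"
    using l_nonzero lb by fastforce
  define \<mu> where "\<mu> v = 2 * \<alpha> v / \<alpha> pb" for v
  have \<mu>: "2 * T p u v = l u * \<mu> v + l v * \<mu> u" if "vec5 u" "vec5 v" for u v
  proof -
    have "\<beta> u = 2 * l u / \<alpha> pb" "\<beta> v = 2 * l v / \<alpha> pb"
      using lb that a0 by (auto simp: field_simps)
    then show ?thesis
      using polar[OF that] a0 by (simp add: \<mu>_def field_simps)
  qed
  have "\<mu> p = 0"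
    using l_nonzero \<mu>[of p] by fastforce
  moreover have "clinear_form \<mu>"
    using lin by (simp add: clinear_form_def \<mu>_def add_divide_distrib distrib_left)
  moreover have "\<mu> pb = 2"
    using a0 by (simp add: \<mu>_def)
  ultimately show ?thesis
    using that \<mu> by blast
qed

end

section \<open>Real coordinates adapted to the singular points\<close>

definition real_vec :: "(nat \<Rightarrow> real) \<Rightarrow> nat \<Rightarrow> complex" where
  "real_vec y = (\<lambda>i. of_real (y i))"

lemma cnjv_real_vec [simp]: "cnjv (real_vec y) = real_vec y"
  by (simp add: cnjv_def real_vec_def)

lemma vec5_real_vec: "vec5 (real_vec y) \<longleftrightarrow> (\<forall>i>4. y i = 0)"
  by (simp add: vec5_def real_vec_def)

lemma real_vec_of_cnjv: "cnjv x = x \<Longrightarrow> real_vec (\<lambda>i. Re (x i)) = x"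
  by (auto simp: real_vec_def fun_eq_iff complex_eq_iff)

lemma scale_zero [simp]: "c \<odot> 0 = 0" "0 \<odot> x = 0"
  by (simp_all add: fun_eq_iff)

lemma sum_vec_apply: "(\<Sum>k\<in>K. f k) i = (\<Sum>k\<in>K. f k i)" for f :: "'k \<Rightarrow> nat \<Rightarrow> complex"
  by (induction K rule: infinite_finite_induct) simp_all

lemma vec_expand: "vec5 v \<Longrightarrow> v = (\<Sum>k\<le>4. v k \<odot> unit_vec k)"
proof
  fix i assume v: "vec5 v"
  have "(\<Sum>k\<le>4. v k \<odot> unit_vec k) i = (\<Sum>k\<le>4. if k = i then v k else 0)"
    unfolding sum_vec_apply by (rule sum.cong) (auto simp: unit_vec_def)
  then show "v i = (\<Sum>k\<le>4. v k \<odot> unit_vec k) i"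
    using v by (auto simp: vec5_def)
qed

lemma sum_le_4: "(\<Sum>k\<le>4::nat. f k) = f 0 + f 1 + f 2 + f 3 + f 4"
  for f :: "nat \<Rightarrow> 'z::comm_monoid_add"
  by (simp add: numeral_eq_Suc add.assoc)

context cubic_tensor
begin

lemma clinear_form_sum:
  assumes "clinear_form \<alpha>"
  shows "\<alpha> (\<Sum>k\<in>K. c k \<odot> f k) = (\<Sum>k\<in>K. c k * \<alpha> (f k))"
proof -
  have "\<alpha> (0 \<odot> 0) = 0 * \<alpha> 0"
    using assms unfolding clinear_form_def by blast
  then have "\<alpha> 0 = 0"
    by simp
  then show ?thesis
    using assms by (induction K rule: infinite_finite_induct) (auto simp: clinear_form_def)
qed

lemma clinear_form_expand:
  "clinear_form \<alpha> \<Longrightarrow> vec5 v \<Longrightarrow> \<alpha> v = (\<Sum>k\<le>4. v k * \<alpha> (unit_vec k))"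
  by (subst vec_expand) (simp_all add: clinear_form_sum)

end

locale split_configuration = cubic_configuration +
  fixes \<mu> :: "(nat \<Rightarrow> complex) \<Rightarrow> complex"
  assumes mu_form: "clinear_form \<mu>" and mu_p: "\<mu> p = 0" "\<mu> pb = 2"
    and polar: "vec5 u \<Longrightarrow> vec5 v \<Longrightarrow> 2 * T p u v = l u * \<mu> v + l v * \<mu> u"
begin

definition \<nu> :: "(nat \<Rightarrow> complex) \<Rightarrow> complex" where
  "\<nu> v = cnj (\<mu> (cnjv v))"

lemma cnjv_linear: "cnjv (c \<odot> v) = cnj c \<odot> cnjv v" "cnjv (v + w) = cnjv v + cnjv w"
  by (auto simp: fun_eq_iff)

lemma mu_linear: "\<mu> (c \<odot> v) = c * \<mu> v" "\<mu> (v + w) = \<mu> v + \<mu> w"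
  and nu_linear: "\<nu> (c \<odot> v) = c * \<nu> v" "\<nu> (v + w) = \<nu> v + \<nu> w"
  using mu_form by (simp_all add: clinear_form_def \<nu>_def cnjv_linear)

lemma nu_p: "\<nu> p = 2" "\<nu> pb = 0"
  by (simp_all add: \<nu>_def mu_p)

lemma polar': "vec5 u \<Longrightarrow> vec5 v \<Longrightarrow> 2 * T pb u v = l u * \<nu> v + l v * \<nu> u"
proof -
  assume uv: "vec5 u" "vec5 v"
  have "2 * T pb u v = cnj (2 * T p (cnjv u) (cnjv v))"
    using T_cnj[of p "cnjv u" "cnjv v"] by simp
  also have "\<dots> = cnj (l (cnjv u) * \<mu> (cnjv v) + l (cnjv v) * \<mu> (cnjv u))"
    by (subst polar) (use uv in auto)
  also have "\<dots> = l u * \<nu> v + l v * \<nu> u"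
    by (simp add: \<nu>_def l_cnjv)
  finally show ?thesis .
qed

text \<open>Through a singular point at which the three forms vanish there would be a whole curve of
  singular points.\<close>

lemma no_singular_on_axis:
  assumes x: "vec5 x" "x \<noteq> 0" "\<mu> x = 0" "\<nu> x = 0" "l x = 0"
    and Txx: "\<And>v. vec5 v \<Longrightarrow> T x x v = - 2 * k * l v"
  shows False
proof -
  \<comment> \<open>The coefficients of \<open>p\<close> and \<open>pb\<close> have constant product
    \<open>k\<close>, and \<open>T p pb v = l v\<close>, so together they contribute
    \<open>2 * k * l v\<close>, which cancels \<open>T x x v\<close>. The mixed terms with
    \<open>x\<close> vanish by polarity.\<close>
  define f where "f t = t \<odot> p + (k / t) \<odot> pb + x" for t
  have val: "\<mu> (f t) = 2 * k / t" "\<nu> (f t) = 2 * t" for t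
    by (simp_all add: f_def mu_linear nu_linear mu_p nu_p x)
  show False
  proof (rule finite_singular)
    fix t :: complex assume t: "t \<noteq> 0"
    have v5: "vec5 (f t)"
      unfolding f_def using x by (intro vec5_add vec5_scale) simp_all
    have Tf: "T (f t) (f t) v = 0" if v: "vec5 v" for v
    proof -
      have "2 * T p x v = 0" "2 * T pb x v = 0"
        using polar[OF x(1) v] polar'[OF x(1) v] x by simp_all
      then have "T p x v = 0" "T pb x v = 0" "T x p v = 0" "T x pb v = 0"
        using T_swap12[of x p v] T_swap12[of x pb v] by simp_all
      moreover have "T p pb v = l v" "T pb p v = l v"
        using T_swap12[of pb p v] by (simp_all add: l_def)
      ultimately show ?thesis
        using t Txx[OF v] by (simp add: f_def T_linear field_simps)
    qed
    have "T (f t) (f t) v = 0" for v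
    proof -
      have "T (f t) (f t) v = T (f t) (f t) (\<lambda>i. if i \<le> 4 then v i else 0)"
        by (rule T_cong3) simp
      then show ?thesis
        using Tf[of "\<lambda>i. if i \<le> 4 then v i else 0"] by (simp add: vec5_def)
    qed
    moreover have "f t \<noteq> 0"
      using val(2)[of t] t nu_linear(1)[of 0 0] by auto
    ultimately show "singular (f t)"
      using v5 by (simp add: singular_def)
  next
    fix s t c :: complex assume st: "s \<noteq> 0" "t \<noteq> 0" and eq: "f s = c \<odot> f t"
    have s: "s = c * t"
      using arg_cong[OF eq, of \<nu>] by (simp add: val nu_linear)
    have "2 * (k / s) = 2 * (c * (k / t))"
      using arg_cong[OF eq, of \<mu>] by (simp add: val mu_linear)
    then have "k / s = c * (k / t)"
      by (metis mult_left_cancel zero_neq_numeral)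
    then have cx: "x i = c * x i" for i
      using fun_cong[OF eq, of i] s by (simp add: f_def algebra_simps)
    obtain i where "x i \<noteq> 0"
      using x(2) by (auto simp: fun_eq_iff)
    then have "c = 1"
      using cx[of i] by (metis mult_cancel_right1)
    then show "s = t"
      using s by simp
  qed
qed

text \<open>If \<open>l q = 0\<close>, removing the components along \<open>p\<close> and
  \<open>pb\<close> leaves a vector \<open>x\<close> on which all three forms vanish. For nonzero
  \<open>x\<close> there is a curve of singular points. For \<open>x = 0\<close> the point
  \<open>q\<close> lies on the line through \<open>p\<close> and \<open>pb\<close>, on which only
  these two points are singular.\<close>

lemma l_q: "l q \<noteq> 0"
proof
  assume lq: "l q = 0"
  define s t where "s = \<nu> q / 2" and "t = \<mu> q / 2"
  define x where "x = q + (- s) \<odot> p + (- t) \<odot> pb"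
  have q: "q = s \<odot> p + t \<odot> pb + x"
    by (auto simp: x_def fun_eq_iff)
  have x: "vec5 x" "\<mu> x = 0" "\<nu> x = 0" "l x = 0"
    by (unfold x_def, intro vec5_add vec5_scale vec5_p)
      (simp_all add: mu_linear nu_linear mu_p nu_p l_linear lq s_def t_def)
  have Tx: "T x x v = - 2 * (s * t) * l v" if v: "vec5 v" for v
  proof -
    have "2 * T p x v = 0" "2 * T pb x v = 0"
      using polar[OF x(1) v] polar'[OF x(1) v] x by simp_all
    then have *: "T p x v = 0" "T pb x v = 0" "T x p v = 0" "T x pb v = 0"
      using T_swap12[of x p v] T_swap12[of x pb v] by simp_all
    have **: "T p pb v = l v" "T pb p v = l v"
      using T_swap12[of pb p v] by (simp_all add: l_def)
    have "0 = T (s \<odot> p + t \<odot> pb + x) (s \<odot> p + t \<odot> pb + x) v"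
      by (simp flip: q)
    also have "\<dots> = 2 * (s * t) * l v + T x x v"
      by (simp add: T_linear * **)
    finally show ?thesis
      by (simp add: eq_neg_iff_add_eq_0 add.commute)
  qed
  show False
  proof (cases "x = 0")
    case True
    have "T 0 0 v = 0" for v
      by (simp add: tri_def)
    then have "s * t = 0"
      using l_nonzero Tx True by fastforce
    then consider "s = 0" | "t = 0"
      by auto
    then show False
      using q q_ne[of s] q_ne(2)[of t] True by cases (auto simp: fun_eq_iff)
  next
    case False
    then show False
      using no_singular_on_axis[OF x(1) False x(2-4) Tx] by simp
  qed
qed

text \<open>\<open>T p q q\<close> vanishes because \<open>q\<close> is singular, and equals
  \<open>l q * \<mu> q\<close> by polarity; likewise at the conjugate point.\<close>

lemma mu_q: "\<mu> q = 0" "\<nu> q = 0"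
  using polar[of q q] polar'[of q q] l_q T_swap13[of p q q] T_swap13[of pb q q] by simp_all

text \<open>Scaled to \<open>l r = 1\<close>, so that \<open>l\<close> is 1 on the real part
  \<open>w0\<close> and 0 on the imaginary part \<open>v0\<close>.\<close>

definition r :: "nat \<Rightarrow> complex" where
  "r = (1 / l q) \<odot> q"

abbreviation rb :: "nat \<Rightarrow> complex" where
  "rb \<equiv> cnjv r"

definition w0 :: "nat \<Rightarrow> complex" where
  "w0 = (1/2) \<odot> (r + rb)"

definition v0 :: "nat \<Rightarrow> complex" where
  "v0 = (-\<i>/2) \<odot> (r + (-1) \<odot> rb)"

lemma r_singular: "singular r"
  unfolding r_def by (rule singular_scale[OF sing_q]) (simp add: l_q)

lemma w0_v0_basic: "cnjv w0 = w0" "cnjv v0 = v0" "vec5 w0" "vec5 v0"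
  using r_singular by (auto simp: w0_def v0_def fun_eq_iff singular_def vec5_def algebra_simps)

lemma r_eq: "r = w0 + \<i> \<odot> v0"
  by (auto simp: w0_def v0_def fun_eq_iff algebra_simps)

lemma w0_v0_forms: "l w0 = 1" "\<mu> w0 = 0" "\<nu> w0 = 0" "l v0 = 0" "\<mu> v0 = 0" "\<nu> v0 = 0"
proof -
  have r: "l r = 1" "\<mu> r = 0" "\<nu> r = 0"
    using l_q mu_q by (simp_all add: r_def l_linear mu_linear nu_linear)
  then have "l rb = 1" "\<mu> rb = 0" "\<nu> rb = 0"
    by (simp_all add: l_cnjv \<nu>_def flip: \<nu>_def) (metis \<nu>_def cnjv_cnjv complex_cnj_cnj complex_cnj_zero)+
  with r show "l w0 = 1" "\<mu> w0 = 0" "\<nu> w0 = 0" "l v0 = 0" "\<mu> v0 = 0" "\<nu> v0 = 0"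
    by (simp_all add: w0_def v0_def l_linear mu_linear nu_linear)
qed

lemma v0_nonzero: "v0 \<noteq> 0"
proof
  assume "v0 = 0"
  then have "r = w0"
    by (subst r_eq) (auto simp: fun_eq_iff)
  then show False
    using no_real[OF r_singular] w0_v0_basic by simp
qed

text \<open>The equations for \<open>w0 + \<i> \<odot> v0\<close> and its conjugate being singular
  are added and subtracted.\<close>

lemma T_w0_v0: "T w0 v0 x = 0" "T w0 w0 x = T v0 v0 x"
proof -
  have "T r r x = 0" "T rb rb x = 0"
    using r_singular singular_cnjv[OF r_singular] by (auto simp: singular_def)
  moreover have "rb = w0 + (- \<i>) \<odot> v0"
    by (auto simp: w0_def v0_def fun_eq_iff algebra_simps)
  ultimately have *: "T (w0 + \<i> \<odot> v0) (w0 + \<i> \<odot> v0) x = 0" "T (w0 + (- \<i>) \<odot> v0) (w0 + (- \<i>) \<odot> v0) x = 0"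
    by (simp_all flip: r_eq)
  have "T v0 w0 x = T w0 v0 x"
    by (rule T_swap12)
  then have "T w0 w0 x + 2 * \<i> * T w0 v0 x - T v0 v0 x = 0" "T w0 w0 x - 2 * \<i> * T w0 v0 x - T v0 v0 x = 0"
    using * by (simp_all add: T_linear algebra_simps)
  then have "4 * \<i> * T w0 v0 x = 0" "2 * (T w0 w0 x - T v0 v0 x) = 0"
    by (simp_all add: algebra_simps)
  then show "T w0 v0 x = 0" "T w0 w0 x = T v0 v0 x"
    by simp_all
qed

lemma T_w0_v0_self: "T w0 w0 w0 = 0" "T v0 v0 v0 = 0" "T w0 w0 v0 = 0" "T v0 v0 w0 = 0"
  "T w0 v0 v0 = 0" "T w0 w0 p = 0" "T w0 w0 pb = 0"
proof -
  show 1: "T w0 w0 v0 = 0" "T w0 v0 v0 = 0"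
    using T_swap23[of w0 w0 v0] T_w0_v0(1) by auto
  then show 2: "T v0 v0 w0 = 0"
    using T_swap13[of v0 v0 w0] by simp
  show "T w0 w0 w0 = 0" "T v0 v0 v0 = 0"
    using T_w0_v0(2)[of w0] T_w0_v0(2)[of v0] 1 2 by simp_all
  show "T w0 w0 p = 0" "T w0 w0 pb = 0"
    using polar[OF w0_v0_basic(3,3)] polar'[OF w0_v0_basic(3,3)] w0_v0_forms
      T_swap13[of w0 w0 p] T_swap13[of w0 w0 pb] by simp_all
qed

text \<open>The common kernel of \<open>l\<close>, \<open>\<mu>\<close> and \<open>\<nu>\<close> is
  a plane defined over the reals that contains \<open>v0\<close>; an axis completes
  \<open>v0\<close> to a real basis of it.\<close>

definition axis :: "(nat \<Rightarrow> complex) \<Rightarrow> bool" where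
  "axis n \<longleftrightarrow> vec5 n \<and> cnjv n = n \<and> l n = 0 \<and> \<mu> n = 0 \<and> (\<forall>c. n \<noteq> c \<odot> v0)"

lemma axis_nu: "axis n \<Longrightarrow> \<nu> n = 0"
  by (simp add: axis_def \<nu>_def)

lemma l_form: "clinear_form l"
  by (simp add: clinear_form_def l_linear)

lemma axis_exists: "\<exists>n. axis n"
proof -
  obtain j where j: "v0 j \<noteq> 0"
    using v0_nonzero by (auto simp: fun_eq_iff)
  \<comment> \<open>Four real equations in five unknowns: \<open>l\<close>, the real and imaginary
    parts of \<open>\<mu>\<close>, and the vanishing of a coordinate in which \<open>v0\<close> is
    nonzero, which rules out multiples of \<open>v0\<close>.\<close>
  define A where "A m k = (if m = 0 then Re (l (unit_vec k)) else if m = 1 then Re (\<mu> (unit_vec k))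
      else if m = 2 then Im (\<mu> (unit_vec k)) else if k = j then 1 else 0)" for m k :: nat
  obtain y where y: "\<forall>k. k \<notin> {..4} \<longrightarrow> y k = 0" "\<exists>k\<in>{..4}. y k \<noteq> 0" "\<forall>m<4. (\<Sum>k\<le>4. A m k * y k) = 0"
    using nontrivial_kernel[of "{..4::nat}" 4 A] by auto
  have v5: "vec5 (real_vec y)"
    using y(1) by (simp add: vec5_real_vec)
  have "Im (l (unit_vec k)) = 0" for k
  proof -
    have "cnjv (unit_vec k) = unit_vec k"
      by (auto simp: unit_vec_def fun_eq_iff)
    then show ?thesis
      using l_cnjv[of "unit_vec k"] by (simp add: complex_eq_iff)
  qed
  then have "l (unit_vec k) = of_real (A 0 k)" "\<mu> (unit_vec k) = of_real (A 1 k) + \<i> * of_real (A 2 k)" for k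
    by (simp_all add: A_def complex_eq_iff)
  then have "l (real_vec y) = of_real (\<Sum>k\<le>4. A 0 k * y k)"
    "\<mu> (real_vec y) = of_real (\<Sum>k\<le>4. A 1 k * y k) + \<i> * of_real (\<Sum>k\<le>4. A 2 k * y k)"
    using clinear_form_expand[OF l_form v5] clinear_form_expand[OF mu_form v5]
    by (simp_all add: real_vec_def mult.commute distrib_left sum.distrib sum_distrib_left mult_ac)
  then have forms: "l (real_vec y) = 0" "\<mu> (real_vec y) = 0"
    using y(3) by simp_all
  have "j \<le> 4"
    using j w0_v0_basic(4) by (auto simp: vec5_def not_le[symmetric])
  moreover have "(\<Sum>k\<le>4. A 3 k * y k) = (\<Sum>k\<le>4. if k = j then y k else 0)"
    by (rule sum.cong) (auto simp: A_def)
  ultimately have "y j = 0"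
    using y(3) by simp
  have "real_vec y \<noteq> c \<odot> v0" for c
  proof
    assume eq: "real_vec y = c \<odot> v0"
    have "of_real (y j) = c * v0 j"
      using fun_cong[OF eq, of j] by (simp add: real_vec_def)
    then have "c = 0"
      using j \<open>y j = 0\<close> by simp
    then show False
      using eq y(2) by (auto simp: real_vec_def fun_eq_iff)
  qed
  then show ?thesis
    using v5 forms by (auto simp: axis_def)
qed

definition basis :: "(nat \<Rightarrow> complex) \<Rightarrow> nat \<Rightarrow> nat \<Rightarrow> real" where
  "basis n k i = (if k = 0 then Re (p i) else if k = 1 then Im (p i) else if k = 2 then Re (w0 i)
     else if k = 3 then Re (n i) else Re (v0 i))"

lemma real_vec_basis:
  assumes "axis n"
  shows "real_vec (basis n 0) = (1/2) \<odot> (p + pb)" "real_vec (basis n 1) = (-\<i>/2) \<odot> (p + (-1) \<odot> pb)"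
    "real_vec (basis n 2) = w0" "real_vec (basis n 3) = n" "real_vec (basis n 4) = v0"
proof -
  show "real_vec (basis n 0) = (1/2) \<odot> (p + pb)" "real_vec (basis n 1) = (-\<i>/2) \<odot> (p + (-1) \<odot> pb)"
    by (auto simp: real_vec_def basis_def fun_eq_iff complex_eq_iff)
  show "real_vec (basis n 2) = w0" "real_vec (basis n 3) = n" "real_vec (basis n 4) = v0"
    using assms real_vec_of_cnjv[of w0] real_vec_of_cnjv[of n] real_vec_of_cnjv[of v0] w0_v0_basic
    by (simp_all add: basis_def[abs_def] axis_def)
qed

text \<open>The coordinates \<open>y 0\<close> and \<open>y 1\<close> belong to the real and
  imaginary parts of \<open>p\<close>; they are written in terms of \<open>p\<close> and
  \<open>pb\<close>, on which the cubic is known.\<close>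

definition combine :: "(nat \<Rightarrow> complex) \<Rightarrow> (nat \<Rightarrow> complex) \<Rightarrow> nat \<Rightarrow> complex" where
  "combine n y = ((y 0 - \<i> * y 1) / 2) \<odot> p + ((y 0 + \<i> * y 1) / 2) \<odot> pb + y 2 \<odot> w0 + y 3 \<odot> n + y 4 \<odot> v0"

lemma combine_eq:
  assumes "axis n"
  shows "combine n y = (\<lambda>i. \<Sum>k\<le>4. y k * of_real (basis n k i))"
proof
  fix i
  have "of_real (basis n k i) = real_vec (basis n k) i" for k
    by (simp add: real_vec_def)
  then show "combine n y i = (\<Sum>k\<le>4. y k * of_real (basis n k i))"
    unfolding sum_le_4
    by (simp add: real_vec_basis[OF assms] real_vec_basis(2)[OF assms, unfolded One_nat_def] combine_def field_simps)
qed

lemma combine_forms: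
  assumes "axis n"
  shows "\<mu> (combine n y) = y 0 + \<i> * y 1" "\<nu> (combine n y) = y 0 - \<i> * y 1" "l (combine n y) = y 2"
  using assms
  by (simp_all add: combine_def mu_linear nu_linear l_linear mu_p nu_p w0_v0_forms axis_nu)
    (simp_all add: axis_def)

lemma basis_dual:
  assumes n: "axis n"
  obtains D :: "nat \<Rightarrow> nat \<Rightarrow> real" where
    "\<And>j k. j \<le> 4 \<Longrightarrow> k \<le> 4 \<Longrightarrow> (\<Sum>i\<le>4. D j i * basis n k i) = (if j = k then 1 else 0)"
    "\<And>x. vec5 x \<Longrightarrow> x = combine n (\<lambda>k. \<Sum>i\<le>4. of_real (D k i) * x i)"
proof -
  have v5: "basis n k i = 0" if "i > 4" for k i
    using that n w0_v0_basic vec5_p by (auto simp: basis_def axis_def vec5_def)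
  have indep: "y k = 0" if y: "\<And>i. i \<le> 4 \<Longrightarrow> (\<Sum>k\<le>4. y k * basis n k i) = 0" and k: "k \<le> 4" for y k
  proof -
    have "(\<Sum>k\<le>4. y k * basis n k i) = 0" for i
      using y[of i] v5[of i] by (cases "i \<le> 4") auto
    then have "combine n (real_vec y) i = 0" for i
      unfolding combine_eq[OF n] by (simp add: real_vec_def flip: of_real_mult of_real_sum)
    then have zero: "combine n (real_vec y) = 0"
      by (simp add: fun_eq_iff)
    have "\<mu> 0 = 0" "l 0 = 0"
      using mu_linear(1)[of 0 0] l_linear(1)[of 0 0] by simp_all
    then have "complex_of_real (y 0) + \<i> * of_real (y 1) = 0" "complex_of_real (y 2) = 0"
      using combine_forms(1,3)[OF n, of "real_vec y"] unfolding zero by (simp_all add: real_vec_def)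
    then have y012: "y 0 = 0" "y 1 = 0" "y 2 = 0"
      by (simp_all add: complex_eq_iff)
    have "of_real (y 3) \<odot> n + of_real (y 4) \<odot> v0 = 0"
      using zero y012 by (simp add: combine_def real_vec_def fun_eq_iff)
    then have rel: "of_real (y 3) * n i + of_real (y 4) * v0 i = 0" for i
      by (simp add: fun_eq_iff)
    have y3: "y 3 = 0"
    proof (rule ccontr)
      assume "y 3 \<noteq> 0"
      then have "n = of_real (- y 4 / y 3) \<odot> v0"
        using rel by (auto simp: fun_eq_iff field_simps eq_neg_iff_add_eq_0)
      then show False
        using n by (auto simp: axis_def)
    qed
    then have "y 4 = 0"
      using rel v0_nonzero by (auto simp: fun_eq_iff)
    have "k \<in> {0, 1, 2, 3, 4}"
      using k by auto
    then show ?thesis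
      using y012 y3 \<open>y 4 = 0\<close> by auto
  qed
  obtain D :: "nat \<Rightarrow> nat \<Rightarrow> real" where
    D: "\<And>j k. j \<le> 4 \<Longrightarrow> k \<le> 4 \<Longrightarrow> (\<Sum>i\<le>4. D j i * basis n k i) = (if j = k then 1 else 0)"
    and E: "\<And>(x :: nat \<Rightarrow> real) i. i \<le> 4 \<Longrightarrow> (\<Sum>k\<le>4. (\<Sum>j\<le>4. D k j * x j) * basis n k i) = x i"
    using dual_basis[of 4 "basis n"] indep by blast
  have "x = combine n (\<lambda>k. \<Sum>i\<le>4. of_real (D k i) * x i)" if x: "vec5 x" for x
  proof
    fix i
    show "x i = combine n (\<lambda>k. \<Sum>i\<le>4. of_real (D k i) * x i) i"
    proof (cases "i \<le> 4")
      case True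
      have "Re (\<Sum>k\<le>4. (\<Sum>j\<le>4. of_real (D k j) * x j) * of_real (basis n k i)) = Re (x i)"
        "Im (\<Sum>k\<le>4. (\<Sum>j\<le>4. of_real (D k j) * x j) * of_real (basis n k i)) = Im (x i)"
        using E[OF True, of "\<lambda>i. Re (x i)"] E[OF True, of "\<lambda>i. Im (x i)"] by simp_all
      then show ?thesis
        by (simp add: combine_eq[OF n] complex_eq_iff)
    next
      case False
      then show ?thesis
        using x v5 by (simp add: combine_eq[OF n] vec5_def)
    qed
  qed
  with D that show ?thesis
    by blast
qed

end

context cubic_tensor
begin

lemma T_vec5: "(\<And>v. vec5 v \<Longrightarrow> T x y v = 0) \<Longrightarrow> T x y v = 0"
  using T_cong3[of v "\<lambda>i. if i \<le> 4 then v i else 0" x y] by (simp add: vec5_def)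

lemma T_perm:
  assumes "T x y z = c"
  shows "T x y z = c" "T x z y = c" "T y x z = c" "T y z x = c" "T z x y = c" "T z y x = c"
proof -
  show "T x y z = c"
    by (fact assms)
  then show 1: "T x z y = c" and 2: "T y x z = c"
    by (simp_all add: T_swap23[of x z y] T_swap12[of y x z])
  show "T y z x = c" "T z x y = c"
    using 1 2 by (simp_all add: T_swap23[of y z x] T_swap12[of z x y])
  then show "T z y x = c"
    by (simp add: T_swap12[of z y x])
qed

end

context split_configuration
begin

lemma combine_exists:
  assumes n: "axis n" and v: "vec5 v"
  shows "\<exists>y. v = combine n y"
proof -
  obtain D :: "nat \<Rightarrow> nat \<Rightarrow> real" where
    D: "\<And>x. vec5 x \<Longrightarrow> x = combine n (\<lambda>k. \<Sum>i\<le>4. of_real (D k i) * x i)"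
    by (rule basis_dual[OF n]) blast
  show ?thesis
    by (rule exI) (rule D[OF v])
qed

text \<open>Otherwise \<open>T w0 w0\<close> would vanish on a basis and \<open>w0\<close> would be
  a real singular point.\<close>

lemma T_w0_w0_axis:
  assumes n: "axis n"
  shows "T w0 w0 n \<noteq> 0"
proof
  assume zero: "T w0 w0 n = 0"
  have "T w0 w0 v = 0" for v
  proof (rule T_vec5)
    fix v assume v: "vec5 v"
    obtain y where "v = combine n y"
      using combine_exists[OF n v] by blast
    then show "T w0 w0 v = 0"
      by (simp add: combine_def T_linear T_w0_v0_self zero)
  qed
  moreover have "w0 \<noteq> 0"
    using w0_v0_forms(1) l_linear(1)[of 0 0] by auto
  ultimately have "singular w0"
    using w0_v0_basic by (simp add: singular_def)
  then show False
    using no_real w0_v0_basic by blast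
qed

lemma T_real: "cnjv x = x \<Longrightarrow> cnjv y = y \<Longrightarrow> cnjv z = z \<Longrightarrow> cnj (T x y z) = T x y z"
  using T_cnj[of x y z] by simp

text \<open>An axis may be scaled and shifted along \<open>v0\<close>. As \<open>T v0 v0 n0\<close>
  equals \<open>\<kappa>\<close>, the shift by \<open>\<tau>\<close> changes
  \<open>T v0 n0 n0\<close> by \<open>2 * \<tau> * \<kappa>\<close> and makes it zero; the scaling
  normalizes \<open>T w0 w0 n\<close>.\<close>

lemma good_axis_exists: "\<exists>n. axis n \<and> T w0 w0 n = 1/2 \<and> T v0 n n = 0"
proof -
  obtain n0 where n0: "axis n0"
    using axis_exists by blast
  define \<kappa> where "\<kappa> = T w0 w0 n0"
  define \<tau> where "\<tau> = - T v0 n0 n0 / (2 * \<kappa>)"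
  define n where "n = (1 / (2 * \<kappa>)) \<odot> (n0 + \<tau> \<odot> v0)"
  have \<kappa>: "\<kappa> \<noteq> 0"
    using T_w0_w0_axis[OF n0] by (simp add: \<kappa>_def)
  have v0n: "T v0 v0 n0 = \<kappa>" "T v0 n0 v0 = \<kappa>"
    using T_w0_v0(2)[of n0] T_swap23[of v0 n0 v0] by (simp_all add: \<kappa>_def)
  have "cnjv n0 = n0"
    using n0 by (simp add: axis_def)
  then have "cnj \<kappa> = \<kappa>" "cnj \<tau> = \<tau>"
    using T_real[of w0 w0 n0] T_real[of v0 n0 n0] w0_v0_basic by (simp_all add: \<kappa>_def \<tau>_def)
  then have "cnjv n = n"
    using \<open>cnjv n0 = n0\<close> w0_v0_basic by (simp add: n_def cnjv_linear)
  moreover have "vec5 n" "l n = 0" "\<mu> n = 0"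
    using n0 w0_v0_basic by (auto simp: n_def axis_def l_linear mu_linear w0_v0_forms)
  moreover have "n \<noteq> c \<odot> v0" for c
  proof
    assume eq: "n = c \<odot> v0"
    have "n0 i = (2 * \<kappa> * c - \<tau>) * v0 i" for i
      using fun_cong[OF eq, of i] \<kappa> by (simp add: n_def field_simps)
    then have "n0 = (2 * \<kappa> * c - \<tau>) \<odot> v0"
      by (auto simp: fun_eq_iff)
    then show False
      using n0 by (auto simp: axis_def)
  qed
  ultimately have "axis n"
    by (simp add: axis_def)
  moreover have "T w0 w0 n = 1/2"
    using \<kappa> by (simp add: n_def T_linear T_w0_v0_self flip: \<kappa>_def)
  moreover have "T v0 n n = 0"
    using \<kappa> by (simp add: n_def T_linear T_w0_v0_self v0n \<tau>_def)
  ultimately show ?thesis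
    by blast
qed

context
  fixes n :: "nat \<Rightarrow> complex"
  assumes axis_n: "axis n" and Tw: "T w0 w0 n = 1/2" and Tv: "T v0 n n = 0"
begin

lemma vec5_n: "vec5 n"
  using axis_n by (simp add: axis_def)

lemma Tvn: "T v0 v0 n = 1/2"
  using T_w0_v0(2)[of n] Tw by simp

lemma T_p_axis: "vec5 z \<Longrightarrow> \<mu> z = 0 \<Longrightarrow> T p z z = 0" "vec5 z \<Longrightarrow> \<nu> z = 0 \<Longrightarrow> T pb z z = 0"
  using polar[of z z] polar'[of z z] by auto

lemmas T_axis_values =
  T_perm[OF T_w0_v0_self(1)] T_perm[OF T_w0_v0_self(2)] T_perm[OF T_w0_v0_self(3)] T_perm[OF T_w0_v0_self(4)]
  T_perm[OF Tw] T_perm[OF Tv] T_perm[OF Tvn] T_perm[OF T_w0_v0(1)[of n]]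

text \<open>By polarity the only terms that involve \<open>p\<close> or \<open>pb\<close> are those
  with \<open>p\<close>, \<open>pb\<close> and one vector from the remaining three, which give
  \<open>3/2 * y 2 * ((y 0)\<^sup>2 + (y 1)\<^sup>2)\<close>. The rest is the cubic in
  \<open>w0\<close>, \<open>n\<close>, \<open>v0\<close>, where the normalization of
  \<open>n\<close> leaves two free coefficients.\<close>

lemma T_combine:
  "T (combine n y) (combine n y) (combine n y) = 3/2 * normal_form (2 * T w0 n n) (2/3 * T n n n) y"
proof -
  define s t where "s = (y 0 - \<i> * y 1) / 2" and "t = (y 0 + \<i> * y 1) / 2"
  define z where "z = y 2 \<odot> w0 + y 3 \<odot> n + y 4 \<odot> v0"
  have z: "vec5 z" "\<mu> z = 0" "\<nu> z = 0" "l z = y 2"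
    unfolding z_def using vec5_n w0_v0_basic axis_nu[OF axis_n] axis_n
    by (auto simp: mu_linear nu_linear l_linear w0_v0_forms) (simp_all add: axis_def)
  have comb: "combine n y = s \<odot> p + t \<odot> pb + z"
    by (simp add: combine_def s_def t_def z_def add.assoc)
  have "T p pb z = y 2"
    using z by (simp add: l_def)
  note vals = T_perm[OF Tpp(1)] T_perm[OF Tpp(2)] T_perm[OF this] T_perm[OF T_p_axis(1)[OF z(1,2)]]
    T_perm[OF T_p_axis(2)[OF z(1,3)]]
  have "T (combine n y) (combine n y) (combine n y) = 6 * s * t * y 2 + T z z z"
    unfolding comb by (simp add: T_linear vals algebra_simps)
  moreover have "4 * s * t = (y 0)\<^sup>2 + (y 1)\<^sup>2"
  proof -
    have "(y 0 - \<i> * y 1) * (y 0 + \<i> * y 1) = (y 0)\<^sup>2 + (y 1)\<^sup>2"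
      by (simp add: power2_eq_square algebra_simps)
    moreover have "2 * s = y 0 - \<i> * y 1" "2 * t = y 0 + \<i> * y 1"
      by (simp_all add: s_def t_def)
    moreover have "4 * s * t = (2 * s) * (2 * t)"
      by simp
    ultimately show ?thesis
      by metis
  qed
  moreover have "T z z z = 3/2 * y 3 * ((y 2)\<^sup>2 + (y 4)\<^sup>2) + 3 * T w0 n n * (y 3)\<^sup>2 * y 2 + T n n n * (y 3) ^ 3"
  proof -
    have "T n w0 n = T w0 n n" "T n n w0 = T w0 n n"
      using T_perm[OF refl[of "T w0 n n"]] by simp_all
    then show ?thesis
      unfolding z_def
      by (simp add: T_linear T_axis_values power2_eq_square power3_eq_cube) (simp add: algebra_simps)
  qed
  moreover have "6 * s * t * y 2 = 3/2 * (4 * s * t) * y 2"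
    by simp
  ultimately show ?thesis
    by (simp add: normal_form_def) (simp add: algebra_simps power2_eq_square power3_eq_cube)
qed

lemma T_axis_combine: "T x x w0 = a \<Longrightarrow> T x x v0 = b \<Longrightarrow> T x x n = c \<Longrightarrow> T x x p = d \<Longrightarrow> T x x pb = e \<Longrightarrow>
    T x x (combine n y) = ((y 0 - \<i> * y 1) / 2) * d + ((y 0 + \<i> * y 1) / 2) * e + y 2 * a + y 3 * c + y 4 * b"
  by (simp add: combine_def T_linear)

text \<open>Otherwise \<open>T n n\<close> is a multiple of \<open>l\<close>, and
  \<open>no_singular_on_axis\<close> applies to \<open>n\<close>.\<close>

lemma Tnnn_nonzero: "T n n n \<noteq> 0"
proof
  assume zero: "T n n n = 0"
  have forms: "\<mu> n = 0" "\<nu> n = 0" "l n = 0"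
    using axis_n axis_nu by (auto simp: axis_def)
  have Tn: "T n n v = - 2 * (- T w0 n n / 2) * l v" if v: "vec5 v" for v
  proof -
    have "T n n w0 = T w0 n n" "T n n v0 = 0" "T n n p = 0" "T n n pb = 0"
      by (fact T_perm(6)[OF refl] T_perm(6)[OF Tv] T_perm(6)[OF T_p_axis(1)[OF vec5_n forms(1)]]
        T_perm(6)[OF T_p_axis(2)[OF vec5_n forms(2)]])+
    moreover obtain y where "v = combine n y"
      using combine_exists[OF axis_n v] by blast
    ultimately show ?thesis
      using T_axis_combine[of n] combine_forms(3)[OF axis_n] zero by simp
  qed
  have "n \<noteq> 0"
  proof
    assume "n = 0"
    then have "n = 0 \<odot> v0"
      by simp
    then show False
      using axis_n unfolding axis_def by blast
  qed
  then show False
    using no_singular_on_axis[OF vec5_n _ forms Tn] by simp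
qed

text \<open>With discriminant zero the real vector \<open>n - a w0\<close> would be singular: it is
  the double point of the conic given by the factor of \<open>y 3\<close> in the normal
  form.\<close>

lemma discriminant_nonzero: "(2 * T w0 n n)\<^sup>2 \<noteq> 4 * (2/3 * T n n n)"
proof
  define a where "a = T w0 n n"
  assume "(2 * T w0 n n)\<^sup>2 = 4 * (2/3 * T n n n)"
  then have Tn: "T n n n = 3/2 * a\<^sup>2"
    by (simp add: a_def power2_eq_square)
  define x where "x = (- a) \<odot> w0 + n"
  have perm: "T n w0 n = a" "T n n w0 = a" "T w0 n n = a"
    using T_perm[OF refl[of "T w0 n n"]] by (simp_all add: a_def)
  have x: "vec5 x" "\<mu> x = 0" "\<nu> x = 0"
    unfolding x_def using vec5_n w0_v0_basic axis_nu[OF axis_n] axis_n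
    by (auto simp: mu_linear nu_linear w0_v0_forms) (simp_all add: axis_def)
  have "T x x w0 = 0" "T x x v0 = 0" "T x x n = 0"
    by (simp_all add: x_def T_linear T_axis_values perm Tn power2_eq_square)
  moreover have "T x x p = 0" "T x x pb = 0"
    using T_perm[OF T_p_axis(1)[OF x(1,2)]] T_perm[OF T_p_axis(2)[OF x(1,3)]] by simp_all
  ultimately have comb0: "T x x (combine n y) = 0" for y
    using T_axis_combine[of x 0 0 0 0 0 y] by simp
  have "T x x v = 0" for v
  proof (rule T_vec5)
    fix v assume "vec5 v"
    then obtain y where "v = combine n y"
      using combine_exists[OF axis_n] by blast
    with comb0 show "T x x v = 0"
      by simp
  qed
  moreover have "cnjv x = x"
    using axis_n w0_v0_basic T_real[of w0 n n] by (simp add: x_def cnjv_linear a_def axis_def)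
  moreover have "x \<noteq> 0"
  proof
    assume "x = 0"
    have eq: "n i = a * w0 i" for i
      using fun_cong[OF \<open>x = 0\<close>, of i] by (simp add: x_def)
    have "a = l (a \<odot> w0)"
      by (simp add: l_linear w0_v0_forms)
    also have "a \<odot> w0 = n"
      using eq by (auto simp: fun_eq_iff)
    finally have "a = 0"
      using axis_n by (simp add: axis_def)
    then have "n = 0 \<odot> v0"
      using eq by (auto simp: fun_eq_iff)
    then show False
      using axis_n unfolding axis_def by blast
  qed
  ultimately have "singular x"
    using x by (simp add: singular_def)
  then show False
    using no_real \<open>cnjv x = x\<close> by blast
qed

end

end

text \<open>The vectors \<open>e k\<close> are the new real basis and the rows of \<open>D\<close>
  the new coordinate functions.\<close>

lemma normal_form_exists:
  assumes "cubic_threefold F" "\<forall>P\<in>singular_locus F. \<not> real_point P" "has_2D4_2A1_singularities F"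
  obtains e D :: "nat \<Rightarrow> nat \<Rightarrow> real" and a c :: real where "c \<noteq> 0" "a\<^sup>2 \<noteq> 4 * c"
    "\<And>k i. i > 4 \<Longrightarrow> e k i = 0"
    "\<And>j k. j \<le> 4 \<Longrightarrow> k \<le> 4 \<Longrightarrow> (\<Sum>i\<le>4. D j i * e k i) = (if j = k then 1 else 0)"
    "\<And>x. vec5 x \<Longrightarrow> x = (\<lambda>i. \<Sum>k\<le>4. (\<Sum>j\<le>4. of_real (D k j) * x j) * of_real (e k i))"
    "\<And>x. vec5 x \<Longrightarrow>
      peval F x = 3/2 * normal_form (of_real a) (of_real c) (\<lambda>k. \<Sum>j\<le>4. of_real (D k j) * x j)"
proof -
  obtain C p q where "cubic_tensor C" and F: "\<And>x. peval F x = tri C x x x"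
    and conf: "cubic_tensor.singular C p" "cubic_tensor.singular C q" "cubic_tensor.split_at C p"
    "\<And>x. cubic_tensor.singular C x \<Longrightarrow> \<exists>c. x = c \<odot> p \<or> x = c \<odot> cnjv p \<or> x = c \<odot> q \<or> x = c \<odot> cnjv q"
    "\<And>x. cubic_tensor.singular C x \<Longrightarrow> cnjv x \<noteq> x" "\<And>c. q \<noteq> c \<odot> p" "\<And>c. q \<noteq> c \<odot> cnjv p"
    using singular_configuration[OF assms] by blast
  interpret cubic_tensor C
    by fact
  interpret cubic_configuration C p q
    using conf by unfold_locales
  obtain \<mu> where "clinear_form \<mu>" "\<mu> p = 0" "\<mu> pb = 2"
    "\<And>u v. vec5 u \<Longrightarrow> vec5 v \<Longrightarrow> 2 * T p u v = l u * \<mu> v + l v * \<mu> u"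
    by (rule mu_exists) blast
  then interpret split_configuration C p q \<mu>
    by unfold_locales
  obtain n where n: "axis n" "T w0 w0 n = 1/2" "T v0 n n = 0"
    using good_axis_exists by blast
  obtain D :: "nat \<Rightarrow> nat \<Rightarrow> real" where
    D: "\<And>j k. j \<le> 4 \<Longrightarrow> k \<le> 4 \<Longrightarrow> (\<Sum>i\<le>4. D j i * basis n k i) = (if j = k then 1 else 0)"
    and E: "\<And>x. vec5 x \<Longrightarrow> x = combine n (\<lambda>k. \<Sum>i\<le>4. of_real (D k i) * x i)"
    by (rule basis_dual[OF n(1)]) blast
  define a c where "a = 2 * Re (T w0 n n)" and "c = 2/3 * Re (T n n n)"
  have "cnj (T w0 n n) = T w0 n n" "cnj (T n n n) = T n n n"
    using n(1) w0_v0_basic by (simp_all add: T_real axis_def)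
  then have ac: "2 * T w0 n n = of_real a" "2/3 * T n n n = of_real c"
    by (simp_all add: a_def c_def complex_eq_iff)
  show ?thesis
  proof (rule that)
    show "c \<noteq> 0"
      using Tnnn_nonzero[OF n] ac(2) by auto
    show "a\<^sup>2 \<noteq> 4 * c"
      using discriminant_nonzero[OF n] unfolding ac
      by (metis of_real_mult of_real_numeral of_real_power)
    show "basis n k i = 0" if "i > 4" for k i
      using that n(1) w0_v0_basic vec5_p by (auto simp: basis_def axis_def vec5_def)
    show "(\<Sum>i\<le>4. D j i * basis n k i) = (if j = k then 1 else 0)" if "j \<le> 4" "k \<le> 4" for j k
      by (rule D[OF that])
    show "x = (\<lambda>i. \<Sum>k\<le>4. (\<Sum>j\<le>4. of_real (D k j) * x j) * of_real (basis n k i))" if "vec5 x" for x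
      using E[OF that] unfolding combine_eq[OF n(1)] .
    show "peval F x = 3/2 * normal_form (of_real a) (of_real c) (\<lambda>k. \<Sum>j\<le>4. of_real (D k j) * x j)"
      if "vec5 x" for x
      using T_combine[OF n, of "\<lambda>k. \<Sum>j\<le>4. of_real (D k j) * x j"] unfolding ac F
      by (simp flip: E[OF that])
  qed
qed

section \<open>Real planes\<close>

locale normal_cubic =
  fixes F :: "nat rpoly" and e D :: "nat \<Rightarrow> nat \<Rightarrow> real" and a c :: real
  assumes c_nz: "c \<noteq> 0" and disc: "a\<^sup>2 \<noteq> 4 * c"
    and e_supp: "i > 4 \<Longrightarrow> e k i = 0"
    and dual: "j \<le> 4 \<Longrightarrow> k \<le> 4 \<Longrightarrow> (\<Sum>i\<le>4. D j i * e k i) = (if j = k then 1 else 0)"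
    and expand: "vec5 x \<Longrightarrow> x = (\<lambda>i. \<Sum>k\<le>4. (\<Sum>j\<le>4. of_real (D k j) * x j) * of_real (e k i))"
    and F_eq: "vec5 x \<Longrightarrow>
      peval F x = 3/2 * normal_form (of_real a) (of_real c) (\<lambda>k. \<Sum>j\<le>4. of_real (D k j) * x j)"
begin

definition crd :: "nat \<Rightarrow> (nat \<Rightarrow> complex) \<Rightarrow> complex" where
  "crd k x = (\<Sum>j\<le>4. of_real (D k j) * x j)"

definition vec :: "(nat \<Rightarrow> complex) \<Rightarrow> nat \<Rightarrow> complex" where
  "vec y = (\<lambda>i. \<Sum>k\<le>4. y k * of_real (e k i))"

abbreviation nf :: "(nat \<Rightarrow> complex) \<Rightarrow> complex" where
  "nf \<equiv> normal_form (of_real a) (of_real c)"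

lemma vec5_vec: "vec5 (vec y)"
  by (simp add: vec5_def vec_def e_supp)

lemma crd_vec: "k \<le> 4 \<Longrightarrow> crd k (vec y) = y k"
proof -
  assume k: "k \<le> 4"
  have "crd k (vec y) = (\<Sum>m\<le>4. y m * of_real (\<Sum>j\<le>4. D k j * e m j))"
    unfolding crd_def vec_def sum_distrib_left of_real_sum
    by (subst sum.swap) (simp add: mult_ac)
  also have "\<dots> = (\<Sum>m\<le>4. if m = k then y m else 0)"
    using k by (intro sum.cong) (auto simp: dual)
  finally show ?thesis
    using k by simp
qed

lemma vec_crd: "vec5 x \<Longrightarrow> vec (\<lambda>k. crd k x) = x"
  using expand[of x] by (simp add: vec_def crd_def)

lemma peval_F: "vec5 x \<Longrightarrow> peval F x = 3/2 * nf (\<lambda>k. crd k x)"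
  using F_eq by (simp add: crd_def)

lemma vec_eq_0_iff: "vec y = 0 \<longleftrightarrow> (\<forall>k\<le>4. y k = 0)"
proof
  assume eq: "vec y = 0"
  have "crd k 0 = 0" for k
    by (simp add: crd_def)
  then show "\<forall>k\<le>4. y k = 0"
    using crd_vec[of _ y] unfolding eq by auto
qed (simp add: vec_def fun_eq_iff)

lemma crd_eq_0D:
  assumes "vec5 x" "\<And>k. k \<le> 4 \<Longrightarrow> crd k x = 0"
  shows "x = 0"
proof -
  have "vec (\<lambda>k. crd k x) = 0"
    unfolding vec_eq_0_iff using assms(2) by simp
  then show ?thesis
    unfolding vec_crd[OF assms(1)] .
qed

lemma complex_points_iff: "x \<in> complex_points F \<longleftrightarrow> vec5 x \<and> x \<noteq> 0 \<and> nf (\<lambda>k. crd k x) = 0"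
  by (cases "vec5 x") (simp_all add: complex_points_def hcoords_proj_space4 peval_F)

lemma vec_in_complex_points: "vec y \<in> complex_points F \<longleftrightarrow> (\<exists>k\<le>4. y k \<noteq> 0) \<and> nf y = 0"
proof -
  have "nf (\<lambda>k. crd k (vec y)) = nf y"
    by (simp add: normal_form_def crd_vec)
  then show ?thesis
    using vec_eq_0_iff[of y] by (auto simp: complex_points_iff vec5_vec)
qed

text \<open>On \<open>y 2 = 0\<close> the normal form is
  \<open>y 3 * ((y 4)\<^sup>2 + c * (y 3)\<^sup>2)\<close>, so the planes of this kind in the
  threefold correspond to the real zeros (p : q) of p (q^2 + c p^2).\<close>

definition plane :: "real \<Rightarrow> real \<Rightarrow> (nat \<Rightarrow> complex) set" where
  "plane p q = {x \<in> hcoords (proj_space 4). \<exists>s t u :: complex.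
     x = (\<lambda>i. s * of_real (e 0 i) + t * of_real (e 1 i) + u * of_real (p * e 3 i + q * e 4 i))}"

lemma plane_vec: "(\<lambda>i. s * of_real (e 0 i) + t * of_real (e 1 i) + u * of_real (p * e 3 i + q * e 4 i)) =
    vec (\<lambda>k. if k = 0 then s else if k = 1 then t else if k = 3 then u * of_real p
      else if k = 4 then u * of_real q else 0)"
  by (simp add: fun_eq_iff vec_def sum_le_4 algebra_simps)

lemma real_plane_plane:
  assumes "p \<noteq> 0 \<or> q \<noteq> 0"
  shows "real_plane (plane p q)"
  unfolding real_plane_def
proof (rule exI[of _ "e 0"], rule exI[of _ "e 1"], rule exI[of _ "\<lambda>i. p * e 3 i + q * e 4 i"], intro conjI)
  show "\<forall>i>4. e 0 i = 0 \<and> e 1 i = 0 \<and> p * e 3 i + q * e 4 i = 0"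
    by (simp add: e_supp)
  show "\<forall>s t u. (\<forall>i. s * e 0 i + t * e 1 i + u * (p * e 3 i + q * e 4 i) = 0) \<longrightarrow> s = 0 \<and> t = 0 \<and> u = 0"
  proof (intro allI impI)
    fix s t u assume zero: "\<forall>i. s * e 0 i + t * e 1 i + u * (p * e 3 i + q * e 4 i) = 0"
    have "of_real s * of_real (e 0 i) + of_real t * of_real (e 1 i) + of_real u * of_real (p * e 3 i + q * e 4 i) =
        (0 :: complex)" for i
      using zero by (simp flip: of_real_mult of_real_add)
    then have "vec (\<lambda>k. if k = 0 then of_real s else if k = 1 then of_real t
        else if k = 3 then of_real u * of_real p else if k = 4 then of_real u * of_real q else 0) = 0"
      unfolding plane_vec[symmetric] by (simp add: fun_eq_iff)
    then have *: "\<forall>k\<le>(4::nat). (if k = 0 then of_real s else if k = 1 then of_real t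
        else if k = 3 then of_real u * of_real p else if k = 4 then of_real u * of_real q else 0 :: complex) = 0"
      by (simp only: vec_eq_0_iff)
    show "s = 0 \<and> t = 0 \<and> u = 0"
      using *[rule_format, of 0] *[rule_format, of 1] *[rule_format, of 3] *[rule_format, of 4] assms by auto
  qed
  show "plane p q = {x \<in> hcoords (proj_space 4). \<exists>s t u. x = (\<lambda>i. s * complex_of_real (e 0 i) +
      t * complex_of_real (e 1 i) + u * complex_of_real (p * e 3 i + q * e 4 i))}"
    by (simp add: plane_def)
qed

lemma contains_plane:
  assumes "p \<noteq> 0 \<or> q \<noteq> 0" "p * (q\<^sup>2 + c * p\<^sup>2) = 0"
  shows "contains_real_plane F (plane p q)"
  unfolding contains_real_plane_def
proof (intro conjI subsetI)
  show "real_plane (plane p q)"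
    using assms by (intro real_plane_plane)
  fix x assume "x \<in> plane p q"
  then obtain s t u where x: "x \<noteq> 0" "x = vec (\<lambda>k. if k = 0 then s else if k = 1 then t
      else if k = 3 then u * of_real p else if k = 4 then u * of_real q else 0)"
    unfolding plane_def plane_vec hcoords_proj_space4 by blast
  have "nf (\<lambda>k. if k = 0 then s else if k = 1 then t
      else if k = 3 then u * of_real p else if k = 4 then u * of_real q else 0) =
      u ^ 3 * of_real (p * (q\<^sup>2 + c * p\<^sup>2))"
    by (simp add: normal_form_def power_mult_distrib power2_eq_square power3_eq_cube algebra_simps)
  also have "\<dots> = 0"
    unfolding assms(2) by simp
  finally have "nf (\<lambda>k. if k = 0 then s else if k = 1 then t
      else if k = 3 then u * of_real p else if k = 4 then u * of_real q else 0) = 0" .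
  then show "x \<in> complex_points F"
    using x by (simp only: vec_in_complex_points) (use vec_eq_0_iff in blast)
qed

lemma contains_axis_plane: "contains_real_plane F (plane 0 1)"
  by (rule contains_plane) simp_all

lemma two_planes:
  assumes "c < 0"
  shows "\<not> (\<exists>!L. contains_real_plane F L)"
proof -
  define g where "g = sqrt (- c)"
  have "contains_real_plane F (plane 1 g)"
    using assms by (intro contains_plane) (auto simp: g_def)
  moreover have "plane 0 1 \<noteq> plane 1 g"
  proof
    assume eq: "plane 0 1 = plane 1 g"
    define y :: "nat \<Rightarrow> complex" where "y = (\<lambda>k. if k = 0 then 0 else if k = 1 then 0
        else if k = 3 then 1 * of_real 1 else if k = 4 then 1 * of_real g else 0)"
    have "vec y \<in> plane 1 g"
      unfolding plane_def plane_vec hcoords_proj_space4 mem_Collect_eq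
    proof (intro conjI)
      show "vec5 (vec y)"
        by (rule vec5_vec)
      have "y 3 \<noteq> 0"
        by (simp add: y_def)
      then show "vec y \<noteq> 0"
        unfolding vec_eq_0_iff by (intro notI) simp
      show "\<exists>s t u. vec y = vec (\<lambda>k. if k = 0 then s else if k = 1 then t
          else if k = 3 then u * of_real 1 else if k = 4 then u * of_real g else 0)"
        by (rule exI[of _ 0], rule exI[of _ 0], rule exI[of _ 1]) (simp only: y_def)
    qed
    then have "vec y \<in> plane 0 1"
      by (simp only: eq)
    then obtain s t u where "vec y = vec (\<lambda>k. if k = 0 then s else if k = 1 then t
        else if k = 3 then u * of_real 0 else if k = 4 then u * of_real 1 else 0)"
      unfolding plane_def plane_vec by blast
    from arg_cong[OF this, of "crd 3"] show False
      by (simp add: crd_vec y_def)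
  qed
  ultimately show ?thesis
    using contains_axis_plane by blast
qed

text \<open>A plane meets \<open>y 2 = y 4 = 0\<close>, and for positive \<open>c\<close> it does so
  in a point with \<open>y 3 = 0\<close> as well. From this point one sees that \<open>y 2\<close>
  vanishes on the plane, and then \<open>y 3\<close> does, because
  \<open>(y 4)\<^sup>2 + c * (y 3)\<^sup>2\<close> is definite.\<close>

lemma plane_unique:
  assumes c: "c > 0" and L: "contains_real_plane F L"
  shows "L = plane 0 1"
proof -
  obtain u v w :: "nat \<Rightarrow> real" where supp0: "\<forall>i>4. u i = 0 \<and> v i = 0 \<and> w i = 0"
    and indep0: "\<forall>s t r. (\<forall>i. s * u i + t * v i + r * w i = 0) \<longrightarrow> s = 0 \<and> t = 0 \<and> r = 0"
    and L_eq: "L = {x \<in> hcoords (proj_space 4). \<exists>s t r :: complex.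
      x = (\<lambda>i. s * of_real (u i) + t * of_real (v i) + r * of_real (w i))}"
    using L unfolding contains_real_plane_def real_plane_def by (elim exE conjE) (rule that)
  have supp: "u i = 0 \<and> v i = 0 \<and> w i = 0" if "i > 4" for i
    using supp0 that by simp
  have indep: "s = 0 \<and> t = 0 \<and> r = 0" if "\<And>i. s * u i + t * v i + r * w i = 0" for s t r
    using indep0[rule_format, of s t r] that by simp
  define b where "b m = (if m = 0 then u else if m = 1 then v else w)" for m :: nat
  define A where "A k m = (\<Sum>j\<le>4. D k j * b m j)" for k m
  define pt where "pt y = real_vec (\<lambda>i. \<Sum>m\<le>2. y m * b m i)" for y :: "nat \<Rightarrow> real"
  define h where "h y k = (\<Sum>m\<le>2. A k m * y m)" for y k
  have sum2: "(\<Sum>m\<le>2::nat. f m) = f 0 + f 1 + f 2" for f :: "nat \<Rightarrow> 'z::comm_monoid_add"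
    by (simp add: numeral_eq_Suc add.assoc)
  have pt5: "vec5 (pt y)" for y
    using supp by (auto simp: pt_def vec5_real_vec b_def intro!: sum.neutral)
  have crd_pt: "crd k (pt y) = of_real (h y k)" for k y
  proof -
    have "crd k (pt y) = of_real (\<Sum>j\<le>4. \<Sum>m\<le>2. D k j * (y m * b m j))"
      by (simp add: crd_def pt_def real_vec_def sum_distrib_left)
    also have "(\<Sum>j\<le>4. \<Sum>m\<le>2. D k j * (y m * b m j)) = h y k"
      unfolding h_def A_def by (subst sum.swap) (simp add: sum_distrib_right sum_distrib_left mult_ac)
    finally show ?thesis .
  qed
  have pt0: "pt y \<noteq> 0" if y: "\<exists>m\<le>2. y m \<noteq> 0" for y
  proof
    assume zero: "pt y = 0"
    have "y 0 * u i + y 1 * v i + y 2 * w i = 0" for i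
    proof -
      have "complex_of_real (\<Sum>m\<le>2. y m * b m i) = 0"
        using fun_cong[OF zero, of i] unfolding pt_def real_vec_def by (simp only: zero_fun_def)
      then show ?thesis
        by (simp only: of_real_eq_0_iff) (simp add: sum2 b_def)
    qed
    then have "y 0 = 0 \<and> y 1 = 0 \<and> y 2 = 0"
      by (rule indep)
    moreover have "m = 0 \<or> m = 1 \<or> m = 2" if "m \<le> 2" for m :: nat
      using that by auto
    ultimately show False
      using y by metis
  qed
  define nr where "nr = (\<lambda>\<eta>. normal_form a c \<eta>)"
  have nf_real: "nf (\<lambda>k. of_real (\<eta> k)) = of_real (nr \<eta>)" for \<eta>
    by (simp add: nr_def ring_map.map_normal_form[OF ring_map_of_real])
  have nr0: "nr (h y) = 0" for y
  proof (cases "\<exists>m\<le>2. y m \<noteq> 0")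
    case True
    have "pt y = (\<lambda>i. of_real (y 0) * of_real (u i) + of_real (y 1) * of_real (v i) + of_real (y 2) * of_real (w i))"
      by (simp add: pt_def real_vec_def sum2 b_def)
    moreover have "pt y \<in> hcoords (proj_space 4)"
      using pt0[OF True] pt5 by (simp add: hcoords_proj_space4)
    ultimately have "pt y \<in> L"
      unfolding L_eq by blast
    then have "nf (\<lambda>k. crd k (pt y)) = 0"
      using L by (auto simp: contains_real_plane_def complex_points_iff)
    then show ?thesis
      unfolding crd_pt nf_real by simp
  next
    case False
    then have "h y k = 0" for k
      by (simp add: h_def)
    then show ?thesis
      by (simp add: nr_def normal_form_def)
  qed
  obtain y0 where y0: "\<exists>m\<le>2. y0 m \<noteq> 0" "h y0 2 = 0" "h y0 4 = 0"
    using nontrivial_kernel[of "{..2::nat}" 2 "\<lambda>r m. A (if r = 0 then 2 else 4) m"]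
    by (auto simp: h_def numeral_2_eq_2 less_Suc_eq all_conj_distrib)
  have "h y0 3 * (c * (h y0 3)\<^sup>2) = 0"
    using nr0[of y0] y0 by (simp add: nr_def normal_form_def)
  then have y03: "h y0 3 = 0"
    using c by simp
  have ab: "(h y0 0)\<^sup>2 + (h y0 1)\<^sup>2 > 0"
  proof (rule ccontr)
    assume "\<not> ?thesis"
    then have "h y0 0 = 0" "h y0 1 = 0"
      by (simp_all add: not_less sum_power2_le_zero_iff)
    then have "crd k (pt y0) = 0" if "k \<le> 4" for k
      using that y0 y03 by (cases "k = 0 \<or> k = 1 \<or> k = 2 \<or> k = 3 \<or> k = 4") (auto simp: crd_pt)
    then show False
      using crd_eq_0D[OF pt5, of y0] pt0[OF y0(1)] by blast
  qed
  have h2: "h y 2 = 0" for y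
  proof -
    have lin: "h (\<lambda>m. y m + t * y0 m) k = h y k + t * h y0 k" for t k
      by (simp add: h_def algebra_simps sum.distrib sum_distrib_left)
    \<comment> \<open>The second difference in direction \<open>y0\<close>, in which only
      coordinates 0 and 1 move, isolates the quadratic term in them, whose coefficient is coordinate
      2.\<close>
    have "nr (h (\<lambda>m. y m + 1 * y0 m)) + nr (h (\<lambda>m. y m + (- 1) * y0 m)) - 2 * nr (h y) =
        2 * h y 2 * ((h y0 0)\<^sup>2 + (h y0 1)\<^sup>2)"
      unfolding nr_def normal_form_def lin y0 y03 by (simp add: power2_eq_square algebra_simps)
    then show ?thesis
      using ab by (auto simp: nr0)
  qed
  have h3: "h y 3 = 0" for y
  proof (rule ccontr)
    assume "h y 3 \<noteq> 0"
    then have "(h y 4)\<^sup>2 + c * (h y 3)\<^sup>2 > 0"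
      using c by (intro add_nonneg_pos) auto
    then show False
      using nr0[of y] \<open>h y 3 \<noteq> 0\<close> by (simp add: nr_def normal_form_def h2)
  qed
  have A23: "A 2 m = 0" "A 3 m = 0" if "m \<le> 2" for m
  proof -
    have "h (\<lambda>j. if j = m then 1 else 0) k = A k m" for k
      using that by (simp add: h_def if_distrib[where f = "\<lambda>t. _ * t"] cong: if_cong)
    then show "A 2 m = 0" "A 3 m = 0"
      using h2[of "\<lambda>j. if j = m then 1 else 0"] h3[of "\<lambda>j. if j = m then 1 else 0"] by simp_all
  qed
  \<comment> \<open>The coordinates 0, 1 and 4 that remain on the plane. They are independent on it,
    so the inclusion of planes is an equality.\<close>
  define \<iota> where "\<iota> i = (if i = 0 then 0 else if i = 1 then 1 else 4 :: nat)" for i :: nat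
  have cpt: "(\<lambda>i. s * of_real (u i) + t * of_real (v i) + r * of_real (w i)) =
      vec (\<lambda>k. s * of_real (A k 0) + t * of_real (A k 1) + r * of_real (A k 2))" for s t r
  proof -
    have 5: "vec5 (\<lambda>i. s * of_real (u i) + t * of_real (v i) + r * of_real (w i))"
      using supp by (simp add: vec5_def)
    have "crd k (\<lambda>i. s * of_real (u i) + t * of_real (v i) + r * of_real (w i)) =
        s * of_real (A k 0) + t * of_real (A k 1) + r * of_real (A k 2)" for k
      by (simp add: crd_def A_def b_def sum_distrib_left sum.distrib algebra_simps)
    then show ?thesis
      using vec_crd[OF 5] by simp
  qed
  have axis: "x \<in> plane 0 1 \<longleftrightarrow> x \<in> hcoords (proj_space 4) \<and> (\<exists>y. y 2 = 0 \<and> y 3 = 0 \<and> x = vec y)" for x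
  proof -
    define \<eta> where "\<eta> s t u k = (if k = 0 then s else if k = 1 then t
        else if k = 3 then u * of_real 0 else if k = 4 then u * of_real 1 else 0 :: complex)" for s t u and k :: nat
    have "vec y = vec (\<eta> (y 0) (y 1) (y 4))" if "y 2 = 0" "y 3 = 0" for y
      using that by (simp add: vec_def fun_eq_iff sum_le_4 \<eta>_def)
    moreover have "\<eta> s t u 2 = 0" "\<eta> s t u 3 = 0" for s t u
      by (simp_all add: \<eta>_def)
    ultimately have "(\<exists>s t u. x = vec (\<eta> s t u)) \<longleftrightarrow> (\<exists>y. y 2 = 0 \<and> y 3 = 0 \<and> x = vec y)"
      by metis
    then show ?thesis
      unfolding plane_def plane_vec \<eta>_def by simp
  qed
  show ?thesis
  proof (intro equalityI subsetI)
    fix x assume "x \<in> L"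
    then obtain s t r where "x \<in> hcoords (proj_space 4)"
      "x = vec (\<lambda>k. s * of_real (A k 0) + t * of_real (A k 1) + r * of_real (A k 2))"
      unfolding L_eq cpt by blast
    then show "x \<in> plane 0 1"
      unfolding axis using A23[of 0] A23[of 1] A23[of 2]
      by (intro conjI exI[of _ "\<lambda>k. s * of_real (A k 0) + t * of_real (A k 1) + r * of_real (A k 2)"]) simp_all
  next
    fix x assume "x \<in> plane 0 1"
    then obtain y where x: "x \<in> hcoords (proj_space 4)" "x = vec y" "y 2 = 0" "y 3 = 0"
      unfolding axis by blast
    have "\<exists>s t r. \<forall>k\<le>4. s * of_real (A k 0) + t * of_real (A k 1) + r * of_real (A k 2) = y k"
    proof -
      have ind: "q m = 0" if q: "\<And>i. i \<le> 2 \<Longrightarrow> (\<Sum>k\<le>2. q k * A (\<iota> i) k) = 0" and m: "m \<le> 2" for q m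
      proof (rule ccontr)
        assume "q m \<noteq> 0"
        then have "pt q \<noteq> 0"
          using pt0 m by blast
        have "h q (\<iota> i) = 0" if "i \<le> 2" for i
          using q[OF that] by (simp add: h_def mult.commute)
        then have "h q 0 = 0" "h q 1 = 0" "h q 4 = 0"
          by (auto simp: \<iota>_def dest: spec[of _ 0] meta_spec[of _ 0] meta_spec[of _ 1] meta_spec[of _ 2])
        then have "crd k (pt q) = 0" if "k \<le> 4" for k
          using that h2 h3 by (cases "k = 0 \<or> k = 1 \<or> k = 2 \<or> k = 3 \<or> k = 4") (auto simp: crd_pt)
        then show False
          using crd_eq_0D[OF pt5, of q] \<open>pt q \<noteq> 0\<close> by blast
      qed
      obtain G :: "nat \<Rightarrow> nat \<Rightarrow> real" where G: "\<And>(x :: nat \<Rightarrow> real) i. i \<le> 2 \<Longrightarrow>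
          (\<Sum>k\<le>2. (\<Sum>j\<le>2. G k j * x j) * A (\<iota> i) k) = x i"
        by (rule dual_basis[of 2 "\<lambda>k i. A (\<iota> i) k"]) (use ind in blast)+
      define z where "z k = (\<Sum>j\<le>2. of_real (G k j) * y (\<iota> j))" for k
      have z: "(\<Sum>k\<le>2. z k * of_real (A (\<iota> i) k)) = y (\<iota> i)" if "i \<le> 2" for i
        using G[OF that, of "\<lambda>j. Re (y (\<iota> j))"] G[OF that, of "\<lambda>j. Im (y (\<iota> j))"]
        by (simp add: z_def complex_eq_iff)
      have "z 0 * of_real (A k 0) + z 1 * of_real (A k 1) + z 2 * of_real (A k 2) = y k" if "k \<le> 4" for k
      proof -
        have "k = 0 \<or> k = 1 \<or> k = 2 \<or> k = 3 \<or> k = 4"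
          using that by auto
        then show ?thesis
          using z[of 0] z[of 1] z[of 2] A23[of 0] A23[of 1] A23[of 2] x(3,4)
          by (elim disjE) (simp_all add: sum2 \<iota>_def)
      qed
      then show ?thesis
        by blast
    qed
    then obtain s t r where "\<And>k. k \<le> 4 \<Longrightarrow> s * of_real (A k 0) + t * of_real (A k 1) + r * of_real (A k 2) = y k"
      by blast
    then have "x = vec (\<lambda>k. s * of_real (A k 0) + t * of_real (A k 1) + r * of_real (A k 2))"
      unfolding x(2) vec_def by (intro ext sum.cong) auto
    then show "x \<in> L"
      unfolding L_eq cpt using x(1) by blast
  qed
qed

lemma unique_plane: "c > 0 \<Longrightarrow> \<exists>!L. contains_real_plane F L"
  using plane_unique contains_axis_plane by blast

end

section \<open>Dense open subsets\<close>

text \<open>The sum of squares is a product of Z = x0 + i x1 and W = x0 - i x1. If one factor is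
  nonzero, it is kept fixed and the other is solved for; if both vanish, a square root of the small
  value does.\<close>

lemma sum_squares_lift:
  assumes \<omega>: "(\<omega> \<longlongrightarrow> x0\<^sup>2 + x1\<^sup>2) F"
  obtains \<xi>0 \<xi>1 :: "'a \<Rightarrow> complex" where "(\<xi>0 \<longlongrightarrow> x0) F" "(\<xi>1 \<longlongrightarrow> x1) F" "\<And>t. (\<xi>0 t)\<^sup>2 + (\<xi>1 t)\<^sup>2 = \<omega> t"
proof -
  define Z W where "Z = x0 + \<i> * x1" and "W = x0 - \<i> * x1"
  have x: "x0 = (Z + W) / 2" "x1 = (Z - W) / (2 * \<i>)"
    by (simp_all add: Z_def W_def)
  have ZW: "x0\<^sup>2 + x1\<^sup>2 = Z * W"
    by (simp add: Z_def W_def power2_eq_square algebra_simps)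
  have split: "((z + w) / 2)\<^sup>2 + ((z - w) / (2 * \<i>))\<^sup>2 = z * w" for z w
    by (simp add: power2_eq_square field_simps)
  consider "Z \<noteq> 0" | "W \<noteq> 0" | "Z = 0" "W = 0"
    by blast
  then show ?thesis
  proof cases
    case 1
    have L: "((\<lambda>t. \<omega> t / Z) \<longlongrightarrow> W) F"
      using tendsto_divide[OF \<omega> tendsto_const 1] 1 by (simp add: ZW)
    have "((\<lambda>t. (Z + \<omega> t / Z) / 2) \<longlongrightarrow> x0) F" "((\<lambda>t. (Z - \<omega> t / Z) / (2 * \<i>)) \<longlongrightarrow> x1) F"
      unfolding x by (intro tendsto_intros L; simp)+
    then show ?thesis
      by (rule that) (simp only: split, simp add: 1)
  next
    case 2
    have L: "((\<lambda>t. \<omega> t / W) \<longlongrightarrow> Z) F"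
      using tendsto_divide[OF \<omega> tendsto_const 2] 2 by (simp add: ZW)
    have "((\<lambda>t. (\<omega> t / W + W) / 2) \<longlongrightarrow> x0) F" "((\<lambda>t. (\<omega> t / W - W) / (2 * \<i>)) \<longlongrightarrow> x1) F"
      unfolding x by (intro tendsto_intros L; simp)+
    then show ?thesis
      by (rule that) (simp only: split, simp add: 2)
  next
    case 3
    have "((\<lambda>t. sqrt (norm (\<omega> t))) \<longlongrightarrow> sqrt (norm (x0\<^sup>2 + x1\<^sup>2))) F"
      by (intro tendsto_intros \<omega>)
    moreover have "norm (csqrt z) = sqrt (norm z)" for z
      using power2_csqrt[of z] by (metis norm_ge_zero norm_power real_sqrt_unique)
    ultimately have "((\<lambda>t. csqrt (\<omega> t)) \<longlongrightarrow> 0) F"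
      using 3 by (intro tendsto_norm_zero_cancel[of "\<lambda>t. csqrt (\<omega> t)"]) (simp add: ZW)
    then show ?thesis
      using 3 by (intro that[of "\<lambda>t. csqrt (\<omega> t)" "\<lambda>_. 0"]) (simp_all add: x)
  qed
qed

definition ncoords :: "'r \<Rightarrow> 'r \<Rightarrow> 'r \<Rightarrow> 'r \<Rightarrow> 'r \<Rightarrow> (nat \<Rightarrow> 'r) \<Rightarrow> nat \<Rightarrow> 'r" where
  "ncoords x0 x1 y l m r = r(0 := x0, 1 := x1, 2 := y, 3 := l, 4 := m)"

lemma normal_form_ncoords:
  "normal_form a c (ncoords x0 x1 y l m r) = y * (x0\<^sup>2 + x1\<^sup>2) + l * (y\<^sup>2 + m\<^sup>2 + a * l * y + c * l\<^sup>2)"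
  by (simp add: normal_form_def ncoords_def)

lemma ncoords_apply: "ncoords x0 x1 y l m r 2 = y" "ncoords x0 x1 y l m r 3 = l" "ncoords x0 x1 y l m r 4 = m"
  by (simp_all add: ncoords_def)

text \<open>In place of the irreducibility of the normal form we use paths: every point of the hypersurface
  is a limit of points of it at which \<open>y 2\<close> and \<open>b\<close> do not vanish.\<close>

lemma hypersurface_density:
  fixes \<Psi> :: "(nat \<Rightarrow> complex) \<Rightarrow> complex"
  assumes c: "c \<noteq> 0"
    and cont: "\<And>\<gamma> y. (\<And>i. ((\<lambda>t. \<gamma> t i) \<longlongrightarrow> y i) (at (0::complex))) \<Longrightarrow> ((\<lambda>t. \<Psi> (\<gamma> t)) \<longlongrightarrow> \<Psi> y) (at 0)"
    and b: "\<And>y l m. \<exists>d1 d2 d3. eventually (\<lambda>t. b (y + t * d1) (l + t * d2) (m + t * d3) \<noteq> (0::complex)) (at 0)"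
    and zero: "\<And>y. normal_form a c y = 0 \<Longrightarrow> y 2 \<noteq> 0 \<Longrightarrow> b (y 2) (y 3) (y 4) \<noteq> 0 \<Longrightarrow> \<Psi> y = 0"
    and y: "normal_form a c y = 0"
  shows "\<Psi> y = 0"
proof -
  have limit: "\<Psi> y = 0"
    if "\<And>i. ((\<lambda>t. \<gamma> t i) \<longlongrightarrow> y i) (at (0::complex))" "eventually (\<lambda>t. \<Psi> (\<gamma> t) = 0) (at 0)" for \<gamma> y
  proof -
    have "((\<lambda>t. \<Psi> (\<gamma> t)) \<longlongrightarrow> 0) (at (0::complex))"
      using tendsto_cong[OF that(2)] by simp
    with cont[OF that(1)] show ?thesis
      by (rule LIM_unique)
  qed
  have path: "((\<lambda>t. ncoords (\<xi>0 t) (\<xi>1 t) (p t) (q t) (r t) y i) \<longlongrightarrow> y i) (at 0)"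
    if "(\<xi>0 \<longlongrightarrow> y 0) (at 0)" "(\<xi>1 \<longlongrightarrow> y 1) (at 0)" "(p \<longlongrightarrow> y 2) (at 0)" "(q \<longlongrightarrow> y 3) (at 0)"
      "(r \<longlongrightarrow> y 4) (at 0)" for \<xi>0 \<xi>1 p q r :: "complex \<Rightarrow> complex" and y i
    using that by (cases "i \<in> {0, 1, 2, 3, 4}") (auto simp: ncoords_def)
  have tau: "((\<lambda>t. t) \<longlongrightarrow> 0) (at (0::complex))"
    by (rule tendsto_ident_at)
  have line: "((\<lambda>t. x + t * d) \<longlongrightarrow> x) (at 0)" for x d :: complex
    by (auto intro!: tendsto_eq_intros)
  have nz: "eventually (\<lambda>t::complex. t \<noteq> 0) (at 0)"
    by (rule eventually_neq_at_within)
  \<comment> \<open>For \<open>y 2\<close> nonzero the coordinates 2, 3, 4 move freely off the zeros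
    of \<open>b\<close>, and the equation prescribes the sum of squares of the first two.\<close>
  have stage1: "\<Psi> y = 0" if y: "normal_form a c y = 0" "y 2 \<noteq> 0" for y
  proof -
    obtain d1 d2 d3 where d: "eventually (\<lambda>t. b (y 2 + t * d1) (y 3 + t * d2) (y 4 + t * d3) \<noteq> 0) (at 0)"
      using b by blast
    define p q r where "p t = y 2 + t * d1" and "q t = y 3 + t * d2" and "r t = y 4 + t * d3" for t
    have pqr: "(p \<longlongrightarrow> y 2) (at 0)" "(q \<longlongrightarrow> y 3) (at 0)" "(r \<longlongrightarrow> y 4) (at 0)"
      unfolding p_def q_def r_def by (rule line)+
    define \<omega> where "\<omega> t = - (q t * ((p t)\<^sup>2 + (r t)\<^sup>2 + a * q t * p t + c * (q t)\<^sup>2)) / p t" for t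
    have "(\<omega> \<longlongrightarrow> - (y 3 * ((y 2)\<^sup>2 + (y 4)\<^sup>2 + a * y 3 * y 2 + c * (y 3)\<^sup>2)) / y 2) (at 0)"
      unfolding \<omega>_def by (intro tendsto_intros pqr y)
    also have "- (y 3 * ((y 2)\<^sup>2 + (y 4)\<^sup>2 + a * y 3 * y 2 + c * (y 3)\<^sup>2)) / y 2 = (y 0)\<^sup>2 + (y 1)\<^sup>2"
    proof -
      have "y 2 * ((y 0)\<^sup>2 + (y 1)\<^sup>2) = - (y 3 * ((y 2)\<^sup>2 + (y 4)\<^sup>2 + a * y 3 * y 2 + c * (y 3)\<^sup>2))"
        using y(1) unfolding normal_form_def by (simp only: eq_neg_iff_add_eq_0)
      then show ?thesis
        using y(2) by (metis nonzero_mult_div_cancel_left)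
    qed
    finally obtain \<xi>0 \<xi>1 where \<xi>: "(\<xi>0 \<longlongrightarrow> y 0) (at 0)" "(\<xi>1 \<longlongrightarrow> y 1) (at 0)"
      "\<And>t. (\<xi>0 t)\<^sup>2 + (\<xi>1 t)\<^sup>2 = \<omega> t"
      by (rule sum_squares_lift) blast
    show ?thesis
    proof (rule limit)
      show "((\<lambda>t. ncoords (\<xi>0 t) (\<xi>1 t) (p t) (q t) (r t) y i) \<longlongrightarrow> y i) (at 0)" for i
        by (rule path[OF \<xi>(1,2) pqr])
      have "eventually (\<lambda>t. p t \<noteq> 0) (at 0)"
        using pqr(1) y(2) by (rule tendsto_imp_eventually_ne)
      then show "eventually (\<lambda>t. \<Psi> (ncoords (\<xi>0 t) (\<xi>1 t) (p t) (q t) (r t) y) = 0) (at 0)"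
        using d
      proof eventually_elim
        fix t assume t: "p t \<noteq> 0" "b (y 2 + t * d1) (y 3 + t * d2) (y 4 + t * d3) \<noteq> 0"
        then show "\<Psi> (ncoords (\<xi>0 t) (\<xi>1 t) (p t) (q t) (r t) y) = 0"
          by (intro zero) (simp_all only: normal_form_ncoords ncoords_apply \<xi>(3) \<omega>_def, simp_all add: p_def q_def r_def)
      qed
    qed
  qed
  \<comment> \<open>For \<open>y 2 = 0\<close> this coordinate becomes t, and the others must move
    so that the prescribed sum of squares, a quotient by t, has the right limit.\<close>
  have stage2: "\<Psi> y = 0" if y: "y 2 = 0" and lim: "(p \<longlongrightarrow> y 3) (at 0)" "(r \<longlongrightarrow> y 4) (at 0)"
    "(\<omega> \<longlongrightarrow> (y 0)\<^sup>2 + (y 1)\<^sup>2) (at 0)"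
    and eq: "\<And>t. t * \<omega> t + p t * (t\<^sup>2 + (r t)\<^sup>2 + a * p t * t + c * (p t)\<^sup>2) = 0" for y p r \<omega>
  proof -
    obtain \<xi>0 \<xi>1 where \<xi>: "(\<xi>0 \<longlongrightarrow> y 0) (at 0)" "(\<xi>1 \<longlongrightarrow> y 1) (at 0)"
      "\<And>t. (\<xi>0 t)\<^sup>2 + (\<xi>1 t)\<^sup>2 = \<omega> t"
      using sum_squares_lift[OF lim(3)] by blast
    show ?thesis
    proof (rule limit)
      show "((\<lambda>t. ncoords (\<xi>0 t) (\<xi>1 t) t (p t) (r t) y i) \<longlongrightarrow> y i) (at 0)" for i
        by (rule path[OF \<xi>(1,2) _ lim(1,2)]) (simp add: y tau)
      show "eventually (\<lambda>t. \<Psi> (ncoords (\<xi>0 t) (\<xi>1 t) t (p t) (r t) y) = 0) (at 0)"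
        using nz
      proof eventually_elim
        fix t :: complex assume "t \<noteq> 0"
        then show "\<Psi> (ncoords (\<xi>0 t) (\<xi>1 t) t (p t) (r t) y) = 0"
          using eq[of t] by (intro stage1) (simp_all only: normal_form_ncoords ncoords_apply \<xi>(3) simp_thms not_False_eq_True)
      qed
    qed
  qed
  have stage2a: "\<Psi> y = 0" if y: "y 2 = 0" "y 3 = 0" "y 4 \<noteq> 0" for y
  proof -
    \<comment> \<open>Chosen so that the limit of \<open>\<omega>\<close>, which is
      \<open>- k * (y 4)\<^sup>2\<close>, is the sum of squares at \<open>y\<close>.\<close>
    define k where "k = - ((y 0)\<^sup>2 + (y 1)\<^sup>2) / (y 4)\<^sup>2"
    define \<omega> where "\<omega> t = - (k * (t\<^sup>2 + (y 4)\<^sup>2 + a * t\<^sup>2 * k + c * t\<^sup>2 * k\<^sup>2))" for t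
    have "(\<omega> \<longlongrightarrow> - (k * (0\<^sup>2 + (y 4)\<^sup>2 + a * 0\<^sup>2 * k + c * 0\<^sup>2 * k\<^sup>2))) (at 0)"
      unfolding \<omega>_def by (intro tendsto_intros)
    then have "(\<omega> \<longlongrightarrow> (y 0)\<^sup>2 + (y 1)\<^sup>2) (at 0)"
      using y by (simp add: k_def add.commute)
    moreover have "((\<lambda>t. t * k) \<longlongrightarrow> y 3) (at 0)"
      using line[of 0 k] y by simp
    moreover have "t * \<omega> t + (t * k) * (t\<^sup>2 + (y 4)\<^sup>2 + a * (t * k) * t + c * (t * k)\<^sup>2) = 0" for t
      by (simp add: \<omega>_def power2_eq_square algebra_simps)
    ultimately show ?thesis
      using stage2[of y "\<lambda>t. t * k" "\<lambda>_. y 4" \<omega>] y by simp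
  qed
  show ?thesis
  proof (cases "y 2 = 0")
    case False
    then show ?thesis
      using stage1 y by blast
  next
    case True
    then have prod: "y 3 * ((y 4)\<^sup>2 + c * (y 3)\<^sup>2) = 0"
      using y by (simp add: normal_form_def)
    consider "y 3 = 0" "y 4 \<noteq> 0" | "y 3 = 0" "y 4 = 0" | "y 3 \<noteq> 0"
      by blast
    then show ?thesis
    proof cases
      case 1
      then show ?thesis
        using stage2a True by blast
    next
      case 2
      \<comment> \<open>Such a point is the limit of points with nonzero \<open>y 4\<close>, which
        are already settled.\<close>
      show ?thesis
      proof (rule limit)
        show "((\<lambda>t. (y(4 := t)) i) \<longlongrightarrow> y i) (at 0)" for i
          using 2 tau by (cases "i = 4") auto
        show "eventually (\<lambda>t. \<Psi> (y(4 := t)) = 0) (at 0)"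
          using nz by eventually_elim (rule stage2a, use 2 True in auto)
      qed
    next
      case 3
      then have M: "(y 4)\<^sup>2 = - c * (y 3)\<^sup>2"
        using prod by (simp add: eq_neg_iff_add_eq_0)
      then have M0: "y 4 \<noteq> 0"
        using 3 c by auto
      \<comment> \<open>At t = 0 the factor of \<open>y 3\<close> vanishes; \<open>k\<close> solves
        the linear condition that its derivative imposes on the velocity of
        \<open>y 4\<close>.\<close>
      define k where "k = (- ((y 0)\<^sup>2 + (y 1)\<^sup>2) / y 3 - a * y 3) / (2 * y 4)"
      define \<omega> where "\<omega> t = - (y 3 * (t + a * y 3 + 2 * y 4 * k + t * k\<^sup>2))" for t
      have "(\<omega> \<longlongrightarrow> - (y 3 * (0 + a * y 3 + 2 * y 4 * k + 0 * k\<^sup>2))) (at 0)"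
        unfolding \<omega>_def by (intro tendsto_intros)
      moreover have "- (y 3 * (0 + a * y 3 + 2 * y 4 * k + 0 * k\<^sup>2)) = (y 0)\<^sup>2 + (y 1)\<^sup>2"
        using 3 M0 by (simp add: k_def field_simps)
      moreover have "t * \<omega> t + y 3 * (t\<^sup>2 + (y 4 + t * k)\<^sup>2 + a * y 3 * t + c * (y 3)\<^sup>2) = 0" for t
      proof -
        have sq: "(y 4 + t * k)\<^sup>2 = - c * (y 3)\<^sup>2 + 2 * y 4 * t * k + t\<^sup>2 * k\<^sup>2"
          by (simp add: power2_sum M power_mult_distrib)
        show ?thesis
          unfolding \<omega>_def sq by (simp add: power2_eq_square algebra_simps)
      qed
      ultimately show ?thesis
        using stage2[of y "\<lambda>_. y 3" "\<lambda>t. y 4 + t * k" \<omega>] True line by simp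
    qed
  qed
qed

lemma eventually_poly_nonzero:
  fixes q :: "complex poly"
  assumes "q \<noteq> 0"
  shows "eventually (\<lambda>t. poly q t \<noteq> 0) (at x)"
proof -
  have "finite {t. poly q t = 0}"
    using assms poly_roots_finite by blast
  then have "open (- ({t. poly q t = 0} - {x}))"
    by (intro open_Compl finite_imp_closed finite_Diff)
  moreover have "x \<in> - ({t. poly q t = 0} - {x})"
    by simp
  ultimately show ?thesis
    unfolding eventually_at_topological by (intro exI[of _ "- ({t. poly q t = 0} - {x})"]) auto
qed

lemma hcoords_proj_space: "x \<in> hcoords (proj_space n) \<longleftrightarrow> (\<exists>i\<le>n. x i \<noteq> 0) \<and> (\<forall>i>n. x i = 0)"
  by (auto simp: hcoords_def not_le)

lemma zclosed_hypersurface: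
  "multihomogeneous Bs d p \<Longrightarrow> zclosed Bs {x \<in> hcoords Bs. peval p x = 0}"
  unfolding zclosed_def by (intro exI[of _ "{p}"]) auto

text \<open>A given point is joined to \<open>w\<close> by a line, on which \<open>p\<close>
  vanishes at finitely many parameters only.\<close>

lemma dense_open_proj_space:
  assumes p: "multihomogeneous (proj_space n) d p" and w: "w \<in> hcoords (proj_space n)" "peval p w \<noteq> 0"
  shows "dense_open_in (proj_space n) {x \<in> hcoords (proj_space n). peval p x \<noteq> 0} (hcoords (proj_space n))"
  unfolding dense_open_in_def
proof (intro conjI allI impI)
  let ?Z = "{x \<in> hcoords (proj_space n). peval p x = 0}"
  have "{x \<in> hcoords (proj_space n). peval p x \<noteq> 0} = hcoords (proj_space n) - ?Z"
    by blast
  then show "\<exists>Z. zclosed (proj_space n) Z \<and> {x \<in> hcoords (proj_space n). peval p x \<noteq> 0} = hcoords (proj_space n) - Z"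
    using zclosed_hypersurface[OF p] by blast
  fix Z assume "zclosed (proj_space n) Z" and sub: "{x \<in> hcoords (proj_space n). peval p x \<noteq> 0} \<subseteq> Z"
  then obtain S where Z: "Z = {x \<in> hcoords (proj_space n). \<forall>s\<in>S. peval s x = 0}"
    by (auto simp: zclosed_def)
  show "hcoords (proj_space n) \<subseteq> Z"
  proof
    fix x assume x: "x \<in> hcoords (proj_space n)"
    have "peval s x = 0" if s: "s \<in> S" for s
    proof -
      define \<gamma> where "\<gamma> t i = poly [:x i, w i - x i:] t" for t i
      obtain q where q: "\<And>t. peval p (\<gamma> t) = poly q t"
        using poly_along_curve[of p "\<lambda>i. [:x i, w i - x i:]"] unfolding \<gamma>_def by blast
      have "\<gamma> 1 = w"
        by (intro ext) (simp add: \<gamma>_def)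
      then have "q \<noteq> 0"
        using q[of 1] w(2) by auto
      then have ev: "eventually (\<lambda>t. poly q t \<noteq> 0) (at 0)"
        by (rule eventually_poly_nonzero)
      have lim: "((\<lambda>t. \<gamma> t i) \<longlongrightarrow> x i) (at 0)" for i
      proof -
        have "((\<lambda>t. \<gamma> t i) \<longlongrightarrow> \<gamma> 0 i) (at 0)"
          unfolding \<gamma>_def by (intro tendsto_intros)
        then show ?thesis
          by (simp add: \<gamma>_def)
      qed
      obtain i where i: "i \<le> n" "x i \<noteq> 0"
        using x by (auto simp: hcoords_proj_space)
      have "eventually (\<lambda>t. \<gamma> t i \<noteq> 0) (at 0)"
        using lim[of i] i(2) by (rule tendsto_imp_eventually_ne)
      with ev have "eventually (\<lambda>t. peval s (\<gamma> t) = 0) (at 0)"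
      proof eventually_elim
        fix t assume t: "poly q t \<noteq> 0" "\<gamma> t i \<noteq> 0"
        have "\<gamma> t \<in> hcoords (proj_space n)"
          using t(2) i(1) x w(1) by (auto simp: hcoords_proj_space \<gamma>_def)
        then have "\<gamma> t \<in> Z"
          using sub t(1) q by auto
        then show "peval s (\<gamma> t) = 0"
          using s by (auto simp: Z)
      qed
      then have "((\<lambda>t. peval s (\<gamma> t)) \<longlongrightarrow> 0) (at 0)"
        by (rule tendsto_eventually)
      with tendsto_peval[OF lim] show ?thesis
        by (rule LIM_unique)
    qed
    then show "x \<in> Z"
      using x by (simp add: Z)
  qed
qed

section \<open>Rationality\<close>

lemma rform_var_space: "i \<le> n \<Longrightarrow> rform (proj_space n) (\<lambda>_. 1) (\<lambda>x. x i)"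
  by (rule rform_degree_cong[OF rform_var[of i "{..n}"]]) auto

lemma rform_sum_scaled: "(\<And>j. j \<in> A \<Longrightarrow> rform Bs d (f j)) \<Longrightarrow> rform Bs d (\<lambda>x. \<Sum>j\<in>A. of_real (r j) * f j x)"
  by (intro rform_sum rform_scale)

lemma peval_continuous_vec:
  assumes "\<And>i. ((\<lambda>t. \<gamma> t i) \<longlongrightarrow> y i) F"
  shows "((\<lambda>t. (\<Sum>k\<le>4. \<gamma> t k * of_real (e k i)) :: complex) \<longlongrightarrow> (\<Sum>k\<le>4. y k * of_real (e k i))) F"
  by (intro tendsto_intros assms)

context normal_cubic
begin

lemma rform_crd: "rform (proj_space 4) (\<lambda>_. 1) (crd k)"
  unfolding crd_def[abs_def] by (intro rform_sum_scaled rform_var_space) auto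

lemma dense_open_hypersurface:
  assumes b: "rform (proj_space 4) d (\<lambda>x. b (crd 2 x) (crd 3 x) (crd 4 x))"
    and dir: "\<And>y l m. \<exists>d1 d2 d3. eventually (\<lambda>t. b (y + t * d1) (l + t * d2) (m + t * d3) \<noteq> (0::complex)) (at 0)"
  shows "dense_open_in (proj_space 4) {x \<in> complex_points F. b (crd 2 x) (crd 3 x) (crd 4 x) \<noteq> 0} (complex_points F)"
  unfolding dense_open_in_def
proof (intro conjI allI impI)
  obtain p where p: "multihomogeneous (proj_space 4) d p" "\<And>x. peval p x = b (crd 2 x) (crd 3 x) (crd 4 x)"
    using b by (rule rformE) blast
  let ?Z = "{x \<in> hcoords (proj_space 4). peval p x = 0}"
  have "{x \<in> complex_points F. b (crd 2 x) (crd 3 x) (crd 4 x) \<noteq> 0} = complex_points F - ?Z"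
    by (auto simp: p(2) complex_points_def)
  then show "\<exists>Z. zclosed (proj_space 4) Z \<and>
      {x \<in> complex_points F. b (crd 2 x) (crd 3 x) (crd 4 x) \<noteq> 0} = complex_points F - Z"
    using zclosed_hypersurface[OF p(1)] by blast
  fix Z assume "zclosed (proj_space 4) Z"
    and sub: "{x \<in> complex_points F. b (crd 2 x) (crd 3 x) (crd 4 x) \<noteq> 0} \<subseteq> Z"
  then obtain S where Z: "Z = {x \<in> hcoords (proj_space 4). \<forall>s\<in>S. peval s x = 0}"
    by (auto simp: zclosed_def)
  show "complex_points F \<subseteq> Z"
  proof
    fix x assume x: "x \<in> complex_points F"
    have "peval s x = 0" if s: "s \<in> S" for s
    proof -
      have "peval s (vec (\<lambda>k. crd k x)) = 0"
      proof (rule hypersurface_density[where b = b and \<Psi> = "\<lambda>y. peval s (vec y)"])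
        show "complex_of_real c \<noteq> 0"
          using c_nz by simp
        show "((\<lambda>t. peval s (vec (\<gamma> t))) \<longlongrightarrow> peval s (vec y)) (at 0)"
          if "\<And>i. ((\<lambda>t. \<gamma> t i) \<longlongrightarrow> y i) (at (0::complex))" for \<gamma> y
          unfolding vec_def by (intro tendsto_peval peval_continuous_vec that)
        show "\<exists>d1 d2 d3. \<forall>\<^sub>F t in at 0. b (y + t * d1) (l + t * d2) (m + t * d3) \<noteq> 0" for y l m
          by (rule dir)
        show "peval s (vec y) = 0" if "nf y = 0" "y 2 \<noteq> 0" "b (y 2) (y 3) (y 4) \<noteq> 0" for y
        proof -
          have "vec y \<in> complex_points F"
            using that by (subst vec_in_complex_points) (auto intro!: exI[of _ "2::nat"])
          then have "vec y \<in> Z"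
            using sub that(3) by (auto simp: crd_vec)
          then show ?thesis
            using s by (simp add: Z)
        qed
        show "nf (\<lambda>k. crd k x) = 0"
          using x by (simp add: complex_points_iff)
      qed
      then show ?thesis
        using x vec_crd[of x] by (simp add: complex_points_iff)
    qed
    then show "x \<in> Z"
      using x by (simp add: Z complex_points_def)
  qed
qed

end

text \<open>The projection from the plane \<open>y 2 = 0 = y 4 - g * y 3\<close> turns the cubic into a family of
  quadric surfaces over the projective line with a section, which gives the parametrization
  \<open>solve\<close> and its inverse \<open>project\<close>.\<close>

definition project :: "complex \<Rightarrow> (nat \<Rightarrow> complex) \<Rightarrow> nat \<Rightarrow> complex" where
  "project g y = (\<lambda>j. if j = 0 then (y 4 - g * y 3) * y 3 else if j = 1 then y 2 * y 3
     else if j = 2 then y 0 * (y 4 - g * y 3) else if j = 3 then y 1 * (y 4 - g * y 3) else 0)"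

text \<open>Put A = y4 - g y3, u = y0 / y3, v = y1 / y3 and k = y2 / A. Dividing the cubic by A
  leaves a quadric that contains the point with y0 = y1 = y3 = 0, hence is linear in A: (k^2 + 1) A
  = - (k (u^2 + v^2) + a k + 2 g) y3. This form is the bracket, homogenized with
  \<open>t 0 = 1\<close>, \<open>t 1 = k\<close>, \<open>t 2 = u\<close>,
  \<open>t 3 = v\<close>.\<close>

definition det :: "complex \<Rightarrow> complex \<Rightarrow> (nat \<Rightarrow> complex) \<Rightarrow> complex" where
  "det a g t = t 1 * ((t 2)\<^sup>2 + (t 3)\<^sup>2) + a * t 1 * (t 0)\<^sup>2 + 2 * g * (t 0) ^ 3"

definition solve :: "complex \<Rightarrow> complex \<Rightarrow> (nat \<Rightarrow> complex) \<Rightarrow> nat \<Rightarrow> complex" where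
  "solve a g t = (\<lambda>j. if j = 0 then t 2 * t 0 * ((t 1)\<^sup>2 + (t 0)\<^sup>2) else if j = 1 then t 3 * t 0 * ((t 1)\<^sup>2 + (t 0)\<^sup>2)
     else if j = 2 then - (t 1 * det a g t) else if j = 3 then ((t 1)\<^sup>2 + (t 0)\<^sup>2) * (t 0)\<^sup>2
     else - (t 0 * det a g t) + g * (((t 1)\<^sup>2 + (t 0)\<^sup>2) * (t 0)\<^sup>2))"

lemma normal_form_solve: "normal_form a (- (g\<^sup>2)) (solve a g t) = 0"
proof -
  define d q where "d = det a g t" and "q = (t 1)\<^sup>2 + (t 0)\<^sup>2"
  have "normal_form a (- (g\<^sup>2)) (solve a g t) = q * (t 0)\<^sup>2 *
      (- (q * (t 1 * ((t 2)\<^sup>2 + (t 3)\<^sup>2) + a * t 1 * (t 0)\<^sup>2 + 2 * g * (t 0) ^ 3)) * d + d\<^sup>2 * q)"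
    unfolding normal_form_def solve_def d_def[symmetric] q_def[symmetric]
    by (simp add: q_def power2_eq_square power3_eq_cube algebra_simps)
  also have "\<dots> = 0"
    by (simp add: d_def det_def power2_eq_square algebra_simps)
  finally show ?thesis .
qed

lemma det_project:
  assumes "normal_form a (- (g\<^sup>2)) y = 0"
  shows "det a g (project g y) = - ((y 4 - g * y 3)\<^sup>2 * (y 3)\<^sup>2 * ((y 4 - g * y 3)\<^sup>2 + (y 2)\<^sup>2))"
proof -
  define A where "A = y 4 - g * y 3"
  have M: "y 4 = A + g * y 3"
    by (simp add: A_def)
  have "det a g (project g y) = A\<^sup>2 * y 3 * (normal_form a (- (g\<^sup>2)) y - y 3 * (A\<^sup>2 + (y 2)\<^sup>2))"
    unfolding det_def project_def normal_form_def A_def[symmetric]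
    by (simp add: M power2_eq_square power3_eq_cube algebra_simps)
  then show ?thesis
    unfolding assms A_def by (simp add: power2_eq_square algebra_simps)
qed

lemma solve_project:
  assumes "normal_form a (- (g\<^sup>2)) y = 0"
  defines "A \<equiv> y 4 - g * y 3"
  shows "k \<le> 4 \<Longrightarrow> solve a g (project g y) k = ((y 3) ^ 3 * A\<^sup>2 * (A\<^sup>2 + (y 2)\<^sup>2)) * y k"
proof -
  assume "k \<le> 4"
  then have k: "k = 0 \<or> k = 1 \<or> k = 2 \<or> k = 3 \<or> k = 4"
    by auto
  have M: "y 4 = A + g * y 3"
    by (simp add: A_def)
  show ?thesis
    using k unfolding solve_def det_project[OF assms(1)] unfolding project_def A_def[symmetric]
    by (elim disjE) (simp_all add: M power2_eq_square power3_eq_cube algebra_simps)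
qed

lemma project_solve:
  "j \<le> 3 \<Longrightarrow> project g (solve a g t) j = (- ((t 0)\<^sup>2 * det a g t * ((t 1)\<^sup>2 + (t 0)\<^sup>2))) * t j"
proof -
  assume "j \<le> 3"
  then have "j = 0 \<or> j = 1 \<or> j = 2 \<or> j = 3"
    by auto
  then show ?thesis
    unfolding project_def solve_def
    by (elim disjE) (simp_all add: power2_eq_square algebra_simps)
qed

abbreviation pform :: "nat \<Rightarrow> nat \<Rightarrow> ((nat \<Rightarrow> complex) \<Rightarrow> complex) \<Rightarrow> bool" where
  "pform n d \<equiv> rform (proj_space n) (\<lambda>_. d)"

lemma pform_mult: "pform n d f \<Longrightarrow> pform n e g \<Longrightarrow> k = d + e \<Longrightarrow> pform n k (\<lambda>x. f x * g x)"
  using rform_mult[of "proj_space n" "\<lambda>_. d" f "\<lambda>_. e" g] by simp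

lemma pform_power: "pform n d f \<Longrightarrow> k = m * d \<Longrightarrow> pform n k (\<lambda>x. f x ^ m)"
  using rform_power[of "proj_space n" "\<lambda>_. d" f m] by simp

lemma same_point_proj_space:
  "(x, y) \<in> same_point (proj_space n) \<longleftrightarrow> x \<in> hcoords (proj_space n) \<and> y \<in> hcoords (proj_space n) \<and>
    (\<exists>k. k \<noteq> 0 \<and> (\<forall>i\<le>n. y i = k * x i))"
  by (auto simp: same_point_def)

lemma case_sum_eq_iff: "case_sum x u = case_sum x' u' \<longleftrightarrow> x = x' \<and> u = u'"
  by (auto simp: fun_eq_iff split_sum_all)

lemma case_sum_hcoords:
  "case_sum x u \<in> hcoords (proj_prod n m) \<longleftrightarrow> x \<in> hcoords (proj_space n) \<and> u \<in> hcoords (proj_space m)"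
proof -
  have "(\<forall>i. i \<notin> \<Union>(proj_prod n m) \<longrightarrow> case_sum x u i = 0) \<longleftrightarrow> (\<forall>i>n. x i = 0) \<and> (\<forall>i>m. u i = 0)"
  proof -
    have "(\<forall>j\<in>{..k}. i \<noteq> j) \<longleftrightarrow> k < i" for i k :: nat
      by (metis atMost_iff not_le)
    then show ?thesis
      by (simp add: split_sum_all image_iff)
  qed
  then show ?thesis
    unfolding hcoords_proj_space by (auto simp: hcoords_def)
qed

lemma case_sum_same_point:
  "(case_sum x u, case_sum x' u') \<in> same_point (proj_prod n m) \<longleftrightarrow>
    (x, x') \<in> same_point (proj_space n) \<and> (u, u') \<in> same_point (proj_space m)"
  unfolding same_point_proj_space by (auto simp: same_point_def case_sum_hcoords)

lemma rform_Inl: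
  assumes "multihomogeneous (proj_space n) (\<lambda>_. d) p"
  shows "rform (proj_prod n m) (\<lambda>B. if B = Inl ` {..n} then d else 0) (\<lambda>z. peval p (\<lambda>i. z (Inl i)))"
proof (rule rform_degree_cong)
  show "rform (proj_prod n m) (\<lambda>B. \<Sum>C\<in>proj_space n. d * (if B = Inl ` {..n} then 1 else 0)) (\<lambda>z. peval p (\<lambda>i. z (Inl i)))"
  proof (rule rform_subst[OF assms])
    fix B i assume "B \<in> proj_space n" "i \<in> B"
    then have "rform (proj_prod n m) (\<lambda>B. if Inl i \<in> B then 1 else 0) (\<lambda>z. z (Inl i))"
      by (intro rform_var[of _ "Inl ` {..n}"]) auto
    then show "rform (proj_prod n m) (\<lambda>B. if B = Inl ` {..n} then 1 else 0) (\<lambda>z. z (Inl i))"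
      by (rule rform_degree_cong) (use \<open>B \<in> proj_space n\<close> \<open>i \<in> B\<close> in auto)
  qed auto
qed auto

context normal_cubic
begin

text \<open>The point of the second factor is kept fixed while the first one moves along the paths
  of \<open>hypersurface_density\<close>.\<close>

lemma dense_open_product:
  assumes b: "rform (proj_space 4) (\<lambda>_. d) (\<lambda>x. b (crd 2 x) (crd 3 x) (crd 4 x))"
    and dir: "\<And>y l m. \<exists>d1 d2 d3. eventually (\<lambda>t. b (y + t * d1) (l + t * d2) (m + t * d3) \<noteq> (0::complex)) (at 0)"
  shows "dense_open_in (proj_prod 4 m)
    {case_sum x u | x u. x \<in> complex_points F \<and> b (crd 2 x) (crd 3 x) (crd 4 x) \<noteq> 0 \<and> u \<in> hcoords (proj_space m)}
    {case_sum x u | x u. x \<in> complex_points F \<and> u \<in> hcoords (proj_space m)}"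
    (is "dense_open_in _ ?U ?X")
  unfolding dense_open_in_def
proof (intro conjI allI impI)
  obtain p where p: "multihomogeneous (proj_space 4) (\<lambda>_. d) p" "\<And>x. peval p x = b (crd 2 x) (crd 3 x) (crd 4 x)"
    using b by (rule rformE) blast
  obtain p' \<delta> where p': "multihomogeneous (proj_prod 4 m) \<delta> p'" "\<And>z. peval p' z = peval p (\<lambda>i. z (Inl i))"
    using rform_Inl[OF p(1), of m] by (rule rformE) blast
  let ?Z = "{z \<in> hcoords (proj_prod 4 m). peval p' z = 0}"
  have "?U = ?X - ?Z"
    by (auto simp: case_sum_hcoords case_sum_eq_iff p' p complex_points_def)
  then show "\<exists>Z. zclosed (proj_prod 4 m) Z \<and> ?U = ?X - Z"
    using zclosed_hypersurface[OF p'(1)] by blast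
  fix Z assume "zclosed (proj_prod 4 m) Z" and sub: "?U \<subseteq> Z"
  then obtain S where Z: "Z = {z \<in> hcoords (proj_prod 4 m). \<forall>s\<in>S. peval s z = 0}"
    by (auto simp: zclosed_def)
  show "?X \<subseteq> Z"
  proof
    fix z assume "z \<in> ?X"
    then obtain x u where z: "z = case_sum x u" and x: "x \<in> complex_points F" and u: "u \<in> hcoords (proj_space m)"
      by blast
    have "peval s (case_sum x u) = 0" if s: "s \<in> S" for s
    proof -
      have "peval s (case_sum (vec (\<lambda>k. crd k x)) u) = 0"
      proof (rule hypersurface_density[where b = b and \<Psi> = "\<lambda>y. peval s (case_sum (vec y) u)"])
        show "complex_of_real c \<noteq> 0"
          using c_nz by simp
        show "((\<lambda>t. peval s (case_sum (vec (\<gamma> t)) u)) \<longlongrightarrow> peval s (case_sum (vec y) u)) (at 0)"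
          if lim: "\<And>i. ((\<lambda>t. \<gamma> t i) \<longlongrightarrow> y i) (at (0::complex))" for \<gamma> y
        proof (rule tendsto_peval)
          fix i show "((\<lambda>t. case_sum (vec (\<gamma> t)) u i) \<longlongrightarrow> case_sum (vec y) u i) (at 0)"
            unfolding vec_def by (cases i) (auto intro!: peval_continuous_vec lim)
        qed
        show "\<exists>d1 d2 d3. \<forall>\<^sub>F t in at 0. b (y + t * d1) (l + t * d2) (m + t * d3) \<noteq> 0" for y l m
          by (rule dir)
        show "peval s (case_sum (vec y) u) = 0" if "nf y = 0" "y 2 \<noteq> 0" "b (y 2) (y 3) (y 4) \<noteq> 0" for y
        proof -
          have "vec y \<in> complex_points F"
            using that by (subst vec_in_complex_points) (auto intro!: exI[of _ "2::nat"])
          then have "case_sum (vec y) u \<in> ?U"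
            using that(3) u by (auto simp: crd_vec case_sum_eq_iff)
          then have "case_sum (vec y) u \<in> Z"
            using sub by blast
          then show ?thesis
            using s by (simp add: Z)
        qed
        show "nf (\<lambda>k. crd k x) = 0"
          using x by (simp add: complex_points_iff)
      qed
      then show ?thesis
        using x vec_crd[of x] by (simp add: complex_points_iff)
    qed
    then show "z \<in> Z"
      using x u by (simp add: Z z case_sum_hcoords complex_points_def)
  qed
qed

end

locale rational_cubic = normal_cubic +
  fixes g :: real
  assumes g: "g \<noteq> 0" "c = - (g\<^sup>2)"
begin

text \<open>The distinct factors of the multiplier in \<open>solve_project\<close>: where none
  vanishes, projecting and parametrizing returns the same point.\<close>

definition bad :: "complex \<Rightarrow> complex \<Rightarrow> complex \<Rightarrow> complex" where
  "bad y l m = l * (m - of_real g * l) * ((m - of_real g * l)\<^sup>2 + y\<^sup>2)"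

lemma bad_form: "pform 4 4 (\<lambda>x. bad (crd 2 x) (crd 3 x) (crd 4 x))"
  unfolding bad_def
  by (rule pform_mult pform_power rform_add rform_diff rform_scale rform_crd | simp)+

lemma bad_direction:
  "\<exists>d1 d2 d3. eventually (\<lambda>t. bad (y + t * d1) (l + t * d2) (m + t * d3) \<noteq> 0) (at 0)"
proof -
  \<comment> \<open>Along the direction (1, 1, 1 + g) all of l, m - g l and y grow with slope 1, so
    no leading coefficient cancels.\<close>
  define q where "q = [:l, 1:] * [:m - of_real g * l, 1:] * ([:m - of_real g * l, 1:]\<^sup>2 + [:y, 1:]\<^sup>2)"
  have "lead_coeff ([:m - of_real g * l, 1:]\<^sup>2 + [:y, 1:]\<^sup>2) = 2"
    by (simp add: power2_eq_square)
  then have "q \<noteq> 0"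
    unfolding q_def by (metis leading_coeff_0_iff mult_eq_0_iff one_neq_zero pCons_eq_0_iff zero_neq_numeral)
  then have "eventually (\<lambda>t. poly q t \<noteq> 0) (at 0)"
    by (rule eventually_poly_nonzero)
  moreover have "bad (y + t * 1) (l + t * 1) (m + t * (1 + of_real g)) = poly q t" for t
    by (simp add: bad_def q_def algebra_simps)
  ultimately show ?thesis
    by (intro exI[of _ 1] exI[of _ "1 + of_real g"]) (auto elim!: eventually_mono)
qed

abbreviation proj :: "(nat \<Rightarrow> complex) \<Rightarrow> nat \<Rightarrow> complex" where
  "proj x \<equiv> project (of_real g) (\<lambda>k. crd k x)"

abbreviation param :: "(nat \<Rightarrow> complex) \<Rightarrow> nat \<Rightarrow> complex" where
  "param t \<equiv> vec (solve (of_real a) (of_real g) t)"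

lemma proj_form: "pform 4 2 (\<lambda>x. proj x j)"
  unfolding project_def
  by (cases "j = 0"; cases "j = 1"; cases "j = 2"; cases "j = 3"; simp)
    (rule pform_mult rform_diff rform_scale rform_crd rform_0 | simp)+

lemma det_form: "pform 3 3 (det (of_real a) (of_real g))"
proof -
  have eq: "det (of_real a) (of_real g) =
      (\<lambda>t. t 1 * ((t 2)\<^sup>2 + (t 3)\<^sup>2) + of_real a * (t 1 * (t 0)\<^sup>2) + of_real (2 * g) * (t 0) ^ 3)"
    by (simp add: det_def fun_eq_iff)
  show ?thesis
    unfolding eq by (rule pform_mult pform_power rform_add rform_scale rform_var_space | simp)+
qed

lemma solve_form: "pform 3 4 (\<lambda>t. solve (of_real a) (of_real g) t k)"
proof -
  have q: "pform 3 2 (\<lambda>t. (t 1)\<^sup>2 + (t 0)\<^sup>2)"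
    by (rule pform_power rform_add rform_var_space | simp)+
  consider "k = 0" | "k = 1" | "k = 2" | "k = 3" | "k \<notin> {0, 1, 2, 3}"
    by auto
  then show ?thesis
  proof cases
    case 1
    have "pform 3 4 (\<lambda>t. t 2 * t 0 * ((t 1)\<^sup>2 + (t 0)\<^sup>2))"
      by (rule q pform_mult rform_var_space | simp)+
    with 1 show ?thesis
      by (simp add: solve_def)
  next
    case 2
    have "pform 3 4 (\<lambda>t. t 3 * t 0 * ((t 1)\<^sup>2 + (t 0)\<^sup>2))"
      by (rule q pform_mult rform_var_space | simp)+
    with 2 show ?thesis
      by (simp add: solve_def)
  next
    case 3
    have "pform 3 4 (\<lambda>t. - (t 1 * det (of_real a) (of_real g) t))"
      by (rule det_form rform_uminus pform_mult rform_var_space | simp)+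
    with 3 show ?thesis
      by (simp add: solve_def)
  next
    case 4
    have "pform 3 4 (\<lambda>t. ((t 1)\<^sup>2 + (t 0)\<^sup>2) * (t 0)\<^sup>2)"
      by (rule q pform_mult pform_power rform_var_space | simp)+
    with 4 show ?thesis
      by (simp add: solve_def)
  next
    case 5
    have "pform 3 4 (\<lambda>t. - (t 0 * det (of_real a) (of_real g) t) + of_real g * (((t 1)\<^sup>2 + (t 0)\<^sup>2) * (t 0)\<^sup>2))"
      by (rule q det_form rform_add rform_scale rform_uminus pform_mult pform_power rform_var_space | simp)+
    with 5 show ?thesis
      by (simp add: solve_def)
  qed
qed

lemma param_form: "pform 3 4 (\<lambda>t. param t i)"
proof -
  have "pform 3 4 (\<lambda>t. \<Sum>k\<le>4. of_real (e k i) * solve (of_real a) (of_real g) t k)"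
    by (intro rform_sum_scaled solve_form)
  then show ?thesis
    by (simp add: vec_def mult.commute)
qed

text \<open>The distinct factors of the multiplier in \<open>project_solve\<close>.\<close>

definition good :: "(nat \<Rightarrow> complex) \<Rightarrow> complex" where
  "good t = t 0 * ((t 1)\<^sup>2 + (t 0)\<^sup>2) * det (of_real a) (of_real g) t"

lemma good_form: "pform 3 6 good"
  unfolding good_def[abs_def]
  by (rule det_form pform_mult pform_power rform_add rform_var_space | simp)+

definition U :: "(nat \<Rightarrow> complex) set" where
  "U = {x \<in> complex_points F. bad (crd 2 x) (crd 3 x) (crd 4 x) \<noteq> 0}"

definition V :: "(nat \<Rightarrow> complex) set" where
  "V = {t \<in> hcoords (proj_space 3). good t \<noteq> 0}"

lemma U_dense: "dense_open_in (proj_space 4) U (complex_points F)"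
  unfolding U_def by (rule dense_open_hypersurface[OF bad_form bad_direction])

lemma V_dense: "dense_open_in (proj_space 3) V (hcoords (proj_space 3))"
proof -
  obtain p where p: "multihomogeneous (proj_space 3) (\<lambda>_. 6) p" "\<And>t. peval p t = good t"
    using good_form by (rule rformE) blast
  \<comment> \<open>At this point \<open>good\<close> takes the value 2 g.\<close>
  define w where "w = (\<lambda>i::nat. if i = 0 then 1 else 0 :: complex)"
  have "w \<in> hcoords (proj_space 3)" "good w \<noteq> 0"
    using g by (auto simp: hcoords_proj_space w_def good_def det_def)
  then show ?thesis
    using dense_open_proj_space[OF p(1), of w] by (simp add: V_def p(2))
qed

lemma proj_U:
  assumes x: "x \<in> U"
  shows "proj x \<in> V" "(x, param (proj x)) \<in> same_point (proj_space 4)"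
proof -
  define y where "y = (\<lambda>k. crd k x)"
  have x': "vec5 x" "x \<noteq> 0" "x = vec y"
    using x by (auto simp: U_def complex_points_iff y_def vec_crd)
  have nf: "normal_form (of_real a) (- ((of_real g)\<^sup>2)) y = 0"
    using x g(2) by (simp add: U_def complex_points_iff y_def)
  define A where "A = y 4 - of_real g * y 3"
  have nz: "y 3 \<noteq> 0" "A \<noteq> 0" "A\<^sup>2 + (y 2)\<^sup>2 \<noteq> 0"
    using x by (auto simp: U_def bad_def y_def A_def)
  have "(y 2 * y 3)\<^sup>2 + (A * y 3)\<^sup>2 = (y 3)\<^sup>2 * (A\<^sup>2 + (y 2)\<^sup>2)"
    by (simp add: power_mult_distrib algebra_simps)
  then have "(y 2 * y 3)\<^sup>2 + (A * y 3)\<^sup>2 \<noteq> 0"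
    using nz by simp
  then have "good (project (of_real g) y) \<noteq> 0"
    unfolding good_def det_project[OF nf] using nz by (simp add: project_def flip: A_def)
  moreover have "project (of_real g) y \<in> hcoords (proj_space 3)"
    using nz by (auto simp: hcoords_proj_space project_def simp flip: A_def intro!: exI[of _ "0::nat"])
  ultimately show "proj x \<in> V"
    by (simp add: V_def y_def)
  define k where "k = (y 3) ^ 3 * A\<^sup>2 * (A\<^sup>2 + (y 2)\<^sup>2)"
  have "vec (solve (of_real a) (of_real g) (project (of_real g) y)) = k \<odot> x"
  proof
    fix i
    have "vec (solve (of_real a) (of_real g) (project (of_real g) y)) i = (\<Sum>m\<le>4. k * y m * of_real (e m i))"
      unfolding vec_def by (rule sum.cong) (simp_all add: solve_project[OF nf] k_def A_def)
    also have "\<dots> = k * vec y i"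
      by (simp add: vec_def sum_distrib_left mult.assoc)
    finally show "vec (solve (of_real a) (of_real g) (project (of_real g) y)) i = (k \<odot> x) i"
      using x'(3) by simp
  qed
  moreover have k: "k \<noteq> 0"
    using nz by (simp add: k_def)
  moreover have "k \<odot> x \<noteq> 0"
    using k x'(2) by (auto simp: fun_eq_iff)
  ultimately show "(x, param (proj x)) \<in> same_point (proj_space 4)"
    unfolding same_point_space4 y_def[symmetric] using x' by auto
qed

lemma param_V:
  assumes t: "t \<in> V"
  shows "param t \<in> U" "(t, proj (param t)) \<in> same_point (proj_space 3)"
proof -
  define d q where "d = det (of_real a) (of_real g) t" and "q = (t 1)\<^sup>2 + (t 0)\<^sup>2"
  define y where "y = solve (of_real a) (of_real g) t"
  have nz: "t 0 \<noteq> 0" "q \<noteq> 0" "d \<noteq> 0"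
    using t by (auto simp: V_def good_def d_def q_def)
  have y: "y 2 = - (t 1 * d)" "y 3 = q * (t 0)\<^sup>2" "y 4 - of_real g * y 3 = - (t 0 * d)"
    by (simp_all add: y_def solve_def d_def q_def)
  have "nf y = 0"
    using normal_form_solve[of "of_real a" "of_real g" t] g(2) by (simp add: y_def)
  moreover have "y 3 \<noteq> 0"
    using nz y by simp
  ultimately have "vec y \<in> complex_points F"
    by (subst vec_in_complex_points) (auto intro!: exI[of _ "3::nat"])
  moreover have "bad (y 2) (y 3) (y 4) \<noteq> 0"
  proof -
    have "(- (t 0 * d))\<^sup>2 + (- (t 1 * d))\<^sup>2 = d\<^sup>2 * q"
      by (simp add: q_def power2_eq_square algebra_simps)
    then show ?thesis
      unfolding bad_def y(3) unfolding y(1,2) using nz by simp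
  qed
  ultimately show "param t \<in> U"
    by (simp add: U_def crd_vec flip: y_def)
  have "project (of_real g) (\<lambda>k. crd k (vec y)) = project (of_real g) y"
    by (intro ext) (simp add: project_def crd_vec)
  then have pr: "proj (param t) = project (of_real g) y"
    by (simp add: y_def)
  define k where "k = - ((t 0)\<^sup>2 * d * q)"
  have k: "k \<noteq> 0"
    using nz by (simp add: k_def)
  have pk: "project (of_real g) y j = k * t j" if "j \<le> 3" for j
    using project_solve[OF that] by (simp add: y_def k_def d_def q_def)
  have "project (of_real g) y \<in> hcoords (proj_space 3)"
    unfolding hcoords_proj_space
  proof
    show "\<exists>i\<le>3. project (of_real g) y i \<noteq> 0"
      using pk[of 0] k nz by (intro exI[of _ 0]) (simp del: One_nat_def)
    show "\<forall>i>3. project (of_real g) y i = 0"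
      by (simp add: project_def)
  qed
  then show "(t, proj (param t)) \<in> same_point (proj_space 3)"
    unfolding pr same_point_proj_space using t k pk by (auto simp: V_def)
qed

lemma rational: "rational_threefold F"
proof -
  have "\<exists>p. multihomogeneous (proj_space 4) (\<lambda>_. 2) p \<and> (\<forall>x. peval p x = proj x j)" for j
    using proj_form[of j] unfolding rform_def .
  then obtain G where G: "\<And>j. multihomogeneous (proj_space 4) (\<lambda>_. 2) (G j)" "\<And>j x. peval (G j) x = proj x j"
    by metis
  have "\<exists>p. multihomogeneous (proj_space 3) (\<lambda>_. 4) p \<and> (\<forall>t. peval p t = param t i)" for i
    using param_form[of i] unfolding rform_def .
  then obtain H where H: "\<And>i. multihomogeneous (proj_space 3) (\<lambda>_. 4) (H i)" "\<And>i t. peval (H i) t = param t i"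
    by metis
  have AG: "apply_forms (proj_space 3) G x = proj x" for x
    by (auto simp: apply_forms_def G(2) fun_eq_iff project_def)
  have AH: "apply_forms (proj_space 4) H t = param t" for t
    using vec5_vec by (auto simp: apply_forms_def H(2) fun_eq_iff vec5_def)
  show ?thesis
    unfolding rational_threefold_def birational_over_R_def
  proof (rule exI[of _ G], rule exI[of _ H], rule exI[of _ U], rule exI[of _ V], intro conjI ballI)
    show "rational_map_forms (proj_space 4) (proj_space 3) G" "rational_map_forms (proj_space 3) (proj_space 4) H"
      using G(1) H(1) by (auto simp: rational_map_forms_def)
  qed (simp_all only: AG AH U_dense V_dense proj_U param_V)
qed

text \<open>The factor is P^0, so the parametrization is kept and its second component is the
  constant 1.\<close>

lemma stably_rational: "stably_rational_threefold F"
proof -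
  define one :: "nat \<Rightarrow> complex" where "one = (\<lambda>i. if i = 0 then 1 else 0)"
  have one: "one \<in> hcoords (proj_space 0)" "u \<in> hcoords (proj_space 0) \<Longrightarrow> (u, one) \<in> same_point (proj_space 0)" for u
    unfolding hcoords_proj_space same_point_proj_space one_def by (auto intro!: exI[of _ "1 / u 0"])
  have "\<forall>j. \<exists>p. multihomogeneous (proj_prod 4 0) (\<lambda>B. if B = Inl ` {..4} then 2 else 0) p \<and>
      (\<forall>z. peval p z = proj (\<lambda>i. z (Inl i)) j)"
  proof
    fix j
    obtain p where p: "multihomogeneous (proj_space 4) (\<lambda>_. 2) p" "\<And>x. peval p x = proj x j"
      using proj_form[of j] by (rule rformE) blast
    from rform_Inl[OF p(1), of 0]
    show "\<exists>p. multihomogeneous (proj_prod 4 0) (\<lambda>B. if B = Inl ` {..4} then 2 else 0) p \<and>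
        (\<forall>z. peval p z = proj (\<lambda>i. z (Inl i)) j)"
      unfolding rform_def p(2) .
  qed
  from choice[OF this] obtain G where G: "\<And>j. multihomogeneous (proj_prod 4 0) (\<lambda>B. if B = Inl ` {..4} then 2 else 0) (G j)"
    "\<And>j z. peval (G j) z = proj (\<lambda>i. z (Inl i)) j"
    by blast
  have "\<exists>p. multihomogeneous (proj_space 3) (\<lambda>_. 4) p \<and> (\<forall>t. peval p t = param t i)" for i
    using param_form[of i] unfolding rform_def .
  then obtain H where H: "\<And>i. multihomogeneous (proj_space 3) (\<lambda>_. 4) (H i)" "\<And>i t. peval (H i) t = param t i"
    by metis
  obtain p1 :: "nat rpoly" where p1: "multihomogeneous (proj_space 3) (\<lambda>_. 0) p1" "\<And>x. peval p1 x = 1"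
    using rform_const[of "proj_space 3" 1] by (auto elim: rformE)
  define H' :: "nat + nat \<Rightarrow> nat rpoly" where "H' = case_sum H (\<lambda>_. p1)"
  define U' where "U' = {case_sum x u | x u. x \<in> complex_points F \<and> bad (crd 2 x) (crd 3 x) (crd 4 x) \<noteq> 0 \<and>
    u \<in> hcoords (proj_space 0)}"
  have U'_iff: "z \<in> U' \<longleftrightarrow> (\<exists>x u. z = case_sum x u \<and> x \<in> U \<and> u \<in> hcoords (proj_space 0))" for z
    by (auto simp: U'_def U_def)
  have AG: "apply_forms (proj_space (3 + 0)) G (case_sum x u) = proj x" for x u
    by (auto simp: apply_forms_def G(2) fun_eq_iff project_def)
  have AH: "apply_forms (proj_prod 4 0) H' t = case_sum (param t) one" for t
    using vec5_vec
    by (auto simp: apply_forms_def H(2) H'_def p1 one_def fun_eq_iff vec5_def image_iff split: sum.splits)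
      (metis atMost_iff not_le)
  show ?thesis
    unfolding stably_rational_threefold_def birational_over_R_def
  proof (rule exI[of _ 0], rule exI[of _ G], rule exI[of _ H'], rule exI[of _ U'], rule exI[of _ V], intro conjI ballI)
    show "rational_map_forms (proj_prod 4 0) (proj_space (3 + 0)) G"
      using G(1) by (auto simp: rational_map_forms_def)
    show "rational_map_forms (proj_space (3 + 0)) (proj_prod 4 0) H'"
      using H(1) p1(1) by (auto simp: rational_map_forms_def H'_def)
    show "dense_open_in (proj_prod 4 0) U'
        {case_sum x y |x y. x \<in> complex_points F \<and> y \<in> hcoords (proj_space 0)}"
      unfolding U'_def by (rule dense_open_product[OF bad_form bad_direction])
    show "dense_open_in (proj_space (3 + 0)) V (hcoords (proj_space (3 + 0)))"
      using V_dense by simp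
  next
    fix z assume "z \<in> U'"
    then obtain x u where z: "z = case_sum x u" "x \<in> U" "u \<in> hcoords (proj_space 0)"
      by (auto simp: U'_iff)
    show "apply_forms (proj_space (3 + 0)) G z \<in> V"
      unfolding z(1) AG by (rule proj_U(1)[OF z(2)])
    show "(z, apply_forms (proj_prod 4 0) H' (apply_forms (proj_space (3 + 0)) G z)) \<in> same_point (proj_prod 4 0)"
      unfolding z(1) AG AH case_sum_same_point using proj_U(2)[OF z(2)] one(2)[OF z(3)] by blast
  next
    fix t assume t: "t \<in> V"
    show "apply_forms (proj_prod 4 0) H' t \<in> U'"
      unfolding AH U'_iff using param_V(1)[OF t] one(1) by blast
    show "(t, apply_forms (proj_space (3 + 0)) G (apply_forms (proj_prod 4 0) H' t)) \<in> same_point (proj_space (3 + 0))"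
      unfolding AH AG using param_V(2)[OF t] by simp
  qed
qed

end

section \<open>Failure of stable rationality\<close>

lemma multihomogeneous_proj_space:
  "multihomogeneous (proj_space n) d p \<Longrightarrow> multihomogeneous (proj_space n) (\<lambda>_. d {..n}) p"
  by (simp add: multihomogeneous_def)

lemma multihomogeneous_0: "multihomogeneous Bs d 0"
  by (simp add: multihomogeneous_def)

lemma zclosed_empty: "zclosed Bs {}"
proof -
  have "multihomogeneous Bs (\<lambda>_. 0) (Poly_Mapping.single 0 1)"
    by (auto simp: multihomogeneous_def)
  from zclosed_hypersurface[OF this] show ?thesis
    by (simp add: peval_single mono_eval_def del: single_one)
qed

context normal_cubic
begin

lemma complex_points_nonempty: "complex_points F \<noteq> {}"
proof -
  have "vec (\<lambda>k. if k = 0 then 1 else 0) \<in> complex_points F"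
    by (subst vec_in_complex_points) (auto simp: normal_form_def)
  then show ?thesis
    by blast
qed

text \<open>Up to scaling, the generic point specializes to every point of the hypersurface at which
  \<open>y 2\<close> and \<open>b\<close> do not vanish; density settles the others.\<close>

lemma hypersurface_zero_on_generic:
  assumes p: "multihomogeneous (proj_space 4) (\<lambda>_. d) p" and c: "c > 0"
    and zero: "\<And>l m z. peval p (\<lambda>i. eval3 l m z (generic_point a c i)) = 0" and y: "nf y = 0"
  shows "peval p y = 0"
proof -
  define Q where "Q y l m = y\<^sup>2 + m\<^sup>2 + of_real a * l * y + of_real c * l\<^sup>2" for y l m :: complex
  define b where "b y l m = l * Q y l m" for y l m
  show ?thesis
  proof (rule hypersurface_density[where b = b and \<Psi> = "peval p", OF _ _ _ _ y])
    show "complex_of_real c \<noteq> 0"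
      using c_nz by simp
    show "((\<lambda>t. peval p (\<gamma> t)) \<longlongrightarrow> peval p y) (at 0)"
      if "\<And>i. ((\<lambda>t. \<gamma> t i) \<longlongrightarrow> y i) (at (0::complex))" for \<gamma> y
      by (rule tendsto_peval[OF that])
  next
    fix y l m :: complex
    \<comment> \<open>Large enough for 1 + a + c + k^2, the coefficient of t^2 in \<open>Q\<close>
      along (1, 1, k), to be positive.\<close>
    define k where "k = 1 + \<bar>1 + a + c\<bar>"
    define q1 where "q1 = [:y, 1:]\<^sup>2 + [:m, of_real k:]\<^sup>2 + smult (of_real a) ([:l, 1:] * [:y, 1:]) + smult (of_real c) ([:l, 1:]\<^sup>2)"
    have "1 + a + c + k * k > 0"
    proof -
      have "k * k \<ge> k * 1"
        by (intro mult_left_mono) (auto simp: k_def)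
      moreover have "k > - (1 + a + c)"
        using abs_ge_minus_self[of "1 + a + c"] unfolding k_def by linarith
      ultimately show ?thesis
        by linarith
    qed
    moreover have "coeff q1 2 = of_real (1 + a + c + k * k)"
      by (simp add: q1_def power2_eq_square coeff_mult numeral_2_eq_2 coeff_pCons)
    ultimately have "coeff q1 2 \<noteq> 0"
      by (metis of_real_eq_0_iff less_irrefl)
    then have "q1 \<noteq> 0"
      by auto
    then have "[:l, 1:] * q1 \<noteq> 0"
      by (intro no_zero_divisors) simp_all
    then have "eventually (\<lambda>t. poly ([:l, 1:] * q1) t \<noteq> 0) (at 0)"
      by (rule eventually_poly_nonzero)
    moreover have "b (y + t * 1) (l + t * 1) (m + t * of_real k) = poly ([:l, 1:] * q1) t" for t
      by (simp add: b_def Q_def q1_def algebra_simps power2_eq_square)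
    ultimately show "\<exists>d1 d2 d3. eventually (\<lambda>t. b (y + t * d1) (l + t * d2) (m + t * d3) \<noteq> 0) (at 0)"
      by (intro exI[of _ 1] exI[of _ "of_real k"]) (auto elim!: eventually_mono)
  next
    fix y assume y: "nf y = 0" "y 2 \<noteq> 0" "b (y 2) (y 3) (y 4) \<noteq> 0"
    define Z W where "Z = y 0 + \<i> * y 1" and "W = y 0 - \<i> * y 1"
    have ZW: "y 2 * (Z * W) = - (y 3 * Q (y 2) (y 3) (y 4))"
    proof -
      have "Z * W = (y 0)\<^sup>2 + (y 1)\<^sup>2"
        by (simp add: Z_def W_def power2_eq_square algebra_simps)
      then show ?thesis
        using y(1) unfolding normal_form_def Q_def by (simp only: eq_neg_iff_add_eq_0)
    qed
    then have Z: "Z \<noteq> 0"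
      using y(3) by (auto simp: b_def)
    \<comment> \<open>The scalar by which the specialized generic point differs from
      \<open>y\<close>: its coordinate 2 is z = Z / y2 instead of y2.\<close>
    define \<kappa> where "\<kappa> = Z / (y 2)\<^sup>2"
    define l m z where "l = y 3 / y 2" and "m = y 4 / y 2" and "z = Z / y 2"
    define R where "R = 1 + m\<^sup>2 + of_real a * l + of_real c * l\<^sup>2"
    have y34: "y 3 = l * y 2" "y 4 = m * y 2"
      using y(2) by (simp_all add: l_def m_def)
    have "Q (y 2) (l * y 2) (m * y 2) = (y 2)\<^sup>2 * R"
      by (simp add: Q_def R_def power2_eq_square algebra_simps)
    then have "y 2 * (Z * W) = y 2 * (- ((y 2)\<^sup>2 * (l * R)))"
      using ZW unfolding y34 by simp
    then have "Z * W = - ((y 2)\<^sup>2 * (l * R))"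
      using y(2) by (metis mult_left_cancel)
    then have "\<kappa> * W = - (l * R)"
      using y(2) by (simp add: \<kappa>_def)
    then have lQ: "l * (1 + m\<^sup>2 + of_real a * l + of_real c * l\<^sup>2) = - (\<kappa> * W)"
      by (simp add: R_def)
    have zz: "z\<^sup>2 = \<kappa> * Z" "z = \<kappa> * y 2" "l * z = \<kappa> * y 3" "m * z = \<kappa> * y 4"
      using y(2) by (simp_all add: z_def \<kappa>_def l_def m_def power2_eq_square)
    have y01: "y 0 = (Z + W) / 2" "y 1 = - \<i> * (Z - W) / 2"
      by (simp_all add: Z_def W_def)
    have "eval3 l m z (generic_point a c i) = \<kappa> * y i" if "i \<le> 4" for i
    proof -
      have "i = 0 \<or> i = 1 \<or> i = 2 \<or> i = 3 \<or> i = 4"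
        using that by auto
      then show ?thesis
        by (elim disjE) (simp_all only: eval3_generic_point lQ zz(1,3,4) y01, simp_all add: zz(2) field_simps)
    qed
    moreover have "i \<le> 4" if "mm \<in> Poly_Mapping.keys p" "i \<in> Poly_Mapping.keys mm" for i mm
      using p that by (auto simp: multihomogeneous_def)
    ultimately have "peval p (\<lambda>i. \<kappa> * y i) = peval p (\<lambda>i. eval3 l m z (generic_point a c i))"
      by (intro peval_cong) auto
    then have "\<kappa> ^ d * peval p y = 0"
      using zero peval_scale[OF p] by simp
    then show "peval p y = 0"
      using Z y(2) by (simp add: \<kappa>_def)
  qed
qed

text \<open>This rewrites the maps in the coordinates of the normal form and supplies the polynomial
  \<open>P\<close> for \<open>not_dominated_by_projective_space\<close>.\<close>

lemma no_retract_of_projective_space: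
  fixes g h :: "nat \<Rightarrow> nat rpoly"
  defines "H \<equiv> \<lambda>t i. if i \<le> 4 then peval (h i) t else 0"
  assumes c: "c > 0"
    and g: "\<And>j. multihomogeneous (proj_space 4) (\<lambda>_. d) (g j)"
    and h: "\<And>i. multihomogeneous (proj_space n) (\<lambda>_. e') (h i)"
    and image: "\<And>t. peval F (H t) = 0"
    and p: "multihomogeneous (proj_space 4) (\<lambda>_. \<delta>) p" and x0: "x0 \<in> complex_points F" "peval p x0 \<noteq> 0"
    and sect: "\<And>x. x \<in> complex_points F \<Longrightarrow> peval p x \<noteq> 0 \<Longrightarrow>
      (x, H (\<lambda>j. peval (g j) x)) \<in> same_point (proj_space 4)"
  shows False
proof -
  have vec_form: "pform 4 1 (\<lambda>y. vec y i)" for i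
  proof -
    have "pform 4 1 (\<lambda>y. \<Sum>k\<le>4. of_real (e k i) * y k)"
      by (intro rform_sum_scaled rform_var_space) simp
    then show ?thesis
      by (simp add: vec_def mult.commute)
  qed
  have subst: "\<exists>q'. multihomogeneous (proj_space 4) (\<lambda>_. k) q' \<and> (\<forall>y. peval q' y = peval q (vec y))"
    if q: "multihomogeneous (proj_space 4) (\<lambda>_. k) q" for q k
    using rform_subst[OF q, of "proj_space 4" "\<lambda>_ _. 1" "\<lambda>i y. vec y i"] vec_form by (simp add: rform_def)
  have "\<forall>j. \<exists>q. multihomogeneous (proj_space 4) (\<lambda>_. d) q \<and> (\<forall>y. peval q y = peval (g j) (vec y))"
    using subst[OF g] by blast
  from choice[OF this] obtain g' where g': "\<And>j. multihomogeneous (proj_space 4) (\<lambda>_. d) (g' j)"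
    "\<And>j y. peval (g' j) y = peval (g j) (vec y)"
    by blast
  obtain p' where p': "multihomogeneous (proj_space 4) (\<lambda>_. \<delta>) p'" "\<And>y. peval p' y = peval p (vec y)"
    using subst[OF p] by blast
  have "pform n e' (\<lambda>t. \<Sum>j\<le>4. of_real (D k j) * peval (h j) t)" for k
    by (intro rform_sum_scaled rform_peval h)
  then have "pform n e' (\<lambda>t. crd k (H t))" for k
    by (simp add: crd_def H_def)
  then have "\<forall>k. \<exists>q. multihomogeneous (proj_space n) (\<lambda>_. e') q \<and> (\<forall>t. peval q t = crd k (H t))"
    by (simp add: rform_def)
  from choice[OF this] obtain h' where h': "\<And>k. multihomogeneous (proj_space n) (\<lambda>_. e') (h' k)"
    "\<And>k t. peval (h' k) t = crd k (H t)"
    by blast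
  define P0 where "P0 = eval_in (\<lambda>r. [:[:[:of_real r:]:]:]) p' (generic_point a c)"
  \<comment> \<open>The factor z guarantees \<open>y 2 \<noteq> 0\<close> wherever \<open>P\<close>
    does not vanish, so that the generic point is a point of the threefold.\<close>
  define P where "P = P0 * [:0, 1:]"
  have evP0: "eval3 l m z P0 = peval p' (\<lambda>i. eval3 l m z (generic_point a c i))" for l m z
    unfolding P0_def ring_map.map_eval_in[OF ring_map_eval3] peval_eq_eval_in by (simp add: eval3_def)
  have evP: "eval3 l m z P = eval3 l m z P0 * z" for l m z
    by (simp add: P_def eval3_def)
  have "P0 \<noteq> 0"
  proof
    assume "P0 = 0"
    then have "peval p' (\<lambda>i. eval3 l m z (generic_point a c i)) = 0" for l m z
      using evP0[of l m z] by (simp add: eval3_def)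
    from hypersurface_zero_on_generic[OF p'(1) c this, of "\<lambda>k. crd k x0"] x0 show False
      by (simp add: p'(2) complex_points_iff vec_crd)
  qed
  then have "P \<noteq> 0"
    by (simp add: P_def)
  have sqrt_c: "sqrt c \<noteq> 0" "(sqrt c)\<^sup>2 = c"
    using c by simp_all
  show False
  proof (rule not_dominated_by_projective_space[of "sqrt c" a d g' n e' h' P])
    show "sqrt c \<noteq> 0" "a\<^sup>2 \<noteq> 4 * (sqrt c)\<^sup>2"
      using sqrt_c disc by simp_all
    show "multihomogeneous (proj_space 4) (\<lambda>_. d) (g' j)" for j
      by (rule g'(1))
    show "multihomogeneous (proj_space n) (\<lambda>_. e') (h' j)" for j
      by (rule h'(1))
    show "normal_form (of_real a) (of_real ((sqrt c)\<^sup>2)) (\<lambda>j. peval (h' j) t) = 0" for t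
    proof -
      have "vec5 (H t)"
        by (simp add: vec5_def H_def)
      from peval_F[OF this] image[of t] show ?thesis
        unfolding h'(2) sqrt_c(2) by simp
    qed
    show "P \<noteq> 0"
      by fact
    fix l m z y
    assume ev: "eval3 l m z P \<noteq> 0" and "y = (\<lambda>i. eval3 l m z (generic_point a ((sqrt c)\<^sup>2) i))"
    then have y: "y = (\<lambda>i. eval3 l m z (generic_point a c i))"
      unfolding sqrt_c(2) by simp
    have z: "z \<noteq> 0" "peval p' y \<noteq> 0"
      using ev by (auto simp: evP evP0 y)
    have y2: "y 2 = z"
      by (simp add: y eval3_generic_point)
    have "nf y = 0"
      unfolding y normal_form_def
      by (simp add: eval3_generic_point field_simps power2_eq_square)
    then have x: "vec y \<in> complex_points F"
      using z(1) y2 by (subst vec_in_complex_points) (auto intro!: exI[of _ "2::nat"])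
    then obtain k where k: "k \<noteq> 0" "H (\<lambda>j. peval (g j) (vec y)) = k \<odot> vec y"
      using sect[OF x] z(2) by (auto simp: p'(2) same_point_space4)
    have "crd i (k \<odot> x) = k * crd i x" for i x
      by (simp add: crd_def sum_distrib_left mult_ac)
    then have val: "peval (h' i) (\<lambda>j. peval (g' j) y) = k * y i" if "i \<le> 4" for i
      unfolding h'(2) g'(2) k(2) using crd_vec[OF that] by simp
    show "peval (h' 2) (\<lambda>k. peval (g' k) y) \<noteq> 0 \<and>
      (\<forall>i\<le>4. \<forall>j\<le>4. y i * peval (h' j) (\<lambda>k. peval (g' k) y) = y j * peval (h' i) (\<lambda>k. peval (g' k) y))"
      using k(1) z(1) y2 by (simp add: val)
  qed
qed

text \<open>Density extends the equation to all points of the projective space. To become an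
  identity of polynomials it must also hold at the zero vector, which follows by a limit, and for
  arbitrary values of the other variables, which do not occur in the forms.\<close>

lemma image_in_hypersurface:
  assumes V: "dense_open_in (proj_space n) V (hcoords (proj_space n))"
    and hom: "multihomogeneous (proj_space 4) (\<lambda>_. 3) F"
    and h: "\<And>i. multihomogeneous (proj_space n) (\<lambda>_. e') (h i)"
    and zero: "\<And>t. t \<in> V \<Longrightarrow> peval F (\<lambda>i. if i \<le> 4 then peval (h i) t else 0) = 0"
  shows "peval F (\<lambda>i. if i \<le> 4 then peval (h i) t else 0) = 0"
proof -
  have eq: "peval F (\<lambda>i. if i \<le> 4 then peval (h i) t else 0) = peval F (\<lambda>i. peval (h i) t)" for t
    using hom by (intro peval_cong) (auto simp: multihomogeneous_def)
  obtain q where q: "multihomogeneous (proj_space n) (\<lambda>_. 3 * e') q" "\<And>t. peval q t = peval F (\<lambda>i. peval (h i) t)"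
    using rform_subst[OF hom, of "proj_space n" "\<lambda>_ _. e'" "\<lambda>i. peval (h i)"] rform_peval[OF h] by (auto simp: rform_def)
  have "V \<subseteq> hcoords (proj_space n)"
    using V by (auto simp: dense_open_in_def)
  then have "V \<subseteq> {t \<in> hcoords (proj_space n). peval q t = 0}"
    using zero by (auto simp: eq q(2))
  then have on: "peval q t = 0" if "t \<in> hcoords (proj_space n)" for t
    using V zclosed_hypersurface[OF q(1)] that by (auto simp: dense_open_in_def)
  have "peval q t = 0" for t
  proof -
    define t' where "t' = (\<lambda>i. if i \<le> n then t i else 0)"
    have "peval q t' = peval q t"
      using q(1) by (intro peval_cong) (auto simp: multihomogeneous_def t'_def)
    moreover have "peval q t' = 0"
    proof (cases "\<exists>i\<le>n. t i \<noteq> 0")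
      case True
      then show ?thesis
        by (intro on) (auto simp: hcoords_proj_space t'_def)
    next
      case False
      define w :: "nat \<Rightarrow> complex" where "w = (\<lambda>i. if i = 0 then 1 else 0)"
      have "((\<lambda>s. peval q (\<lambda>i. s * w i)) \<longlongrightarrow> peval q t') (at 0)"
      proof (rule tendsto_peval)
        show "((\<lambda>s. s * w i) \<longlongrightarrow> t' i) (at 0)" for i
          using False by (auto simp: t'_def intro!: tendsto_eq_intros)
      qed
      moreover have "eventually (\<lambda>s. peval q (\<lambda>i. s * w i) = 0) (at 0)"
        using eventually_neq_at_within[of "0::complex"]
        by eventually_elim (intro on, auto simp: hcoords_proj_space w_def)
      then have "((\<lambda>s. peval q (\<lambda>i. s * w i)) \<longlongrightarrow> 0) (at 0)"
        by (rule tendsto_eventually)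
      ultimately show ?thesis
        by (rule LIM_unique)
    qed
    ultimately show ?thesis
      by simp
  qed
  then show ?thesis
    by (simp add: eq q(2))
qed

text \<open>Density excludes the empty set because the empty set is closed; one equation of the
  complement that is nonzero at a point of \<open>U\<close> then describes a neighbourhood inside
  \<open>U\<close>.\<close>

lemma dense_open_nonempty:
  assumes U: "dense_open_in Bs U X" and X: "X \<subseteq> hcoords Bs" "X \<noteq> {}"
  obtains z s d where "z \<in> X" "multihomogeneous Bs d s" "peval s z \<noteq> 0" "\<And>x. x \<in> X \<Longrightarrow> peval s x \<noteq> 0 \<Longrightarrow> x \<in> U"
proof -
  obtain Z where Z: "zclosed Bs Z" "U = X - Z"
    using U by (auto simp: dense_open_in_def)
  have "U \<noteq> {}"
    using U X(2) zclosed_empty[of Bs] by (auto simp: dense_open_in_def)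
  then obtain z where z: "z \<in> U"
    by blast
  obtain S where S: "\<And>s. s \<in> S \<Longrightarrow> \<exists>d. multihomogeneous Bs d s" "Z = {x \<in> hcoords Bs. \<forall>s\<in>S. peval s x = 0}"
    using Z(1) by (auto simp: zclosed_def)
  have "z \<in> X" "z \<notin> Z"
    using z Z by auto
  then obtain s where s: "s \<in> S" "peval s z \<noteq> 0"
    using X(1) by (auto simp: S(2))
  then show ?thesis
    using that[of z _ s] S \<open>z \<in> X\<close> Z(2) by blast
qed

lemma not_rational:
  assumes c: "c > 0" and hom: "multihomogeneous (proj_space 4) (\<lambda>_. 3) F"
  shows "\<not> rational_threefold F"
proof
  assume "rational_threefold F"
  then obtain G H U V where GH: "rational_map_forms (proj_space 4) (proj_space 3) G"
    "rational_map_forms (proj_space 3) (proj_space 4) H"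
    and U: "dense_open_in (proj_space 4) U (complex_points F)"
    and V: "dense_open_in (proj_space 3) V (hcoords (proj_space 3))"
    and UV: "\<forall>x\<in>U. apply_forms (proj_space 3) G x \<in> V \<and>
      (x, apply_forms (proj_space 4) H (apply_forms (proj_space 3) G x)) \<in> same_point (proj_space 4)"
    and VU: "\<forall>y\<in>V. apply_forms (proj_space 4) H y \<in> U \<and>
      (y, apply_forms (proj_space 3) G (apply_forms (proj_space 4) H y)) \<in> same_point (proj_space 3)"
    unfolding rational_threefold_def birational_over_R_def by (elim exE conjE) (rule that)
  obtain d where d: "\<And>j. j \<le> 3 \<Longrightarrow> multihomogeneous (proj_space 4) (\<lambda>_. d) (G j)"
    using GH(1) multihomogeneous_proj_space by (auto simp: rational_map_forms_def) blast
  obtain k where k: "\<And>j. j \<le> 4 \<Longrightarrow> multihomogeneous (proj_space 3) (\<lambda>_. k) (H j)"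
    using GH(2) multihomogeneous_proj_space by (auto simp: rational_map_forms_def) blast
  define g h where "g j = (if j \<le> 3 then G j else 0)" and "h i = (if i \<le> 4 then H i else 0)" for i j
  have gh: "multihomogeneous (proj_space 4) (\<lambda>_. d) (g j)" "multihomogeneous (proj_space 3) (\<lambda>_. k) (h i)" for i j
    using d k by (simp_all add: g_def h_def multihomogeneous_0)
  have AH: "apply_forms (proj_space 4) H t = (\<lambda>i. if i \<le> 4 then peval (h i) t else 0)" for t
    by (auto simp: apply_forms_def h_def)
  have AG: "apply_forms (proj_space 3) G x = (\<lambda>j. peval (g j) x)" for x
    by (auto simp: apply_forms_def g_def peval_0)
  obtain z s \<delta> where s: "z \<in> complex_points F" "multihomogeneous (proj_space 4) \<delta> s" "peval s z \<noteq> 0"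
    "\<And>x. x \<in> complex_points F \<Longrightarrow> peval s x \<noteq> 0 \<Longrightarrow> x \<in> U"
  proof (rule dense_open_nonempty[OF U _ complex_points_nonempty])
    show "complex_points F \<subseteq> hcoords (proj_space 4)"
      by (auto simp: complex_points_def)
  qed (rule that)
  have "peval F (\<lambda>i. if i \<le> 4 then peval (h i) t else 0) = 0" for t
  proof (rule image_in_hypersurface[OF V hom gh(2)])
    fix t assume "t \<in> V"
    then have "apply_forms (proj_space 4) H t \<in> complex_points F"
      using VU U by (auto simp: dense_open_in_def)
    then show "peval F (\<lambda>i. if i \<le> 4 then peval (h i) t else 0) = 0"
      by (simp add: AH complex_points_def)
  qed
  from no_retract_of_projective_space[where g = g, OF c gh this multihomogeneous_proj_space[OF s(2)] s(1,3)] show False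
    using UV s(4) unfolding AH AG by blast
qed

text \<open>Restricting the birational map to the threefold times a real point \<open>u0\<close>,
  and composing the inverse with the first projection, yields a retraction from a projective
  space.\<close>

lemma not_stably_rational:
  assumes c: "c > 0" and hom: "multihomogeneous (proj_space 4) (\<lambda>_. 3) F"
  shows "\<not> stably_rational_threefold F"
proof
  let ?X = "\<lambda>m. {case_sum x y |x y. x \<in> complex_points F \<and> y \<in> hcoords (proj_space m)}"
  assume "stably_rational_threefold F"
  then obtain m G H U V where GH: "rational_map_forms (proj_prod 4 m) (proj_space (3 + m)) G"
    "rational_map_forms (proj_space (3 + m)) (proj_prod 4 m) H"
    and U: "dense_open_in (proj_prod 4 m) U (?X m)"
    and V: "dense_open_in (proj_space (3 + m)) V (hcoords (proj_space (3 + m)))"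
    and UV: "\<forall>x\<in>U. apply_forms (proj_space (3 + m)) G x \<in> V \<and>
      (x, apply_forms (proj_prod 4 m) H (apply_forms (proj_space (3 + m)) G x)) \<in> same_point (proj_prod 4 m)"
    and VU: "\<forall>y\<in>V. apply_forms (proj_prod 4 m) H y \<in> U \<and>
      (y, apply_forms (proj_space (3 + m)) G (apply_forms (proj_prod 4 m) H y)) \<in> same_point (proj_space (3 + m))"
    unfolding stably_rational_threefold_def birational_over_R_def by (elim exE conjE) (rule that)
  define n where "n = 3 + m"
  obtain d where d: "\<And>j. j \<le> n \<Longrightarrow> multihomogeneous (proj_prod 4 m) d (G j)"
    using GH(1) by (auto simp: rational_map_forms_def n_def)
  obtain k where k: "\<And>j. j \<le> 4 \<Longrightarrow> multihomogeneous (proj_space n) (\<lambda>_. k) (H (Inl j))"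
    using GH(2) multihomogeneous_proj_space by (auto simp: rational_map_forms_def n_def) blast
  define u1 :: "nat \<Rightarrow> complex" where "u1 = (\<lambda>i. if i = 0 then 1 else 0)"
  have "u1 \<in> hcoords (proj_space m)"
    by (auto simp: hcoords_proj_space u1_def)
  then have X: "?X m \<noteq> {}" "?X m \<subseteq> hcoords (proj_prod 4 m)"
    using complex_points_nonempty by (auto simp: case_sum_hcoords complex_points_def)
  obtain z s \<delta> where s: "z \<in> ?X m" "multihomogeneous (proj_prod 4 m) \<delta> s" "peval s z \<noteq> 0"
    "\<And>x. x \<in> ?X m \<Longrightarrow> peval s x \<noteq> 0 \<Longrightarrow> x \<in> U"
    by (rule dense_open_nonempty[OF U X(2,1)]) (rule that)
  then obtain x0 u where z: "z = case_sum x0 u" "x0 \<in> complex_points F" "u \<in> hcoords (proj_space m)"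
    by blast
  obtain i0 where i0: "i0 \<le> m" "u i0 \<noteq> 0"
    using z(3) by (auto simp: hcoords_proj_space)
  \<comment> \<open>The second component is replaced by a real vector so that the restricted forms
    keep real coefficients. Multiplying \<open>s\<close> by a coordinate that is nonzero at
    \<open>u\<close> keeps the new vector nonzero.\<close>
  have "peval (s * Poly_Mapping.single (Poly_Mapping.single (Inr i0) 1) 1) z \<noteq> 0"
    using s(3) i0 by (simp add: peval_mult peval_single mono_eval_def z(1))
  then obtain y where y: "\<And>i. i \<in> Inr ` {..m} \<Longrightarrow> y i \<in> \<real>" "\<And>i. i \<notin> Inr ` {..m} \<Longrightarrow> y i = z i"
    "peval (s * Poly_Mapping.single (Poly_Mapping.single (Inr i0) 1) 1) y \<noteq> 0"
    by (rule real_coordinates_dense[rotated]) auto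
  define r where "r i = (if i \<le> m then Re (y (Inr i)) else 0)" for i
  define u0 where "u0 = real_vec r"
  have y_eq: "y = case_sum x0 u0"
  proof
    fix i show "y i = case_sum x0 u0 i"
    proof (cases i)
      case (Inl j)
      then show ?thesis
        using y(2)[of i] by (simp add: z(1) image_iff)
    next
      case (Inr j)
      show ?thesis
      proof (cases "j \<le> m")
        case True
        then show ?thesis
          using y(1)[of i] Inr by (simp add: u0_def real_vec_def r_def image_iff complex_is_Real_iff complex_eq_iff)
      next
        case False
        then show ?thesis
          using y(2)[of i] Inr z(3) by (simp add: u0_def real_vec_def r_def z(1) image_iff hcoords_proj_space)
      qed
    qed
  qed
  have s0: "peval s (case_sum x0 u0) \<noteq> 0" "u0 i0 \<noteq> 0"
    using y(3) unfolding y_eq by (simp_all add: peval_mult peval_single mono_eval_def)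
  have u0: "u0 \<in> hcoords (proj_space m)"
    using s0(2) i0 by (auto simp: hcoords_proj_space u0_def real_vec_def r_def)
  have restrict: "\<exists>q'. multihomogeneous (proj_space 4) (\<lambda>_. dd (Inl ` {..4})) q' \<and>
      (\<forall>x. peval q' x = peval q (case_sum x u0))"
    if q: "multihomogeneous (proj_prod 4 m) dd q" for q dd
  proof -
    have "rform (proj_space 4) (\<lambda>_. \<Sum>B\<in>proj_prod 4 m. dd B * (if B = Inl ` {..4} then 1 else 0))
        (\<lambda>x. peval q (\<lambda>i. case_sum x u0 i))"
    proof (rule rform_subst[OF q])
      fix B i assume B: "B \<in> proj_prod 4 m" "i \<in> B"
      show "pform 4 (if B = Inl ` {..4} then 1 else 0) (\<lambda>x. case_sum x u0 i)"
      proof (cases i)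
        case (Inl j)
        then have "B = Inl ` {..4}" "j \<le> 4"
          using B by auto
        then show ?thesis
          using Inl rform_var_space[of j 4] by simp
      next
        case (Inr j)
        then have "B \<noteq> Inl ` {..4}"
          using B by auto
        then show ?thesis
          using Inr rform_const[of "proj_space 4" "r j"] by (simp add: u0_def real_vec_def)
      qed
    qed auto
    moreover have "Inl ` {..4::nat} \<noteq> (Inr ` {..m} :: (nat + nat) set)"
      by auto
    ultimately show ?thesis
      by (simp add: rform_def)
  qed
  have "\<forall>j. \<exists>q. multihomogeneous (proj_space 4) (\<lambda>_. d (Inl ` {..4})) q \<and>
      (\<forall>x. peval q x = (if j \<le> n then peval (G j) (case_sum x u0) else 0))"
  proof
    fix j
    show "\<exists>q. multihomogeneous (proj_space 4) (\<lambda>_. d (Inl ` {..4})) q \<and>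
        (\<forall>x. peval q x = (if j \<le> n then peval (G j) (case_sum x u0) else 0))"
      using restrict[OF d, of j] multihomogeneous_0 peval_0 by (cases "j \<le> n") auto
  qed
  from choice[OF this] obtain g where g: "\<And>j. multihomogeneous (proj_space 4) (\<lambda>_. d (Inl ` {..4})) (g j)"
    "\<And>j x. peval (g j) x = (if j \<le> n then peval (G j) (case_sum x u0) else 0)"
    by blast
  obtain p where p: "multihomogeneous (proj_space 4) (\<lambda>_. \<delta> (Inl ` {..4})) p" "\<And>x. peval p x = peval s (case_sum x u0)"
    using restrict[OF s(2)] by blast
  define h where "h i = (if i \<le> 4 then H (Inl i) else 0)" for i
  have h: "multihomogeneous (proj_space n) (\<lambda>_. k) (h i)" for i
    using k by (simp add: h_def multihomogeneous_0)
  have AH: "\<exists>v. apply_forms (proj_prod 4 m) H t = case_sum (\<lambda>i. if i \<le> 4 then peval (h i) t else 0) v" for t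
  proof
    show "apply_forms (proj_prod 4 m) H t = case_sum (\<lambda>i. if i \<le> 4 then peval (h i) t else 0)
        (\<lambda>i. apply_forms (proj_prod 4 m) H t (Inr i))"
      by (auto simp: fun_eq_iff split_sum_all apply_forms_def h_def)
  qed
  have AG: "apply_forms (proj_space (3 + m)) G (case_sum x u0) = (\<lambda>j. peval (g j) x)" for x
    by (auto simp: apply_forms_def g(2) n_def)
  have "peval F (\<lambda>i. if i \<le> 4 then peval (h i) t else 0) = 0" for t
  proof (rule image_in_hypersurface[OF V[folded n_def] hom h])
    fix t assume "t \<in> V"
    then have "apply_forms (proj_prod 4 m) H t \<in> ?X m"
      using VU U by (auto simp: dense_open_in_def)
    then have "(\<lambda>i. if i \<le> 4 then peval (h i) t else 0) \<in> complex_points F"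
      using AH[of t] by (auto simp: case_sum_eq_iff)
    then show "peval F (\<lambda>i. if i \<le> 4 then peval (h i) t else 0) = 0"
      by (simp add: complex_points_def)
  qed
  moreover have "peval p x0 \<noteq> 0"
    using s0 by (simp add: p(2))
  ultimately show False
  proof (rule no_retract_of_projective_space[OF c g(1) h _ p(1) z(2)])
    fix x assume x: "x \<in> complex_points F" "peval p x \<noteq> 0"
    then have "case_sum x u0 \<in> U"
      using u0 by (intro s(4)) (auto simp: p(2))
    then have "(case_sum x u0, apply_forms (proj_prod 4 m) H (\<lambda>j. peval (g j) x)) \<in> same_point (proj_prod 4 m)"
      using UV AG by metis
    then show "(x, \<lambda>i. if i \<le> 4 then peval (h i) (\<lambda>j. peval (g j) x) else 0) \<in> same_point (proj_space 4)"
      using AH[of "\<lambda>j. peval (g j) x"] by (auto simp: case_sum_same_point)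
  qed
qed

end

theorem proposition4p5:
  fixes F :: "nat rpoly"
  assumes "cubic_threefold F"
    and "\<forall>P\<in>singular_locus F. \<not> real_point P"
    and "has_2D4_2A1_singularities F"
  shows "(\<not> rational_threefold F \<longleftrightarrow> \<not> stably_rational_threefold F) \<and>
         (\<not> stably_rational_threefold F \<longleftrightarrow> (\<exists>!L. contains_real_plane F L))"
proof -
  obtain e D :: "nat \<Rightarrow> nat \<Rightarrow> real" and a c :: real where nf: "c \<noteq> 0" "a\<^sup>2 \<noteq> 4 * c"
    "\<And>k i. i > 4 \<Longrightarrow> e k i = 0"
    "\<And>j k. j \<le> 4 \<Longrightarrow> k \<le> 4 \<Longrightarrow> (\<Sum>i\<le>4. D j i * e k i) = (if j = k then 1 else 0)"
    "\<And>x. vec5 x \<Longrightarrow> x = (\<lambda>i. \<Sum>k\<le>4. (\<Sum>j\<le>4. of_real (D k j) * x j) * of_real (e k i))"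
    "\<And>x. vec5 x \<Longrightarrow>
      peval F x = 3/2 * normal_form (of_real a) (of_real c) (\<lambda>k. \<Sum>j\<le>4. of_real (D k j) * x j)"
    by (rule normal_form_exists[OF assms]) (rule that)
  interpret normal_cubic F e D a c
    by unfold_locales (fact nf)+
  have hom: "multihomogeneous (proj_space 4) (\<lambda>_. 3) F"
    using assms(1) by (simp add: cubic_threefold_def)
  show ?thesis
  \<comment> \<open>The three properties hold together for positive \<open>c\<close> and fail
    together for negative \<open>c\<close>, so the equivalences follow without proving any
    implication between them.\<close>
  proof (cases "c > 0")
    case True
    then show ?thesis
      using not_rational[OF True hom] not_stably_rational[OF True hom] unique_plane by simp
  next
    case False
    then have "c < 0"
      using nf(1) by simp
    then interpret rational_cubic F e D a c "sqrt (- c)"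
      by unfold_locales simp_all
    show ?thesis
      using rational stably_rational two_planes[OF \<open>c < 0\<close>] by simp
  qed
qed

end
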